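(* Let $n\ge 1$, $\Lambda\ge 1$, and let $u\in C(\overline{B_1})$, where $B_1\subset\mathbb{R}^n$ is the open unit ball, satisfy $M_\Lambda^-(D^2u)\le 0$ in $B_1$ in the viscosity sense. Then for all $t\ge 2$, $$\bigl|\{x\in B_1:\ \underline{\Theta}_u(x) > 64\|u\|_{L^\infty(B_1)}\,t\}\cap B_{1/2}\bigr| \le |B_2|\,t^{-\epsilon},\qquad \epsilon = 2^{-2}(2n\Lambda)^{1-n}.$$
   Context: For a symmetric $n\times n$ matrix $N$, the Pucci operator is $M_\Lambda^-(N) := (\text{sum of positive eigenvalues of }N) + \Lambda\,(\text{sum of negative eigenvalues of }N)$. For a bounded domain $\Omega$ and $u,\varphi\in C(\overline{\Omega})$, $\varphi$ is tangent from below to $u$ in $\Omega$ at $x_0\in\Omega$ if $\varphi\le u$ in $\overline\Omega$ and $\varphi(x_0)=u(x_0)$. $M_\Lambda^-(D^2u)\le 0$ in the viscosity sense in $\Omega$ means: $M_\Lambda^-(D^2\varphi(x_0))\le 0$ whenever $\varphi\in C^2(\overline\Omega)$ is tangent from below to $u$ in $\Omega$ at some $x_0\in\Omega$. A paraboloid has opening $a$ if its Hessian is $aI$. For $x\in\Omega$, $\underline{\Theta}_u(x)$ is the smallest $a\ge 0$ such that some paraboloid of opening $-a$ is tangent from below to $u$ in $\Omega$ at $x$, and $\underline{\Theta}_u(x)=\infty$ if no such paraboloid exists; here $\Omega=B_1$. $|\cdot|$ denotes Lebesgue measure and $B_r$ the ball of radius $r$ centered at the origin. *)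

theory Defs
  imports "HOL-Analysis.Analysis"
begin

text \<open>Pucci minimal operator of a symmetric matrix N: eigenvalues (with multiplicity)
  are read off an orthonormal eigenbasis (which exists and determines the eigenvalue
  multiset uniquely for symmetric N).\<close>
definition pucci_minus :: "real \<Rightarrow> real^'n^'n \<Rightarrow> real" where
  "pucci_minus \<Lambda> N = (SOME s. \<exists>(b :: 'n \<Rightarrow> real^'n) (lam :: 'n \<Rightarrow> real).
      (\<forall>i j. b i \<bullet> b j = (if i = j then 1 else 0)) \<and>
      (\<forall>i. N *v b i = lam i *\<^sub>R b i) \<and>
      s = (\<Sum>i\<in>UNIV. if lam i > 0 then lam i else \<Lambda> * lam i))"

text \<open>phi is C^2 on the closure of Omega, with gradient g and Hessian H
  (derivatives on Omega extending continuously to the closure).\<close>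
definition C2_closure ::
  "(real^'n \<Rightarrow> real) \<Rightarrow> (real^'n \<Rightarrow> real^'n) \<Rightarrow> (real^'n \<Rightarrow> real^'n^'n) \<Rightarrow> (real^'n) set \<Rightarrow> bool" where
  "C2_closure \<phi> g H \<Omega> \<longleftrightarrow> continuous_on (closure \<Omega>) \<phi> \<and>
     (\<forall>x\<in>\<Omega>. (\<phi> has_derivative (\<lambda>h. g x \<bullet> h)) (at x) \<and>
               (g has_derivative (\<lambda>h. H x *v h)) (at x)) \<and>
     uniformly_continuous_on \<Omega> g \<and> uniformly_continuous_on \<Omega> H"

definition tangent_below ::
  "(real^'n \<Rightarrow> real) \<Rightarrow> (real^'n \<Rightarrow> real) \<Rightarrow> (real^'n) set \<Rightarrow> real^'n \<Rightarrow> bool" where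
  "tangent_below \<phi> u \<Omega> x0 \<longleftrightarrow> x0 \<in> \<Omega> \<and> (\<forall>x\<in>closure \<Omega>. \<phi> x \<le> u x) \<and> \<phi> x0 = u x0"

definition visc_pucci_super :: "real \<Rightarrow> (real^'n \<Rightarrow> real) \<Rightarrow> (real^'n) set \<Rightarrow> bool" where
  "visc_pucci_super \<Lambda> u \<Omega> \<longleftrightarrow>
     (\<forall>\<phi> g H x0. C2_closure \<phi> g H \<Omega> \<and> tangent_below \<phi> u \<Omega> x0 \<longrightarrow> pucci_minus \<Lambda> (H x0) \<le> 0)"

text \<open>Smallest a \<ge> 0 such that a paraboloid of opening -a (Hessian -aI) touches u from
  below at x; infinity if none exists (Inf of the empty set of ereals is top).\<close>
definition Theta_low :: "(real^'n \<Rightarrow> real) \<Rightarrow> (real^'n) set \<Rightarrow> real^'n \<Rightarrow> ereal" where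
  "Theta_low u \<Omega> x = Inf (ereal ` {a. a \<ge> 0 \<and>
      (\<exists>b c. tangent_below (\<lambda>y. c + b \<bullet> y - a / 2 * (norm y)\<^sup>2) u \<Omega> x)})"

end

theory Submission
  imports Defs
begin

text \<open>
  Let \<open>M\<close> be the supremum of \<open>\<bar>u\<bar>\<close>. Replacing \<open>u\<close> by its minimum \<open>v\<close> with a concave paraboloid, and by
  that paraboloid outside the unit ball, gives a supersolution on the whole space that agrees with
  \<open>u\<close> on the ball of radius \<open>1/2\<close>, so no localization is needed. Let \<open>A(a)\<close> be the closed set of points
  at which \<open>v\<close> is touched from below by a paraboloid of opening \<open>-a\<close>. The claim is that
  \<open>\<bar>A(2a) - A(a)\<bar>\<close> is at least a fixed fraction of the measure of the complement of \<open>A(a)\<close>; iterating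
  over dyadic \<open>a\<close> gives the power decay.

  For the claim, let \<open>\<Gamma>\<^sub>a\<close> be the convex envelope of \<open>v + a/2 \<bar>x\<bar>\<^sup>2\<close>, so that \<open>A(a)\<close> is where the two agree, and
  slide paraboloids of opening \<open>-2a\<close> with slopes taken from the (expanding) subdifferential of
  \<open>\<Gamma>\<^sub>a + a/2 \<bar>x\<bar>\<^sup>2\<close> off \<open>A(a)\<close>. They touch \<open>v\<close> at points of \<open>A(2a)\<close>, and not in \<open>A(a)\<close>, because a supersolution
  admits only one slope of touching paraboloids at a point. Hence the set of these slopes has measure at least
  \<open>a\<^sup>n\<close> times that of the complement of \<open>A(a)\<close>. Conversely, the slopes arising from
  \<open>S = A(2a) - A(a)\<close> have measure at most \<open>(n \<Lambda>)\<^bsup>n-1\<^esup> (2a)\<^sup>n \<bar>S\<bar>\<close>: the Hessian \<open>H\<close> of \<open>v\<close> from below satisfies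
  \<open>H \<ge> -2a\<close> and the Pucci inequality, so at least one factor of \<open>det (I + H/2a)\<close> is at most \<open>1\<close> and the
  others are at most \<open>n \<Lambda>\<close>. To have Hessians almost everywhere, both sides are parametrized by
  the Lipschitz gradient of the convex conjugate of \<open>\<Gamma>\<^sub>b + b/2 \<bar>x\<bar>\<^sup>2\<close> with \<open>b = 2a\<close>, which is differentiable
  almost everywhere by Rademacher's theorem.
\<close>

section \<open>Symmetric matrices\<close>

text \<open>Since \<open>v\<close> is only continuous, its Hessian need not exist; what is
  differentiable almost everywhere is the gradient of the conjugate, a map from slopes to points. If
  the Hessian is H, that map has derivative M = (H + 2b)^(-1), while the slope map x -> Dv + b x has
  Jacobian H + b, so slopes expand relative to points by det (I - b M) / det M. Doubling the opening
  is what closes the slope argument: with b = 2a, equal slopes p - a z = q - b z at a point z give q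
  = p + a z, so q already belongs to the contact point z. Passing from points to slopes at opening
  -a gains a^n and the contact estimate costs (2a)^n, hence the 2^n in c = 1 / (2^n (n
  \<Lambda>)^(n-1)); the stated exponent is c / 2. The barrier 3M - 8M |x|^2 has opening -16M,
  opening -32M confines the noncontact set to the ball of radius 2, and k doublings with 2^k <= 2t
  end at an opening of size at most 64 M t.\<close>

definition eigenbasis :: "real^'n^'n \<Rightarrow> ('n \<Rightarrow> real^'n) \<Rightarrow> ('n \<Rightarrow> real) \<Rightarrow> bool" where
  "eigenbasis N e lam \<longleftrightarrow>
     (\<forall>i j. e i \<bullet> e j = (if i = j then 1 else 0)) \<and> (\<forall>i. N *v e i = lam i *\<^sub>R e i)"

lemma symmetric_inner:
  fixes A :: "real^'n^'n"
  assumes "transpose A = A"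
  shows "x \<bullet> (A *v y) = (A *v x) \<bullet> y"
  by (metis assms dot_lmul_matrix transpose_matrix_vector)

text \<open>A maximizer \<open>x\<close> of the Rayleigh quotient on the unit sphere of
  \<open>S\<close> is an eigenvector: the residual \<open>w\<close> lies in \<open>S\<close> by
  invariance, and moving \<open>x\<close> a little along \<open>w\<close> would increase the
  quotient unless \<open>w = 0\<close>.\<close>

lemma symmetric_eigenvector_in_subspace:
  fixes A :: "real^'n^'n"
  assumes A: "transpose A = A" and S: "subspace S" "\<And>x. x \<in> S \<Longrightarrow> A *v x \<in> S"
    and z: "z \<in> S" "z \<noteq> 0"
  obtains x l where "x \<in> S" "norm x = 1" "A *v x = l *\<^sub>R x"
proof -
  let ?K = "S \<inter> sphere 0 1"
  have "compact ?K"
    using closed_subspace[OF S(1)] by (simp add: closed_Int_compact)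
  moreover have "(1 / norm z) *\<^sub>R z \<in> ?K"
    using z S(1) by (auto simp: subspace_scale)
  then have "?K \<noteq> {}" by blast
  moreover have "continuous_on ?K (\<lambda>x. x \<bullet> (A *v x))"
    by (intro continuous_intros matrix_vector_mult_linear_continuous_on)
  ultimately obtain x where x: "x \<in> ?K" and mx: "\<And>y. y \<in> ?K \<Longrightarrow> y \<bullet> (A *v y) \<le> x \<bullet> (A *v x)"
    using continuous_attains_sup[of ?K "\<lambda>x. x \<bullet> (A *v x)"] by blast
  define l where "l = x \<bullet> (A *v x)"
  have xx: "x \<bullet> x = 1" using x by (simp add: norm_eq_1)
  have nn: "y \<bullet> (A *v y) \<le> l * (y \<bullet> y)" if "y \<in> S" for y
  proof (cases "y = 0")
    case False
    let ?y = "(1 / norm y) *\<^sub>R y"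
    have "?y \<in> ?K" using that S(1) False by (auto simp: subspace_scale)
    then have "?y \<bullet> (A *v ?y) \<le> l" using mx l_def by blast
    then show ?thesis using False
      by (simp add: matrix_vector_mult_scaleR field_simps power2_norm_eq_inner[symmetric] power2_eq_square)
  qed simp
  define w where "w = A *v x - l *\<^sub>R x"
  have wS: "w \<in> S" unfolding w_def using S x by (simp add: subspace_diff subspace_scale)
  have "w \<bullet> w = 0"
  proof (rule ccontr)
    assume "w \<bullet> w \<noteq> 0"
    then have pos: "w \<bullet> w > 0" by (simp add: inner_gt_zero_iff)
    define q where "q = l * (w \<bullet> w) - w \<bullet> (A *v w)"
    have "q \<ge> 0" unfolding q_def using nn[OF wS] by simp
    \<comment> \<open>Small enough that the second-order loss \<open>t * q\<close> is at most
      \<open>w \<bullet> w\<close>, while maximality forces it to be at least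
      \<open>2 * (w \<bullet> w)\<close>; the \<open>+ 1\<close> covers
      \<open>q = 0\<close>.\<close>
    define t where "t = (w \<bullet> w) / (q + 1)"
    have t: "t > 0" unfolding t_def using pos \<open>q \<ge> 0\<close> by simp
    have "x + t *\<^sub>R w \<in> S" using x wS S(1) by (simp add: subspace_add subspace_scale)
    from nn[OF this] have "(x + t *\<^sub>R w) \<bullet> (A *v (x + t *\<^sub>R w)) \<le> l * ((x + t *\<^sub>R w) \<bullet> (x + t *\<^sub>R w))" .
    moreover have "(x + t *\<^sub>R w) \<bullet> (A *v (x + t *\<^sub>R w)) = l + 2 * t * (w \<bullet> (A *v x)) + t\<^sup>2 * (w \<bullet> (A *v w))"
      using symmetric_inner[OF A, of x w]
      by (simp add: matrix_vector_mult_scaleR matrix_vector_right_distrib inner_add_left inner_add_right l_def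
         power2_eq_square algebra_simps inner_commute)
    moreover have "(x + t *\<^sub>R w) \<bullet> (x + t *\<^sub>R w) = 1 + 2 * t * (w \<bullet> x) + t\<^sup>2 * (w \<bullet> w)"
      using xx by (simp add: inner_add_left inner_add_right power2_eq_square algebra_simps inner_commute)
    ultimately have "l + 2 * t * (w \<bullet> (A *v x)) + t\<^sup>2 * (w \<bullet> (A *v w)) \<le> l * (1 + 2 * t * (w \<bullet> x) + t\<^sup>2 * (w \<bullet> w))"
      by simp
    then have "2 * t * (w \<bullet> (A *v x)) - 2 * t * l * (w \<bullet> x) \<le> t\<^sup>2 * q"
      unfolding q_def by (simp add: algebra_simps)
    moreover have "w \<bullet> (A *v x) - l * (w \<bullet> x) = w \<bullet> w"
      by (simp add: w_def inner_diff_right)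
    ultimately have "2 * t * (w \<bullet> w) \<le> t\<^sup>2 * q"
      by (metis (no_types, lifting) mult.assoc right_diff_distrib)
    then have "2 * (w \<bullet> w) \<le> t * q" using t by (simp add: power2_eq_square)
    moreover have "t * q \<le> w \<bullet> w" unfolding t_def using pos \<open>q \<ge> 0\<close> by (simp add: field_simps)
    ultimately show False using pos by linarith
  qed
  then have "A *v x = l *\<^sub>R x" by (simp add: w_def)
  then show thesis using x that by auto
qed

text \<open>An orthonormal set of eigenvectors of largest cardinality spans: its orthogonal
  complement is invariant because \<open>A\<close> is symmetric, and a nonzero complement would
  contain one more eigenvector.\<close>

theorem symmetric_eigenbasis_exists:
  fixes A :: "real^'n^'n"
  assumes A: "transpose A = A"
  obtains e lam where "eigenbasis A e lam"
proof -
  define P where "P B \<longleftrightarrow> pairwise orthogonal B \<and> (\<forall>x\<in>B. norm x = 1 \<and> (\<exists>l. A *v x = l *\<^sub>R x))" for B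
  have ind: "independent B" "finite B" "card B \<le> CARD('n)" if "P B" for B
  proof -
    show "independent B"
      using that unfolding P_def by (intro pairwise_orthogonal_independent) auto
    then show "finite B" "card B \<le> CARD('n)"
      using independent_bound[of B] by auto
  qed
  have "P {}" by (simp add: P_def)
  then obtain B where B: "P B" and mx: "\<And>C. P C \<Longrightarrow> card C \<le> card B"
    using ex_has_greatest_nat[of P "{}" card "Suc CARD('n)"] ind(3) le_imp_less_Suc by metis
  have sp: "span B = UNIV"
  proof (rule ccontr)
    assume "span B \<noteq> UNIV"
    then have "span B \<subset> span UNIV" by auto
    then obtain z where z: "z \<noteq> 0" "\<And>y. y \<in> span B \<Longrightarrow> orthogonal z y"
      using orthogonal_to_subspace_exists_gen[of B UNIV] by auto
    let ?S = "{x. \<forall>b\<in>B. x \<bullet> b = 0}"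
    have S: "subspace ?S"
      by (auto simp: subspace_def inner_add_left)
    have inv: "A *v x \<in> ?S" if x: "x \<in> ?S" for x
    proof safe
      fix b assume b: "b \<in> B"
      then obtain l where "A *v b = l *\<^sub>R b" using B P_def by blast
      then have "(A *v x) \<bullet> b = l * (x \<bullet> b)" using symmetric_inner[OF A, of x b] by simp
      then show "(A *v x) \<bullet> b = 0" using x b by simp
    qed
    have zS: "z \<in> ?S" using z(2) span_base by (auto simp: orthogonal_def)
    obtain x l where x: "x \<in> ?S" "norm x = 1" "A *v x = l *\<^sub>R x"
      using symmetric_eigenvector_in_subspace[OF A S inv zS z(1)] by auto
    have xB: "x \<notin> B" using x by (auto simp: norm_eq_1)
    have "P (insert x B)"
      using B x unfolding P_def
      by (auto simp: pairwise_insert orthogonal_def inner_commute)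
    then have "card (insert x B) \<le> card B" by (rule mx)
    then show False using xB ind(2)[OF B] by simp
  qed
  have "card B = CARD('n)"
    using sp ind[OF B] dim_span_eq_card_independent[of B] by (simp add: dim_UNIV)
  then obtain e where e: "bij_betw e (UNIV::'n set) B"
    using ind(2)[OF B] by (metis finite_class.finite_UNIV finite_same_card_bij)
  have "\<forall>i. \<exists>l. A *v e i = l *\<^sub>R e i" using e B unfolding P_def bij_betw_def by blast
  then obtain lam where lam: "\<And>i. A *v e i = lam i *\<^sub>R e i" by metis
  have "e i \<bullet> e j = (if i = j then 1 else 0)" for i j
  proof (cases "i = j")
    case True then show ?thesis using e B unfolding P_def bij_betw_def by (auto simp: norm_eq_1)
  next
    case False
    then have "e i \<noteq> e j" using e by (auto simp: bij_betw_def inj_on_def)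
    then show ?thesis using e B False unfolding P_def bij_betw_def pairwise_def orthogonal_def by auto
  qed
  then have "eigenbasis A e lam" using lam by (simp add: eigenbasis_def)
  then show thesis by (rule that)
qed

lemma orthonormal_expansion:
  fixes e :: "'n \<Rightarrow> real^'n"
  assumes e: "\<And>i j. e i \<bullet> e j = (if i = j then 1 else 0)"
  shows "x = (\<Sum>i\<in>UNIV. (x \<bullet> e i) *\<^sub>R e i)"
proof -
  have inj: "inj e"
    by (rule injI) (metis e zero_neq_one)
  have nz: "e i \<noteq> 0" for i using e[of i i] by auto
  have "pairwise orthogonal (range e)"
    by (auto simp: pairwise_def orthogonal_def e)
  then have "independent (range e)"
    using nz by (intro pairwise_orthogonal_independent) (simp, metis imageE)
  moreover have "card (range e) = CARD('n)" using inj by (simp add: card_image)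
  ultimately have "span (range e) = UNIV"
    by (metis card_eq_dim dim_UNIV DIM_cart DIM_real finite_class.finite_UNIV finite_imageI mult.right_neutral subset_UNIV top.extremum_uniqueI dim_span_eq_card_independent dim_eq_full)
  then have x: "x \<in> span (range e)" by simp
  define y where "y = x - (\<Sum>i\<in>UNIV. (x \<bullet> e i) *\<^sub>R e i)"
  have "y \<bullet> e j = 0" for j
    by (simp add: y_def inner_diff_left inner_sum_left e if_distrib cong: if_cong)
  then have "orthogonal y z" if "z \<in> span (range e)" for z
    using that by (intro orthogonal_to_span[OF that]) (auto simp: orthogonal_def)
  then have "orthogonal y y" using \<open>span (range e) = UNIV\<close> by simp
  then show ?thesis by (simp add: y_def orthogonal_def)
qed

lemma eigenbasis_quadratic:
  fixes N :: "real^'n^'n"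
  assumes "eigenbasis N e lam"
  shows "x \<bullet> (N *v x) = (\<Sum>i\<in>UNIV. lam i * (x \<bullet> e i)\<^sup>2)"
    and "x \<bullet> x = (\<Sum>i\<in>UNIV. (x \<bullet> e i)\<^sup>2)"
proof -
  have e: "\<And>i j. e i \<bullet> e j = (if i = j then 1 else 0)" and N: "\<And>i. N *v e i = lam i *\<^sub>R e i"
    using assms by (auto simp: eigenbasis_def)
  have "N *v x = N *v (\<Sum>i\<in>UNIV. (x \<bullet> e i) *\<^sub>R e i)" using orthonormal_expansion[OF e, of x] by simp
  also have "\<dots> = (\<Sum>i\<in>UNIV. (x \<bullet> e i) *\<^sub>R (lam i *\<^sub>R e i))"
    by (simp add: matrix_vector_mult_scaleR N linear_sum[OF matrix_vector_mul_linear])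
  finally have "x \<bullet> (N *v x) = (\<Sum>i\<in>UNIV. (x \<bullet> e i) * lam i * (x \<bullet> e i))"
    by (simp add: inner_sum_right)
  then show "x \<bullet> (N *v x) = (\<Sum>i\<in>UNIV. lam i * (x \<bullet> e i)\<^sup>2)"
    by (simp add: power2_eq_square algebra_simps)
  have "x \<bullet> x = x \<bullet> (\<Sum>i\<in>UNIV. (x \<bullet> e i) *\<^sub>R e i)" using orthonormal_expansion[OF e, of x] by simp
  also have "\<dots> = (\<Sum>i\<in>UNIV. (x \<bullet> e i)\<^sup>2)" by (simp add: inner_sum_right power2_eq_square)
  finally show "x \<bullet> x = (\<Sum>i\<in>UNIV. (x \<bullet> e i)\<^sup>2)" .
qed

lemma eigenbasis_det:
  fixes N :: "real^'n^'n"
  assumes "eigenbasis N e lam"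
  shows "det N = (\<Prod>i\<in>UNIV. lam i)"
proof -
  have e: "\<And>i j. e i \<bullet> e j = (if i = j then 1 else 0)" and N: "\<And>i. N *v e i = lam i *\<^sub>R e i"
    using assms by (auto simp: eigenbasis_def)
  define P :: "real^'n^'n" where "P = (\<chi> i j. e j $ i)"
  define D :: "real^'n^'n" where "D = (\<chi> i j. if i = j then lam i else 0)"
  have col: "column i P = e i" for i by (simp add: P_def column_def vec_eq_iff)
  have "orthogonal_matrix P"
    unfolding orthogonal_matrix_orthonormal_columns col by (simp add: norm_eq_1 orthogonal_def e)
  then have P: "det P \<noteq> 0" using det_orthogonal_matrix[of P] by auto
  have "N ** P = P ** D"
  proof -
    have "(N ** P) $ i $ j = (P ** D) $ i $ j" for i j
    proof -
      have "(N ** P) $ i $ j = (N *v e j) $ i"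
        by (simp add: matrix_matrix_mult_def matrix_vector_mult_def P_def)
      also have "\<dots> = lam j * e j $ i" by (simp add: N)
      also have "\<dots> = (P ** D) $ i $ j"
        by (simp add: matrix_matrix_mult_def P_def D_def if_distrib cong: if_cong)
      finally show ?thesis .
    qed
    then show ?thesis by (simp add: vec_eq_iff)
  qed
  then have "det N * det P = det P * det D" by (metis det_mul)
  then have "det N = det D" using P by simp
  also have "\<dots> = (\<Prod>i\<in>UNIV. lam i)" by (subst det_diagonal) (auto simp: D_def)
  finally show ?thesis .
qed

section \<open>Differentiability of Lipschitz functions\<close>

lemma lmeasurable_outer_open:
  assumes S: "S \<in> lmeasurable" and e: "e > 0"
  obtains T where "open T" "S \<subseteq> T" "T \<in> lmeasurable" "measure lebesgue T < measure lebesgue S + e"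
proof -
  obtain T where T: "open T" "S \<subseteq> T" "T - S \<in> lmeasurable" "emeasure lebesgue (T - S) < ennreal e"
    using sets_lebesgue_outer_open[OF fmeasurableD[OF S] e] by blast
  have TS: "T = S \<union> (T - S)" using T by auto
  then have "T \<in> lmeasurable" using S T by (metis fmeasurable.Un)
  moreover have "measure lebesgue (T - S) < e"
    using T e by (simp add: emeasure_eq_measure2 ennreal_less_iff)
  moreover have "measure lebesgue T \<le> measure lebesgue S + measure lebesgue (T - S)"
    using TS S T measure_Un_le[of S lebesgue "T - S"] by (metis fmeasurableD)
  ultimately show thesis using T that by simp
qed

text \<open>Each point of \<open>E\<close> is an endpoint of arbitrarily short intervals inside
  \<open>U\<close> whose images are shorter than \<open>p\<close> times their length. A disjoint
  Vitali subfamily covers \<open>E\<close> up to a null set, and the Lipschitz map \<open>h\<close>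
  keeps that remainder null. The conclusion is an enclosing measurable \<open>T\<close>, so that
  \<open>E\<close> itself may be any set.\<close>

lemma vitali_image_bound:
  fixes h :: "real \<Rightarrow> real"
  assumes mono: "strict_mono h" and lip: "\<And>x y. \<bar>h x - h y\<bar> \<le> K * \<bar>x - y\<bar>"
    and p: "p > 0"
    and slope: "\<And>x d. x \<in> E \<Longrightarrow> d > 0 \<Longrightarrow> \<exists>y. y \<noteq> x \<and> \<bar>y - x\<bar> < d \<and> \<bar>h y - h x\<bar> < p * \<bar>y - x\<bar>"
    and U: "open U" "E \<subseteq> U" "U \<in> lmeasurable"
  obtains T where "T \<in> lmeasurable" "h ` E \<subseteq> T" "measure lebesgue T \<le> p * measure lebesgue U"
proof -
  define F where "F = {(a::real, r). r > 0 \<and> cball a r \<subseteq> U \<and> h (a + r) - h (a - r) < p * (2 * r)}"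
  have "\<exists>i. i \<in> F \<and> x \<in> cball (fst i) (snd i) \<and> snd i < d" if x: "x \<in> E" and d: "d > 0" for x d
  proof -
    obtain e where e: "e > 0" "ball x e \<subseteq> U" using U x by (meson open_contains_ball subsetD)
    obtain y where y: "y \<noteq> x" "\<bar>y - x\<bar> < min d e" "\<bar>h y - h x\<bar> < p * \<bar>y - x\<bar>"
      using slope[OF x, of "min d e"] d e by auto
    \<comment> \<open>The interval between \<open>x\<close> and \<open>y\<close> is written as a
      ball about its midpoint, the form that the covering theorem expects.\<close>
    define a where "a = (x + y) / 2"
    define r where "r = \<bar>y - x\<bar> / 2"
    have r: "r > 0" "r < d" using y d by (auto simp: r_def)
    have "{a + r, a - r} = {x, y}" unfolding a_def r_def by (cases "x \<le> y") (auto simp: field_simps)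
    then consider "a + r = x \<and> a - r = y" | "a + r = y \<and> a - r = x" by (auto simp: doubleton_eq_iff)
    then have "h (a + r) - h (a - r) < p * (2 * r)"
      using y by cases (auto simp: r_def)
    moreover have "cball a r \<subseteq> ball x e"
      using y unfolding a_def r_def by (auto simp: dist_real_def abs_if field_simps split: if_splits)
    moreover have "x \<in> cball a r" unfolding a_def r_def by (auto simp: dist_real_def abs_if field_simps)
    ultimately show ?thesis using e r unfolding F_def by (intro exI[of _ "(a, r)"]) auto
  qed
  then obtain C where C: "countable C" "C \<subseteq> F"
     "pairwise (\<lambda>i j. disjnt (cball (fst i) (snd i)) (cball (fst j) (snd j))) C"
     "negligible (E - (\<Union>i \<in> C. cball (fst i) (snd i)))"
    using Vitali_covering_theorem_cballs[of F snd E fst] unfolding F_def by force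
  have cont: "continuous_on A h" for A
  proof -
    have "K \<ge> 0" using lip[of 1 0] by simp
    then show ?thesis
      by (intro continuous_on_subset[OF lipschitz_on_continuous_on[of K UNIV h]])
         (auto simp: lipschitz_on_def dist_real_def lip)
  qed
  have img: "h ` cball a r = {h (a - r)..h (a + r)}" if r: "r > 0" for a r
  proof
    show "h ` cball a r \<subseteq> {h (a - r)..h (a + r)}"
      using mono by (auto simp: cball_eq_atLeastAtMost strict_mono_less_eq)
    show "{h (a - r)..h (a + r)} \<subseteq> h ` cball a r"
    proof
      fix z assume "z \<in> {h (a - r)..h (a + r)}"
      then have z: "h (a - r) \<le> z" "z \<le> h (a + r)" by auto
      obtain x where "a - r \<le> x" "x \<le> a + r" "h x = z"
        using IVT'[OF z _ cont] r by auto
      then show "z \<in> h ` cball a r" by (auto simp: cball_eq_atLeastAtMost)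
    qed
  qed
  define B where "B = (\<Union>i\<in>C. h ` cball (fst i) (snd i))"
  have meas: "h ` cball (fst i) (snd i) \<in> lmeasurable" for i
    by (intro lmeasurable_compact compact_continuous_image cont compact_cball)
  have fin: "measure lebesgue (\<Union>i\<in>I. h ` cball (fst i) (snd i)) \<le> p * measure lebesgue U"
    if I: "I \<subseteq> C" "finite I" for I
  proof -
    have "measure lebesgue (\<Union>i\<in>I. h ` cball (fst i) (snd i)) \<le> (\<Sum>i\<in>I. measure lebesgue (h ` cball (fst i) (snd i)))"
      using I meas by (intro measure_UNION_le) auto
    also have "\<dots> \<le> (\<Sum>i\<in>I. p * measure lebesgue (cball (fst i) (snd i)))"
    proof (rule sum_mono)
      fix i assume "i \<in> I"
      then have i: "snd i > 0" "h (fst i + snd i) - h (fst i - snd i) < p * (2 * snd i)"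
        using I C by (auto simp: F_def)
      then have "h (fst i - snd i) \<le> h (fst i + snd i)" using mono by (simp add: strict_mono_less_eq)
      then show "measure lebesgue (h ` cball (fst i) (snd i)) \<le> p * measure lebesgue (cball (fst i) (snd i))"
        using i img[OF i(1), of "fst i"] by (simp add: cball_eq_atLeastAtMost)
    qed
    also have "\<dots> = p * measure lebesgue (\<Union>i\<in>I. cball (fst i) (snd i))"
      using I C by (subst measure_UNION') (auto simp: sum_distrib_left pairwise_subset)
    also have "\<dots> \<le> p * measure lebesgue U"
    proof (intro mult_left_mono measure_mono_fmeasurable)
      show "(\<Union>i\<in>I. cball (fst i) (snd i)) \<subseteq> U" using I C unfolding F_def by fastforce
    qed (use I p U in auto)
    finally show ?thesis .
  qed
  have B: "B \<in> lmeasurable" "measure lebesgue B \<le> p * measure lebesgue U"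
    unfolding B_def using fmeasurable_UN_bound[OF C(1) meas fin] measure_UN_bound[OF C(1) meas fin] by auto
  have neg: "negligible (h ` (E - (\<Union>i \<in> C. cball (fst i) (snd i))))"
    by (rule negligible_locally_Lipschitz_image[OF _ C(4)])
       (auto intro!: exI[of _ UNIV] exI[of _ K] simp: lip)
  show thesis
  proof
    let ?T = "B \<union> h ` (E - (\<Union>i \<in> C. cball (fst i) (snd i)))"
    show "?T \<in> lmeasurable" using B neg by (simp add: fmeasurable.Un negligible_imp_measurable)
    show "h ` E \<subseteq> ?T"
    proof
      fix z assume "z \<in> h ` E"
      then obtain x where "x \<in> E" "z = h x" by blast
      then show "z \<in> ?T"
      proof (cases "x \<in> (\<Union>i \<in> C. cball (fst i) (snd i))")
        case True
        then have "z \<in> B" unfolding B_def \<open>z = h x\<close> by blast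
        then show ?thesis by simp
      qed blast
    qed
    show "measure lebesgue ?T \<le> p * measure lebesgue U"
      using B neg measure_Un_le[OF fmeasurableD[OF B(1)] negligible_imp_sets[OF neg]]
        negligible_imp_measure0[OF neg] by linarith
  qed
qed

text \<open>
  The outer measure \<open>m\<close> of \<open>E\<close> satisfies \<open>m \<le> (p / q) m\<close>: the image of \<open>E\<close> under \<open>h\<close> has outer measure at most \<open>p m\<close>, and
  the inverse of \<open>h\<close>, which has slopes below \<open>1 / q\<close>, maps it back to \<open>E\<close>.
\<close>
lemma negligible_two_slopes:
  fixes h :: "real \<Rightarrow> real"
  assumes lo: "\<And>x y. x \<le> y \<Longrightarrow> y - x \<le> h y - h x" and hi: "\<And>x y. \<bar>h x - h y\<bar> \<le> K * \<bar>x - y\<bar>"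
    and pq: "0 < p" "p < q" and E: "bounded E"
    and low: "\<And>x d. x \<in> E \<Longrightarrow> d > 0 \<Longrightarrow> \<exists>y. y \<noteq> x \<and> \<bar>y - x\<bar> < d \<and> \<bar>h y - h x\<bar> < p * \<bar>y - x\<bar>"
    and high: "\<And>x d. x \<in> E \<Longrightarrow> d > 0 \<Longrightarrow> \<exists>y. y \<noteq> x \<and> \<bar>y - x\<bar> < d \<and> \<bar>h y - h x\<bar> > q * \<bar>y - x\<bar>"
  shows "negligible E"
proof -
  have mono: "strict_mono h"
    using lo by (intro strict_monoI) (smt (verit))
  have lo': "\<bar>x - y\<bar> \<le> \<bar>h x - h y\<bar>" for x y
    using lo[of x y] lo[of y x] by linarith
  have K: "K > 0" using hi[of 1 0] lo'[of 1 0] by simp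
  have cont: "continuous_on A h" for A
    using K by (intro continuous_on_subset[OF lipschitz_on_continuous_on[of K UNIV h]])
         (auto simp: lipschitz_on_def dist_real_def hi)
  have surj: "\<exists>x. h x = z" for z
  proof -
    define R where "R = \<bar>z - h 0\<bar>"
    have "h (-R) \<le> z" "z \<le> h R" using lo[of "-R" 0] lo[of 0 R] by (auto simp: R_def)
    then show ?thesis using IVT'[of h "-R" z R] cont by (auto simp: R_def)
  qed
  define k where "k = inv h"
  have hk: "h (k z) = z" for z
  proof -
    obtain x where "h x = z" using surj by blast
    then show ?thesis unfolding k_def by (metis f_inv_into_f rangeI)
  qed
  have "inj h" using mono by (rule strict_mono_imp_inj_on)
  then have kh: "k (h x) = x" for x unfolding k_def by simp
  have kmono: "strict_mono k"
  proof (rule strict_monoI)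
    fix x y :: real assume "x < y"
    then have "h (k x) < h (k y)" by (simp add: hk)
    then show "k x < k y" using mono strict_mono_less by blast
  qed
  have klip: "\<bar>k x - k y\<bar> \<le> 1 * \<bar>x - y\<bar>" for x y using lo'[of "k x" "k y"] by (simp add: hk)
  \<comment> \<open>\<open>m\<close> is the outer measure of \<open>E\<close>, phrased with open
    sets because the covering lemma takes an open enclosure; boundedness of \<open>E\<close> makes
    \<open>S\<close> nonempty.\<close>
  define S where "S = {measure lebesgue U | U. open U \<and> E \<subseteq> U \<and> U \<in> lmeasurable}"
  define m where "m = Inf S"
  obtain R where R: "E \<subseteq> ball 0 R" using E bounded_subset_ballD by blast
  have ne: "S \<noteq> {}" unfolding S_def using R open_ball lmeasurable_ball by blast
  have bdd: "bdd_below S" by (rule bdd_belowI[of _ 0]) (auto simp: S_def)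
  have m0: "m \<ge> 0" unfolding m_def using ne by (intro cInf_greatest) (auto simp: S_def)
  have step: "m \<le> (p * (m + e) + e) / q + e" if e: "e > 0" for e
  proof -
    obtain s where s: "s \<in> S" "s < m + e" using cInf_lessD[OF ne, of "m + e"] e m_def by auto
    then obtain U where U: "open U" "E \<subseteq> U" "U \<in> lmeasurable" "measure lebesgue U < m + e" by (auto simp: S_def)
    obtain T where T: "T \<in> lmeasurable" "h ` E \<subseteq> T" "measure lebesgue T \<le> p * measure lebesgue U"
      using vitali_image_bound[OF mono hi pq(1) low U(1-3)] by blast
    obtain T' where T': "open T'" "T \<subseteq> T'" "T' \<in> lmeasurable" "measure lebesgue T' < measure lebesgue T + e"
      using lmeasurable_outer_open[OF T(1) e] by blast
    \<comment> \<open>A slope of \<open>h\<close> above \<open>q\<close> at \<open>z\<close> is a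
      slope of the inverse \<open>k\<close> below \<open>1 / q\<close> at \<open>h z\<close>. The
      radius \<open>d / K\<close> keeps the image point within distance \<open>d\<close>.\<close>
    have sl: "\<exists>y. y \<noteq> x \<and> \<bar>y - x\<bar> < d \<and> \<bar>k y - k x\<bar> < (1 / q) * \<bar>y - x\<bar>" if "x \<in> h ` E" and d: "d > 0" for x d
    proof -
      obtain z where z: "z \<in> E" "x = h z" using \<open>x \<in> h ` E\<close> by auto
      obtain y where y: "y \<noteq> z" "\<bar>y - z\<bar> < d / K" "\<bar>h y - h z\<bar> > q * \<bar>y - z\<bar>"
        using high[OF z(1), of "d / K"] d K by auto
      have "\<bar>h y - h z\<bar> < d" using hi[of y z] y K by (simp add: field_simps)
      moreover have "h y \<noteq> h z" using y by (metis kh)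
      ultimately show ?thesis using y z pq by (intro exI[of _ "h y"]) (simp add: kh field_simps)
    qed
    obtain V where V: "V \<in> lmeasurable" "k ` h ` E \<subseteq> V" "measure lebesgue V \<le> (1 / q) * measure lebesgue T'"
    proof (rule vitali_image_bound[OF kmono klip _ sl T'(1) _ T'(3)])
      show "h ` E \<subseteq> T'" using T T' by blast
    qed (use pq in auto)
    obtain V' where V': "open V'" "V \<subseteq> V'" "V' \<in> lmeasurable" "measure lebesgue V' < measure lebesgue V + e"
      using lmeasurable_outer_open[OF V(1) e] by blast
    have "E \<subseteq> V'" using V V' by (auto simp: image_image kh)
    then have "measure lebesgue V' \<in> S" using V' unfolding S_def by blast
    then have "m \<le> measure lebesgue V'" unfolding m_def using bdd by (rule cInf_lower)
    also have "\<dots> \<le> (1 / q) * measure lebesgue T' + e" using V' V by simp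
    also have "\<dots> \<le> (1 / q) * (p * (m + e) + e) + e"
    proof -
      have "measure lebesgue T' \<le> p * (m + e) + e"
        using T T' U(4) pq by (smt (verit, best) mult_left_mono)
      then show ?thesis using pq by (intro add_mono mult_left_mono) auto
    qed
    finally show ?thesis by simp
  qed
  have "m \<le> p * m / q"
  proof (rule tendsto_le)
    have "((\<lambda>e. (p * (m + e) + e) / q + e) \<longlongrightarrow> (p * (m + 0) + 0) / q + 0) (at_right 0)"
      using pq by (intro tendsto_intros) auto
    then show "((\<lambda>e. (p * (m + e) + e) / q + e) \<longlongrightarrow> p * m / q) (at_right 0)" by simp
    show "((\<lambda>e. m) \<longlongrightarrow> m) (at_right (0::real))" by simp
    show "\<forall>\<^sub>F e in at_right 0. m \<le> (p * (m + e) + e) / q + e"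
      by (rule eventually_mono[OF eventually_at_right_less step])
  qed (simp_all add: trivial_limit_at_right_real)
  then have "m * q \<le> m * p" using pq by (simp add: field_simps)
  then have "m = 0" using pq m0 by (smt (verit) mult_left_less_imp_less mult_strict_left_mono)
  show ?thesis
    unfolding negligible_outer
  proof safe
    fix e :: real assume "e > 0"
    then obtain s where "s \<in> S" "s < e" using cInf_lessD[OF ne, of e] \<open>m = 0\<close> m_def by auto
    then show "\<exists>T. E \<subseteq> T \<and> T \<in> lmeasurable \<and> measure lebesgue T < e" by (auto simp: S_def)
  qed
qed

text \<open>With \<open>l\<close> the supremum of the eventual lower bounds (the limit inferior),
  failure of convergence to \<open>l\<close> leaves room for two rationals above \<open>l\<close>
  such that the values keep falling below one and rising above the other. Rationality later makes
  the family of exceptional sets countable, and \<open>a \<le> p\<close> keeps \<open>p\<close>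
  positive.\<close>

lemma slope_dichotomy:
  fixes s :: "real \<Rightarrow> real"
  assumes bd: "\<forall>\<^sub>F y in F. a \<le> s y \<and> s y \<le> b" and F: "F \<noteq> bot"
    and no: "\<not> (\<exists>l. (s \<longlongrightarrow> l) F)"
  obtains p q where "p \<in> \<rat>" "q \<in> \<rat>" "a \<le> p" "p < q" "\<exists>\<^sub>F y in F. s y < p" "\<exists>\<^sub>F y in F. s y > q"
proof (rule ccontr)
  note t = that
  assume nt: "\<not> thesis"
  have *: "eventually (\<lambda>y. s y \<le> q) F"
    if pq: "p \<in> \<rat>" "q \<in> \<rat>" "a \<le> p" "p < q" "\<exists>\<^sub>F y in F. s y < p" for p q
  proof (rule ccontr)
    assume "\<not> eventually (\<lambda>y. s y \<le> q) F"
    then have "\<exists>\<^sub>F y in F. s y > q" by (simp add: frequently_def not_less)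
    from t[OF pq this] nt show False by simp
  qed
  define A where "A = {r. eventually (\<lambda>y. r \<le> s y) F}"
  have aA: "a \<in> A" using bd by (auto simp: A_def elim: eventually_mono)
  have ub: "r \<le> b" if "r \<in> A" for r
  proof -
    have "eventually (\<lambda>y. r \<le> s y \<and> s y \<le> b) F" using that bd unfolding A_def by (auto elim: eventually_elim2)
    then have "eventually (\<lambda>y. r \<le> b) F" by (auto elim: eventually_mono)
    then show ?thesis using F by (simp add: eventually_const_iff)
  qed
  define l where "l = Sup A"
  have bddA: "bdd_above A" by (rule bdd_aboveI[OF ub])
  have "(s \<longlongrightarrow> l) F"
  proof (rule order_tendstoI)
    fix c assume "c < l"
    then obtain r where "r \<in> A" "c < r" using less_cSup_iff[of A c] aA bddA l_def by auto
    then show "eventually (\<lambda>y. c < s y) F" unfolding A_def by (auto elim: eventually_mono)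
  next
    fix c assume "l < c"
    then obtain q' where q': "q' \<in> \<rat>" "l < q'" "q' < c" using Rats_dense_in_real by blast
    then obtain p' where p': "p' \<in> \<rat>" "l < p'" "p' < q'" using Rats_dense_in_real by blast
    have "p' \<notin> A" using p' bddA cSup_upper l_def by fastforce
    then have "\<exists>\<^sub>F y in F. s y < p'" by (simp add: A_def frequently_def not_less)
    moreover have "a \<le> p'" using p' cSup_upper[OF aA bddA] l_def by simp
    ultimately have "eventually (\<lambda>y. s y \<le> q') F" using * p' q' by blast
    then show "eventually (\<lambda>y. s y < c) F" using q' by (auto elim: eventually_mono)
  qed
  then show False using no by blast
qed

theorem negligible_nondifferentiable_lipschitz_real:
  fixes g :: "real \<Rightarrow> real"
  assumes lip: "\<And>x y. \<bar>g x - g y\<bar> \<le> L * \<bar>x - y\<bar>"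
  shows "negligible {x. \<not> (\<exists>l. (g has_real_derivative l) (at x))}"
proof -
  have L: "L \<ge> 0" using lip[of 1 0] by simp
  \<comment> \<open>Slopes of \<open>g\<close> lie between -L and L, so those of \<open>h\<close>
    lie between 1 and 2L + 1: \<open>h\<close> is increasing with a Lipschitz inverse, and it is
    differentiable exactly where \<open>g\<close> is.\<close>
  define h where "h x = g x + (L + 1) * x" for x
  have lo: "y - x \<le> h y - h x" if "x \<le> y" for x y
    using lip[of x y] that unfolding h_def by (simp add: algebra_simps abs_if split: if_splits)
  have hi: "\<bar>h x - h y\<bar> \<le> (2 * L + 1) * \<bar>x - y\<bar>" for x y
  proof -
    have "h x - h y = (g x - g y) + (L + 1) * (x - y)" by (simp add: h_def algebra_simps)
    then have "\<bar>h x - h y\<bar> \<le> \<bar>g x - g y\<bar> + (L + 1) * \<bar>x - y\<bar>"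
      using L by (metis abs_mult abs_of_nonneg abs_triangle_ineq add_nonneg_nonneg zero_le_one)
    then show ?thesis using lip[of x y] by (simp add: algebra_simps)
  qed
  \<comment> \<open>The cutoff by \<open>n\<close> makes each piece bounded, as
    \<open>negligible_two_slopes\<close> asks.\<close>
  define E where "E p q n = {x. \<bar>x\<bar> < real n \<and>
      (\<forall>d>0. \<exists>y. y \<noteq> x \<and> \<bar>y - x\<bar> < d \<and> \<bar>h y - h x\<bar> < p * \<bar>y - x\<bar>) \<and>
      (\<forall>d>0. \<exists>y. y \<noteq> x \<and> \<bar>y - x\<bar> < d \<and> \<bar>h y - h x\<bar> > q * \<bar>y - x\<bar>)}" for p q and n :: nat
  have neg: "negligible (E p q n)" if "0 < p" "p < q" for p q n
    using lo hi that
  proof (rule negligible_two_slopes)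
    show "bounded (E p q n)" by (rule boundedI[of _ "real n"]) (auto simp: E_def)
  qed (auto simp: E_def)
  define I where "I = {(p, q, n :: nat). p \<in> \<rat> \<and> q \<in> \<rat> \<and> 0 < p \<and> p < (q :: real)}"
  have "I \<subseteq> \<rat> \<times> \<rat> \<times> UNIV" by (auto simp: I_def)
  then have "countable I" by (rule countable_subset) (intro countable_SIGMA countable_rat countableI_type)
  then have "negligible (\<Union>i\<in>I. case i of (p, q, n) \<Rightarrow> E p q n)"
    using neg by (intro negligible_countable_Union) (auto simp: I_def)
  moreover have "x \<in> (\<Union>i\<in>I. case i of (p, q, n) \<Rightarrow> E p q n)"
    if x: "\<not> (\<exists>l. (g has_real_derivative l) (at x))" for x
  proof -
    define s where "s y = (h y - h x) / (y - x)" for y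
    have slope: "s y * \<bar>y - x\<bar> = \<bar>h y - h x\<bar>" if "y \<noteq> x" for y
      using that lo[of x y] lo[of y x] by (cases "x < y") (auto simp: s_def field_simps)
    have "\<not> (\<exists>l. (s \<longlongrightarrow> l) (at x))"
    proof
      assume "\<exists>l. (s \<longlongrightarrow> l) (at x)"
      then obtain l where "(s \<longlongrightarrow> l) (at x)" by blast
      then have "(h has_real_derivative l) (at x)" by (simp add: s_def[abs_def] has_field_derivative_iff)
      then have "((\<lambda>y. h y - (L + 1) * y) has_real_derivative l - (L + 1)) (at x)"
        by (auto intro!: derivative_eq_intros)
      moreover have "(\<lambda>y. h y - (L + 1) * y) = g" by (auto simp: h_def)
      ultimately show False using x by auto
    qed
    moreover have "\<forall>\<^sub>F y in at x. 1 \<le> s y \<and> s y \<le> 2 * L + 1"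
    proof -
      have "1 \<le> s y \<and> s y \<le> 2 * L + 1" if "y \<noteq> x" for y
      proof -
        have "\<bar>y - x\<bar> > 0" using that by simp
        moreover have "1 * \<bar>y - x\<bar> \<le> s y * \<bar>y - x\<bar>"
          unfolding slope[OF that] using lo[of x y] lo[of y x] by (cases "x \<le> y") simp_all
        moreover have "s y * \<bar>y - x\<bar> \<le> (2 * L + 1) * \<bar>y - x\<bar>" using slope[OF that] hi[of y x] by simp
        ultimately show ?thesis using mult_le_cancel_right_pos by blast
      qed
      then show ?thesis by (auto simp: eventually_at intro!: exI[of _ 1])
    qed
    ultimately obtain p q where pq: "p \<in> \<rat>" "q \<in> \<rat>" "1 \<le> p" "p < q" "\<exists>\<^sub>F y in at x. s y < p" "\<exists>\<^sub>F y in at x. s y > q"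
      using slope_dichotomy[of 1 s "2 * L + 1" "at x"] by auto
    have fr: "\<exists>y. y \<noteq> x \<and> \<bar>y - x\<bar> < d \<and> P y" if "\<exists>\<^sub>F y in at x. P y" "d > 0" for P d
      using that by (force simp: frequently_def eventually_at dist_real_def)
    have 1: "\<exists>y. y \<noteq> x \<and> \<bar>y - x\<bar> < d \<and> \<bar>h y - h x\<bar> < p * \<bar>y - x\<bar>" if d: "d > 0" for d
    proof -
      obtain y where y: "y \<noteq> x" "\<bar>y - x\<bar> < d" "s y < p" using fr[OF pq(5) d] by blast
      then have "s y * \<bar>y - x\<bar> < p * \<bar>y - x\<bar>" by (intro mult_strict_right_mono) auto
      then show ?thesis using y slope by auto
    qed
    have 2: "\<exists>y. y \<noteq> x \<and> \<bar>y - x\<bar> < d \<and> \<bar>h y - h x\<bar> > q * \<bar>y - x\<bar>" if d: "d > 0" for d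
    proof -
      obtain y where y: "y \<noteq> x" "\<bar>y - x\<bar> < d" "s y > q" using fr[OF pq(6) d] by blast
      then have "q * \<bar>y - x\<bar> < s y * \<bar>y - x\<bar>" by (intro mult_strict_right_mono) auto
      then show ?thesis using y slope by auto
    qed
    obtain n :: nat where n: "\<bar>x\<bar> < real n" using reals_Archimedean2 by blast
    have "(p, q, n) \<in> I" using pq by (auto simp: I_def)
    moreover have "x \<in> E p q n" using 1 2 n by (simp add: E_def)
    ultimately show ?thesis by blast
  qed
  ultimately show ?thesis by (auto intro: negligible_subset)
qed

section \<open>Null sets detected along parallel lines\<close>

lemma nn_integral_lborel_translate:
  fixes f :: "'a::euclidean_space \<Rightarrow> ennreal"
  assumes [measurable]: "f \<in> borel_measurable borel"
  shows "(\<integral>\<^sup>+x. f (x + c) \<partial>lborel) = (\<integral>\<^sup>+x. f x \<partial>lborel)"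
proof -
  have "(\<integral>\<^sup>+x. f x \<partial>lborel) = (\<integral>\<^sup>+x. f x \<partial>(distr lborel borel ((+) c)))"
    by (subst lborel_distr_plus) simp
  also have "\<dots> = (\<integral>\<^sup>+x. f (x + c) \<partial>lborel)"
    by (subst nn_integral_distr) (auto simp: add.commute)
  finally show ?thesis by simp
qed

lemma integral_lborel_translate:
  fixes f :: "'a::euclidean_space \<Rightarrow> real"
  assumes [measurable]: "f \<in> borel_measurable borel"
  shows "(\<integral>x. f (x + c) \<partial>lborel) = (\<integral>x. f x \<partial>lborel)"
proof -
  have "(\<integral>x. f x \<partial>lborel) = (\<integral>x. f x \<partial>(distr lborel borel ((+) c)))"
    by (subst lborel_distr_plus) simp
  also have "\<dots> = (\<integral>x. f (x + c) \<partial>lborel)"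
    by (subst integral_distr) (auto simp: add.commute)
  finally show ?thesis by simp
qed

text \<open>Averaging over the translates of \<open>E\<close> along \<open>v\<close> avoids rotating \<open>v\<close> into a coordinate direction.\<close>
lemma null_set_by_slices:
  fixes E :: "'a::euclidean_space set" and v :: 'a
  assumes [measurable]: "E \<in> sets borel" and slices: "\<And>x. {s. x + s *\<^sub>R v \<in> E} \<in> null_sets lborel"
  shows "E \<in> null_sets lborel"
proof -
  let ?f = "\<lambda>s x. indicator {0..1::real} s * indicator E (x + s *\<^sub>R v) :: ennreal"
  have "emeasure lborel E = (\<integral>\<^sup>+s. indicator {0..1::real} s * emeasure lborel E \<partial>lborel)"
    by (simp add: nn_integral_multc)
  also have "\<dots> = (\<integral>\<^sup>+s. \<integral>\<^sup>+x. ?f s x \<partial>lborel \<partial>lborel)"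
  proof (rule nn_integral_cong)
    fix s :: real
    have "(\<integral>\<^sup>+x. ?f s x \<partial>lborel) = indicator {0..1} s * (\<integral>\<^sup>+x. indicator E (x + s *\<^sub>R v) \<partial>lborel)"
      by (rule nn_integral_cmult) measurable
    also have "(\<integral>\<^sup>+x. indicator E (x + s *\<^sub>R v) \<partial>lborel) = emeasure lborel E"
      by (subst nn_integral_lborel_translate) auto
    finally show "indicator {0..1::real} s * emeasure lborel E = (\<integral>\<^sup>+x. ?f s x \<partial>lborel)" by simp
  qed
  also have "\<dots> = (\<integral>\<^sup>+x. \<integral>\<^sup>+s. ?f s x \<partial>lborel \<partial>lborel)"
    by (rule lborel_pair.Fubini') measurable
  also have "\<dots> = (\<integral>\<^sup>+(x::'a). 0 \<partial>lborel)"
  proof (rule nn_integral_cong)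
    fix x :: 'a
    have "AE s in lborel. s \<notin> {s. x + s *\<^sub>R v \<in> E}" using slices by (rule AE_not_in)
    then have "AE s in lborel. ?f s x = 0" by eventually_elim (auto simp: indicator_def)
    then have "(\<integral>\<^sup>+s. ?f s x \<partial>lborel) = (\<integral>\<^sup>+s. 0 \<partial>(lborel :: real measure))" by (rule nn_integral_cong_AE)
    then show "(\<integral>\<^sup>+s. ?f s x \<partial>lborel) = 0" by simp
  qed
  finally show ?thesis by (simp add: null_sets_def)
qed

section \<open>Directional derivatives and Rademacher's theorem\<close>

definition has_dir_deriv :: "('a::real_normed_vector \<Rightarrow> real) \<Rightarrow> 'a \<Rightarrow> 'a \<Rightarrow> real \<Rightarrow> bool" where
  "has_dir_deriv g x v l \<longleftrightarrow> ((\<lambda>s. (g (x + s *\<^sub>R v) - g x) / s) \<longlongrightarrow> l) (at 0)"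

lemma has_dir_deriv_unique: "has_dir_deriv g x v l \<Longrightarrow> has_dir_deriv g x v l' \<Longrightarrow> l = l'"
  unfolding has_dir_deriv_def by (rule tendsto_unique[of "at (0::real)"]) auto

lemma has_dir_deriv_0: "has_dir_deriv g x 0 0"
  by (simp add: has_dir_deriv_def)

lemma has_dir_deriv_scale:
  assumes "has_dir_deriv g x v l"
  shows "has_dir_deriv g x (c *\<^sub>R v) (c * l)"
proof (cases "c = 0")
  case False
  have "filterlim (\<lambda>s. c * s) (at 0) (at (0::real))"
    using False by (auto simp: filterlim_at eventually_at intro!: tendsto_eq_intros exI[of _ 1])
  then have "((\<lambda>s. (g (x + (c * s) *\<^sub>R v) - g x) / (c * s)) \<longlongrightarrow> l) (at 0)"
    using assms unfolding has_dir_deriv_def by (rule filterlim_compose[rotated])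
  then have "((\<lambda>s. c * ((g (x + (c * s) *\<^sub>R v) - g x) / (c * s))) \<longlongrightarrow> c * l) (at 0)"
    by (intro tendsto_intros)
  then show ?thesis unfolding has_dir_deriv_def using False by (simp add: mult.commute)
qed (simp add: has_dir_deriv_0)

lemma has_dir_deriv_line:
  "(\<exists>l. has_dir_deriv g (x + t *\<^sub>R v) v l) \<longleftrightarrow> (\<exists>l. ((\<lambda>s. g (x + s *\<^sub>R v)) has_real_derivative l) (at t))"
  unfolding has_dir_deriv_def DERIV_def by (simp add: algebra_simps)

text \<open>The Cauchy criterion for difference quotients with both tolerances discretized:
  intersecting over \<open>k\<close> and uniting over \<open>j\<close> gives exactly the points with
  a derivative along \<open>v\<close>. Each piece is closed for continuous \<open>g\<close>, so this
  set is Borel, as the slicing argument requires.\<close>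

definition slope_osc_set :: "('a::real_normed_vector \<Rightarrow> real) \<Rightarrow> 'a \<Rightarrow> nat \<Rightarrow> nat \<Rightarrow> 'a set" where
  "slope_osc_set g v k j = {x. \<forall>s t. s \<noteq> 0 \<and> t \<noteq> 0 \<and> \<bar>s\<bar> < 1 / Suc j \<and> \<bar>t\<bar> < 1 / Suc j \<longrightarrow>
      \<bar>(g (x + s *\<^sub>R v) - g x) / s - (g (x + t *\<^sub>R v) - g x) / t\<bar> \<le> 1 / Suc k}"

lemma closed_slope_osc_set:
  assumes g: "continuous_on UNIV g"
  shows "closed (slope_osc_set g v k j)"
proof -
  have "slope_osc_set g v k j = (\<Inter>s\<in>{s. s \<noteq> 0 \<and> \<bar>s\<bar> < 1 / Suc j}. \<Inter>t\<in>{s. s \<noteq> 0 \<and> \<bar>s\<bar> < 1 / Suc j}.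
     {x. \<bar>(g (x + s *\<^sub>R v) - g x) / s - (g (x + t *\<^sub>R v) - g x) / t\<bar> \<le> 1 / Suc k})"
    by (auto simp: slope_osc_set_def)
  moreover have "closed {x. \<bar>(g (x + s *\<^sub>R v) - g x) / s - (g (x + t *\<^sub>R v) - g x) / t\<bar> \<le> 1 / Suc k}"
    if "s \<noteq> 0" "t \<noteq> 0" for s t
    using that by (intro closed_Collect_le continuous_intros continuous_on_compose2[OF g]) auto
  ultimately show ?thesis by (auto intro!: closed_INT)
qed

lemma has_dir_deriv_iff_slope_osc:
  "(\<exists>l. has_dir_deriv g x v l) \<longleftrightarrow> x \<in> (\<Inter>k. \<Union>j. slope_osc_set g v k j)"
proof
  let ?Q = "\<lambda>s. (g (x + s *\<^sub>R v) - g x) / s"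
  {
    assume "\<exists>l. has_dir_deriv g x v l"
    then obtain l where l: "(?Q \<longlongrightarrow> l) (at 0)" by (auto simp: has_dir_deriv_def)
    show "x \<in> (\<Inter>k. \<Union>j. slope_osc_set g v k j)"
    proof
      fix k
      obtain d where d: "d > 0" "\<And>s. s \<noteq> 0 \<Longrightarrow> \<bar>s\<bar> < d \<Longrightarrow> \<bar>?Q s - l\<bar> < 1 / (2 * Suc k)"
        using tendstoD[OF l, of "1 / (2 * Suc k)"] by (auto simp: eventually_at dist_real_def)
      obtain j where j: "1 / real (Suc j) < d" using d(1) nat_approx_posE by blast
      have "\<bar>?Q s - ?Q t\<bar> \<le> 1 / Suc k" if "s \<noteq> 0 \<and> t \<noteq> 0 \<and> \<bar>s\<bar> < 1 / Suc j \<and> \<bar>t\<bar> < 1 / Suc j" for s t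
      proof -
        have "\<bar>?Q s - l\<bar> < 1 / (2 * Suc k)" "\<bar>?Q t - l\<bar> < 1 / (2 * Suc k)" using d(2) that j by force+
        moreover have "1 / real (2 * Suc k) + 1 / real (2 * Suc k) = 1 / Suc k" by (simp add: field_simps)
        moreover have "\<bar>a - b\<bar> \<le> h + h" if "\<bar>a - l\<bar> < h" "\<bar>b - l\<bar> < h" for a b h :: real
          using that by linarith
        ultimately show ?thesis by metis
      qed
      then show "x \<in> (\<Union>j. slope_osc_set g v k j)" unfolding slope_osc_set_def by blast
    qed
  }
  {
    assume "x \<in> (\<Inter>k. \<Union>j. slope_osc_set g v k j)"
    then have "\<forall>k. \<exists>j. x \<in> slope_osc_set g v k j" by blast
    then obtain J where J: "\<And>k. x \<in> slope_osc_set g v k (J k)" by metis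
    \<comment> \<open>The derivative is produced as the limit of the quotients along
      \<open>1 / Suc i\<close>; the oscillation bound then transfers it to all small
      \<open>s\<close>.\<close>
    define q where "q i = ?Q (1 / Suc i)" for i
    have osc: "\<bar>?Q s - ?Q t\<bar> \<le> 1 / Suc k"
      if "s \<noteq> 0" "t \<noteq> 0" "\<bar>s\<bar> < 1 / Suc (J k)" "\<bar>t\<bar> < 1 / Suc (J k)" for s t k
      using J[of k] that unfolding slope_osc_set_def by blast
    have big: "\<bar>1 / real (Suc i)\<bar> < 1 / Suc (J k)" if "i > J k" for i k
      using that by (simp add: frac_less2)
    have "Cauchy q"
    proof (rule metric_CauchyI)
      fix e :: real assume "e > 0"
      then obtain k where k: "1 / real (Suc k) < e" using nat_approx_posE by blast
      have "dist (q m) (q n) < e" if "m \<ge> Suc (J k)" "n \<ge> Suc (J k)" for m n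
        using osc[of "1 / Suc m" "1 / Suc n" k] big[of k m] big[of k n] that k
        by (auto simp: q_def dist_real_def)
      then show "\<exists>M. \<forall>m\<ge>M. \<forall>n\<ge>M. dist (q m) (q n) < e" by blast
    qed
    then obtain l where l: "q \<longlonglongrightarrow> l" using Cauchy_convergent_iff convergent_def by blast
    have "(?Q \<longlongrightarrow> l) (at 0)"
    proof (rule tendstoI)
      fix e :: real assume "e > 0"
      then obtain k where k: "1 / real (Suc k) < e" using nat_approx_posE by blast
      have "\<bar>?Q s - l\<bar> \<le> 1 / Suc k" if "s \<noteq> 0" "\<bar>s\<bar> < 1 / Suc (J k)" for s
      proof -
        have "(\<lambda>i. \<bar>?Q s - q i\<bar>) \<longlonglongrightarrow> \<bar>?Q s - l\<bar>" using l by (intro tendsto_intros)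
        moreover have "\<bar>?Q s - q i\<bar> \<le> 1 / Suc k" if "i \<ge> Suc (J k)" for i
          unfolding q_def using osc[of s "1 / Suc i" k] big[of k i] \<open>s \<noteq> 0\<close> \<open>\<bar>s\<bar> < 1 / Suc (J k)\<close> that by auto
        ultimately show ?thesis by (intro LIMSEQ_le_const2) blast+
      qed
      then show "\<forall>\<^sub>F s in at 0. dist (?Q s) l < e"
        unfolding eventually_at using k by (intro exI[of _ "1 / Suc (J k)"]) (force simp: dist_real_def)
    qed
    then show "\<exists>l. has_dir_deriv g x v l" by (auto simp: has_dir_deriv_def)
  }
qed

context
  fixes g :: "'a::euclidean_space \<Rightarrow> real" and L :: real
  assumes lip: "\<And>x y. \<bar>g x - g y\<bar> \<le> L * norm (x - y)"
begin

lemma lipschitz_real_nonneg: "L \<ge> 0"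
proof -
  obtain b :: 'a where "b \<in> Basis" by (meson ex_in_conv nonempty_Basis)
  then show ?thesis using lip[of b 0] by simp
qed

lemma lipschitz_real_continuous: "continuous_on A g"
  by (rule continuous_on_subset[OF lipschitz_on_continuous_on[of L UNIV g]])
    (auto simp: lipschitz_on_def dist_real_def dist_norm lip lipschitz_real_nonneg)

lemma lipschitz_real_measurable [measurable]: "g \<in> borel_measurable borel"
  by (rule borel_measurable_continuous_onI[OF lipschitz_real_continuous])

text \<open>On each line in direction \<open>v\<close> the restriction of \<open>g\<close> is
  Lipschitz with constant \<open>L * norm v\<close>, so the one-variable theorem makes every slice
  of the exceptional Borel set null.\<close>

lemma AE_has_dir_deriv: "AE x in lborel. \<exists>l. has_dir_deriv g x v l"
proof -
  let ?E = "- (\<Inter>k. \<Union>j. slope_osc_set g v k j)"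
  have E: "?E = {x. \<not> (\<exists>l. has_dir_deriv g x v l)}" unfolding has_dir_deriv_iff_slope_osc by blast
  have "slope_osc_set g v k j \<in> sets borel" for k j
    using closed_slope_osc_set[OF lipschitz_real_continuous] by simp
  then have "(\<Inter>k. \<Union>j. slope_osc_set g v k j) \<in> sets borel"
    by (intro sets.countable_INT'' sets.countable_UN) auto
  then have meas: "?E \<in> sets borel" by (rule borel_comp)
  have "?E \<in> null_sets lborel"
  proof (rule null_set_by_slices[OF meas])
    fix x
    have "negligible {s. \<not> (\<exists>l. ((\<lambda>s. g (x + s *\<^sub>R v)) has_real_derivative l) (at s))}"
    proof (rule negligible_nondifferentiable_lipschitz_real)
      fix s t :: real
      have "norm (x + s *\<^sub>R v - (x + t *\<^sub>R v)) = \<bar>s - t\<bar> * norm v"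
        by (metis add_diff_cancel_left norm_scaleR scaleR_diff_left)
      then show "\<bar>g (x + s *\<^sub>R v) - g (x + t *\<^sub>R v)\<bar> \<le> (L * norm v) * \<bar>s - t\<bar>"
        using lip[of "x + s *\<^sub>R v" "x + t *\<^sub>R v"] by (simp add: algebra_simps)
    qed
    then have "negligible {s. x + s *\<^sub>R v \<in> ?E}" unfolding E by (simp only: mem_Collect_eq has_dir_deriv_line)
    moreover have "(\<lambda>s. x + s *\<^sub>R v) -` ?E \<inter> space lborel \<in> sets lborel"
      using meas by (intro measurable_sets[of _ lborel borel]) auto
    then have "{s. x + s *\<^sub>R v \<in> ?E} \<in> sets lborel" by (simp add: vimage_def)
    ultimately show "{s. x + s *\<^sub>R v \<in> ?E} \<in> null_sets lborel"
      by (simp add: negligible_iff_null_sets null_sets_completion_iff)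
  qed
  then have "AE x in lborel. x \<notin> ?E" by (rule AE_not_in)
  then show ?thesis unfolding E by simp
qed

lemma dir_quotient_bound: "\<bar>(g (x + s *\<^sub>R v) - g x) / s\<bar> \<le> L * norm v"
proof (cases "s = 0")
  case False
  then show ?thesis using lip[of "x + s *\<^sub>R v" x] by (simp add: field_simps)
qed (simp add: lipschitz_real_nonneg)

text \<open>
  The defect \<open>\<delta>\<close> of additivity is the limit of the second differences \<open>\<phi>\<close>. A translation turns the integral of \<open>\<phi>\<close>
  over a compact set \<open>E\<close> into an integral of bounded quotients over the symmetric difference of \<open>E\<close> and a
  translate of \<open>E\<close>, so the integral of \<open>\<delta>\<close> over every compact set vanishes.
\<close>
lemma AE_has_dir_deriv_add:
  "AE x in lborel. \<forall>l m. has_dir_deriv g x v l \<longrightarrow> has_dir_deriv g x w m \<longrightarrow> has_dir_deriv g x (v + w) (l + m)"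
proof -
  define s where "s k = 1 / real (Suc k)" for k
  have s0: "s \<longlonglongrightarrow> 0" unfolding s_def using LIMSEQ_inverse_real_of_nat by (simp add: inverse_eq_divide)
  have sn: "s k \<noteq> 0" for k by (simp add: s_def)
  have lim: "(\<lambda>k. (g (x + s k *\<^sub>R u) - g x) / s k) \<longlonglongrightarrow> l" if "has_dir_deriv g x u l" for x u l
  proof -
    have "filterlim s (at 0) sequentially" using s0 sn by (simp add: filterlim_at)
    with that show ?thesis unfolding has_dir_deriv_def by (rule filterlim_compose)
  qed
  define Q where "Q k x = (g (x + s k *\<^sub>R w) - g x) / s k" for k x
  define \<phi> where "\<phi> k x = Q k (x + s k *\<^sub>R v) - Q k x" for k x
  have [measurable]: "Q k \<in> borel_measurable borel" for k unfolding Q_def by measurable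
  have [measurable]: "\<phi> k \<in> borel_measurable borel" for k unfolding \<phi>_def by measurable
  have Qb: "\<bar>Q k x\<bar> \<le> L * norm w" for k x unfolding Q_def by (rule dir_quotient_bound)
  define \<delta> where "\<delta> x = lim (\<lambda>k. \<phi> k x)" for x
  have [measurable]: "\<delta> \<in> borel_measurable borel" unfolding \<delta>_def by measurable
  have \<phi>_eq: "\<phi> k x = (g (x + s k *\<^sub>R (v + w)) - g x) / s k - (g (x + s k *\<^sub>R v) - g x) / s k - (g (x + s k *\<^sub>R w) - g x) / s k" for k x
    by (simp add: \<phi>_def Q_def diff_divide_distrib algebra_simps)
  have conv: "(\<lambda>k. \<phi> k x) \<longlonglongrightarrow> n - l - m"
    if "has_dir_deriv g x v l" "has_dir_deriv g x w m" "has_dir_deriv g x (v + w) n" for x l m n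
    unfolding \<phi>_eq using that by (intro tendsto_diff lim)
  have good: "AE x in lborel. \<exists>l m n. has_dir_deriv g x v l \<and> has_dir_deriv g x w m \<and> has_dir_deriv g x (v + w) n"
    using AE_has_dir_deriv[of v] AE_has_dir_deriv[of w] AE_has_dir_deriv[of "v + w"] by eventually_elim blast
  have \<phi>b: "\<bar>\<phi> k x\<bar> \<le> 2 * (L * norm w)" for k x
    using Qb[of k "x + s k *\<^sub>R v"] Qb[of k x] unfolding \<phi>_def by linarith
  have lim\<delta>: "AE x in lborel. (\<lambda>k. \<phi> k x) \<longlonglongrightarrow> \<delta> x"
    using good
  proof eventually_elim
    case (elim x)
    then have "convergent (\<lambda>k. \<phi> k x)" using conv convergent_def by blast
    then show ?case by (simp add: \<delta>_def convergent_LIMSEQ_iff)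
  qed
  have zero: "(\<integral>x. indicator E x * \<delta> x \<partial>lborel) = 0" if E: "compact E" for E :: "'a set"
  proof -
    have [measurable]: "E \<in> sets borel" using E by (simp add: borel_compact)
    have fin: "emeasure lborel E < \<infinity>" using E by (intro emeasure_bounded_finite compact_imp_bounded)
    have intE: "integrable lborel (\<lambda>x. indicator E x * c)" for c :: real
      using fin by (intro integrable_mult_left) simp
    have bint: "integrable lborel (\<lambda>x. indicator E x * f x)"
      if [measurable]: "f \<in> borel_measurable borel" and "\<And>x. \<bar>f x\<bar> \<le> c" for f :: "'a \<Rightarrow> real" and c :: real
      by (rule Bochner_Integration.integrable_bound[OF intE[of c]])
         (auto simp: indicator_def intro!: AE_I2 order_trans[OF that(2)])
    have l1: "(\<lambda>k. \<integral>x. indicator E x * \<phi> k x \<partial>lborel) \<longlonglongrightarrow> (\<integral>x. indicator E x * \<delta> x \<partial>lborel)"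
    proof (rule integral_dominated_convergence[OF _ _ intE[of "2 * (L * norm w)"]])
      show "AE x in lborel. (\<lambda>k. indicator E x * \<phi> k x) \<longlonglongrightarrow> indicator E x * \<delta> x"
        using lim\<delta> by eventually_elim (intro tendsto_intros)
      show "AE x in lborel. norm (indicator E x * \<phi> k x) \<le> indicator E x * (2 * (L * norm w))" for k
        using \<phi>b[of k] by (auto simp: indicator_def)
    qed measurable
    \<comment> \<open>\<open>D'\<close> is the measure of the translate of \<open>E\<close> minus
      \<open>E\<close>, and \<open>D\<close> the same number after a shift. It tends to zero: a
      point outside the closed set \<open>E\<close> is eventually outside the translates too, and
      boundedness of \<open>E\<close> supplies a dominating ball.\<close>
    define D where "D k = (\<integral>x. indicator E x * (1 - indicator E (x + s k *\<^sub>R v)) \<partial>lborel :: real)" for k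
    define D' where "D' k = (\<integral>x. indicator E (x + (- s k) *\<^sub>R v) * (1 - indicator E x) \<partial>lborel :: real)" for k
    have D': "D' k = D k" for k
      unfolding D_def D'_def
      using integral_lborel_translate[of "\<lambda>x. indicator E (x + (- s k) *\<^sub>R v) * (1 - indicator E x)" "s k *\<^sub>R v"]
      by (simp add: algebra_simps)
    have "D' \<longlonglongrightarrow> 0"
    proof -
      obtain R where R: "R > 0" "E \<subseteq> ball 0 R" using compact_imp_bounded[OF E] bounded_subset_ballD by blast
      have "(\<lambda>k. \<integral>x. indicator E (x + (- s k) *\<^sub>R v) * (1 - indicator E x) \<partial>lborel :: real) \<longlonglongrightarrow> (\<integral>(x::'a). 0 \<partial>lborel)"
      proof (rule integral_dominated_convergence[where w="indicator (ball 0 (R + norm v))"])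
        show "AE x in lborel. (\<lambda>k. indicator E (x + (- s k) *\<^sub>R v) * (1 - indicator E x) :: real) \<longlonglongrightarrow> 0"
        proof (rule AE_I2)
          fix x
          show "(\<lambda>k. indicator E (x + (- s k) *\<^sub>R v) * (1 - indicator E x) :: real) \<longlonglongrightarrow> 0"
          proof (cases "x \<in> E")
            case False
            have "(\<lambda>k. x + (- s k) *\<^sub>R v) \<longlonglongrightarrow> x + (- 0) *\<^sub>R v" using s0 by (intro tendsto_intros)
            then have "\<forall>\<^sub>F k in sequentially. x + (- s k) *\<^sub>R v \<in> - E"
              using False compact_imp_closed[OF E] by (intro topological_tendstoD) auto
            then have "\<forall>\<^sub>F k in sequentially. indicator E (x + (- s k) *\<^sub>R v) * (1 - indicator E x) = (0::real)"
              by eventually_elim (auto simp: indicator_def)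
            then show ?thesis by (rule tendsto_eventually)
          qed simp
        qed
        show "AE x in lborel. norm (indicator E (x + (- s k) *\<^sub>R v) * (1 - indicator E x) :: real) \<le> indicator (ball 0 (R + norm v)) x" for k
        proof (rule AE_I2)
          fix x
          have "x \<in> ball 0 (R + norm v)" if "x + (- s k) *\<^sub>R v \<in> E"
          proof -
            have "norm x \<le> norm (x + (- s k) *\<^sub>R v) + norm (s k *\<^sub>R v)"
              using norm_triangle_ineq[of "x + (- s k) *\<^sub>R v" "s k *\<^sub>R v"] by simp
            moreover have "norm (s k *\<^sub>R v) \<le> norm v"
              using mult_right_mono[of 1 "1 + real k" "norm v"] by (simp add: s_def field_simps)
            moreover have "norm (x + (- s k) *\<^sub>R v) < R" using that R by auto
            ultimately show ?thesis by simp
          qed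
          then show "norm (indicator E (x + (- s k) *\<^sub>R v) * (1 - indicator E x) :: real) \<le> indicator (ball 0 (R + norm v)) x"
            by (auto simp: indicator_def)
        qed
        show "integrable lborel (indicator (ball 0 (R + norm v)) :: 'a \<Rightarrow> real)"
          using emeasure_lborel_ball_finite by (intro integrable_real_indicator) auto
      qed measurable
      then show ?thesis by (simp add: D'_def[abs_def])
    qed
    have bd: "\<bar>\<integral>x. indicator E x * \<phi> k x \<partial>lborel\<bar> \<le> (L * norm w) * (D k + D' k)" for k
    proof -
      let ?E' = "\<lambda>x. indicator E (x + (- s k) *\<^sub>R v) :: real"
      have i1: "integrable lborel (\<lambda>x. indicator E x * Q k (x + s k *\<^sub>R v))"
        by (rule bint[where c="L * norm w"]) (auto simp: Qb)
      have i2: "integrable lborel (\<lambda>x. indicator E x * Q k x)"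
        by (rule bint[where c="L * norm w"]) (auto simp: Qb)
      have tr: "(\<integral>x. indicator E x * Q k (x + s k *\<^sub>R v) \<partial>lborel) = (\<integral>x. ?E' x * Q k x \<partial>lborel)"
        using integral_lborel_translate[of "\<lambda>x. ?E' x * Q k x" "s k *\<^sub>R v"] by (simp add: algebra_simps)
      have cov: "\<And>f :: 'a \<Rightarrow> real. integrable lborel (\<lambda>x. f (x + s k *\<^sub>R v)) \<Longrightarrow> f \<in> borel_measurable borel \<Longrightarrow> integrable lborel f"
      proof -
        fix f :: "'a \<Rightarrow> real" assume "integrable lborel (\<lambda>x. f (x + s k *\<^sub>R v))" and [measurable]: "f \<in> borel_measurable borel"
        then have "integrable (distr lborel borel ((+) (s k *\<^sub>R v))) f"
          by (subst integrable_distr_eq) (measurable, simp add: add.commute)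
        then show "integrable lborel f" by (simp add: lborel_distr_plus)
      qed
      have i3: "integrable lborel (\<lambda>x. ?E' x * Q k x)"
        using i1 cov[of "\<lambda>x. ?E' x * Q k x"] by simp
      have i4: "integrable lborel (\<lambda>x. indicator E x * (1 - indicator E (x + s k *\<^sub>R v)) :: real)"
        by (rule bint[where c=1]) (auto simp: indicator_def)
      have i4': "integrable lborel (\<lambda>x. indicator E x * (1 - ?E' x))"
        by (rule bint[where c=1]) (auto simp: indicator_def)
      have i5: "integrable lborel (\<lambda>x. ?E' x * (1 - indicator E x))"
        using i4 cov[of "\<lambda>x. ?E' x * (1 - indicator E x)"] by simp
      \<comment> \<open>\<open>E\<close> and its translate have equal measure, hence so do the two
        halves of their symmetric difference.\<close>
      have D2: "D k = (\<integral>x. indicator E x * (1 - ?E' x) \<partial>lborel)"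
      proof -
        have j: "integrable lborel (indicator E :: 'a \<Rightarrow> real)" using intE[of 1] by simp
        have j': "integrable lborel ?E'" using j cov[of ?E'] by simp
        have j'': "integrable lborel (\<lambda>x. indicator E x * ?E' x)"
          by (rule bint[where c=1]) (auto simp: indicator_def)
        have "(\<integral>x. indicator E x * (1 - ?E' x) \<partial>lborel) = (\<integral>x. indicator E x - indicator E x * ?E' x \<partial>lborel)"
          by (simp add: algebra_simps)
        also have "\<dots> = (\<integral>x. indicator E x \<partial>lborel) - (\<integral>x. indicator E x * ?E' x \<partial>lborel)"
          using j j'' by (rule Bochner_Integration.integral_diff)
        also have "(\<integral>x. indicator E x \<partial>lborel) = (\<integral>x. ?E' x \<partial>lborel)"
          using integral_lborel_translate[of ?E' "s k *\<^sub>R v"] by (simp add: algebra_simps)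
        also have "(\<integral>x. ?E' x \<partial>lborel) - (\<integral>x. indicator E x * ?E' x \<partial>lborel) = (\<integral>x. ?E' x - indicator E x * ?E' x \<partial>lborel)"
          using j' j'' by (rule Bochner_Integration.integral_diff[symmetric])
        also have "\<dots> = D' k" unfolding D'_def by (simp add: algebra_simps)
        finally show ?thesis using D' by simp
      qed
      have "(\<integral>x. indicator E x * \<phi> k x \<partial>lborel) = (\<integral>x. indicator E x * Q k (x + s k *\<^sub>R v) - indicator E x * Q k x \<partial>lborel)"
        by (simp add: \<phi>_def right_diff_distrib)
      also have "\<dots> = (\<integral>x. ?E' x * Q k x \<partial>lborel) - (\<integral>x. indicator E x * Q k x \<partial>lborel)"
        using i1 i2 by (simp add: tr)
      also have "\<dots> = (\<integral>x. ?E' x * Q k x - indicator E x * Q k x \<partial>lborel)"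
        using i3 i2 by simp
      finally have eq: "(\<integral>x. indicator E x * \<phi> k x \<partial>lborel) = (\<integral>x. ?E' x * Q k x - indicator E x * Q k x \<partial>lborel)" .
      have "\<bar>\<integral>x. ?E' x * Q k x - indicator E x * Q k x \<partial>lborel\<bar>
          \<le> (\<integral>x. (L * norm w) * (indicator E x * (1 - ?E' x) + ?E' x * (1 - indicator E x)) \<partial>lborel)"
        unfolding real_norm_def[symmetric]
      proof (rule Bochner_Integration.integral_norm_bound_integral)
        show "integrable lborel (\<lambda>x. ?E' x * Q k x - indicator E x * Q k x)" using i3 i2 by simp
        show "integrable lborel (\<lambda>x. (L * norm w) * (indicator E x * (1 - ?E' x) + ?E' x * (1 - indicator E x)))"
          using i4' i5 by simp
        show "norm (?E' x * Q k x - indicator E x * Q k x) \<le> (L * norm w) * (indicator E x * (1 - ?E' x) + ?E' x * (1 - indicator E x))" for x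
          using Qb[of k x] by (auto simp: indicator_def)
      qed
      also have "\<dots> = (L * norm w) * (D k + D' k)"
        using i4' i5 by (simp add: D2 D'_def)
      finally show ?thesis unfolding eq .
    qed
    have "(\<lambda>k. \<integral>x. indicator E x * \<phi> k x \<partial>lborel) \<longlonglongrightarrow> 0"
    proof (rule Lim_null_comparison)
      show "\<forall>\<^sub>F k in sequentially. norm (\<integral>x. indicator E x * \<phi> k x \<partial>lborel) \<le> (L * norm w) * (D k + D' k)"
        using bd by (intro always_eventually) simp
      have "(\<lambda>k. (L * norm w) * (D' k + D' k)) \<longlonglongrightarrow> (L * norm w) * (0 + 0)"
        using \<open>D' \<longlonglongrightarrow> 0\<close> by (intro tendsto_intros)
      then show "(\<lambda>k. (L * norm w) * (D k + D' k)) \<longlonglongrightarrow> 0" by (simp add: D')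
    qed
    then show ?thesis using l1 LIMSEQ_unique by blast
  qed
  \<comment> \<open>A compact subset of the set where \<open>c * \<delta>\<close> is positive is
    null, because the integral over it vanishes; inner approximation by such subsets then handles
    the whole set.\<close>
  have null: "{x. c * \<delta> x > 0} \<in> null_sets lborel" if c: "c = 1 \<or> c = -1" for c :: real
  proof -
    let ?S = "{x. c * \<delta> x > 0}"
    have S: "?S \<in> sets lborel" by measurable
    have Sb: "?S \<in> sets borel" by measurable
    have cpt: "negligible T" if T: "compact T" "T \<subseteq> ?S" for T
    proof -
      have [measurable]: "T \<in> sets borel" using T by (simp add: borel_compact)
      have fin: "emeasure lborel T < \<infinity>" using T by (intro emeasure_bounded_finite compact_imp_bounded)
      have \<delta>b: "AE x in lborel. \<bar>\<delta> x\<bar> \<le> 2 * (L * norm w)"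
        using lim\<delta>
      proof eventually_elim
        case (elim x)
        then have "(\<lambda>k. \<bar>\<phi> k x\<bar>) \<longlonglongrightarrow> \<bar>\<delta> x\<bar>" by (rule tendsto_rabs)
        then show ?case using \<phi>b by (intro LIMSEQ_le_const2) auto
      qed
      have i1: "integrable lborel (\<lambda>x. indicator T x * (2 * (L * norm w)))" using fin by simp
      have i2: "integrable lborel (\<lambda>x. indicator T x * \<delta> x)"
        by (rule Bochner_Integration.integrable_bound[OF i1]) (use \<delta>b in \<open>auto simp: indicator_def elim!: eventually_mono\<close>)
      then have i3: "integrable lborel (\<lambda>x. c * (indicator T x * \<delta> x))" by simp
      have nn: "AE x in lborel. 0 \<le> c * (indicator T x * \<delta> x)"
        using T by (auto simp: indicator_def dest!: subsetD intro!: AE_I2)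
      have "(\<integral>x. c * (indicator T x * \<delta> x) \<partial>lborel) = 0" using zero[OF T(1)] by simp
      then have "AE x in lborel. c * (indicator T x * \<delta> x) = 0"
        using integral_nonneg_eq_0_iff_AE[OF i3 nn] by simp
      then have "AE x in lborel. x \<notin> T"
        by eventually_elim (use T in \<open>auto simp: indicator_def split: if_splits\<close>)
      then have "T \<in> null_sets lborel" by (subst (asm) AE_iff_null_sets[symmetric]) simp_all
      then show ?thesis by (simp add: negligible_iff_null_sets null_sets_completionI)
    qed
    have "negligible (?S \<inter> cball 0 (real n))" for n
      unfolding negligible_outer
    proof safe
      fix e :: real assume e: "e > 0"
      have "?S \<inter> cball 0 (real n) \<in> sets lebesgue" using S by auto
      then obtain T where T: "closed T" "T \<subseteq> ?S \<inter> cball 0 (real n)" "?S \<inter> cball 0 (real n) - T \<in> lmeasurable"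
         "emeasure lebesgue (?S \<inter> cball 0 (real n) - T) < ennreal e"
        using sets_lebesgue_inner_closed e by blast
      have "compact T" using T bounded_subset[OF bounded_cball] compact_eq_bounded_closed by blast
      then have neg: "negligible T" using cpt T by blast
      let ?U = "?S \<inter> cball 0 (real n) - T"
      have "measure lebesgue ?U < e" using T(3,4) e by (simp add: emeasure_eq_measure2 ennreal_less_iff)
      moreover have "measure lebesgue (?U \<union> T) \<le> measure lebesgue ?U + measure lebesgue T"
        using T(3) neg by (intro measure_Un_le fmeasurableD negligible_imp_sets)
      ultimately have "measure lebesgue (?U \<union> T) < e" using negligible_imp_measure0[OF neg] by simp
      moreover have "?U \<union> T \<in> lmeasurable"
        by (rule fmeasurable.Un[OF T(3) negligible_imp_measurable[OF neg]])
      moreover have "?S \<inter> cball 0 (real n) \<subseteq> ?U \<union> T" by auto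
      ultimately show "\<exists>T. ?S \<inter> cball 0 (real n) \<subseteq> T \<and> T \<in> lmeasurable \<and> measure lebesgue T < e"
        by (intro exI[of _ "?U \<union> T"]) simp
    qed
    then have "negligible (\<Union>n. ?S \<inter> cball 0 (real n))" by (intro negligible_countable_Union) auto
    moreover have "(\<Union>n. ?S \<inter> cball 0 (real n)) = ?S"
      by (auto simp: real_arch_simple)
    ultimately have "negligible ?S" by simp
    then show ?thesis using S by (simp add: negligible_iff_null_sets null_sets_completion_iff)
  qed
  have "AE x in lborel. \<delta> x = 0"
    using AE_not_in[OF null[of 1, simplified]] AE_not_in[OF null[of "-1", simplified]]
  proof eventually_elim
    case (elim x)
    then show ?case by simp
  qed
  with good show ?thesis
  proof eventually_elim
    case (elim x)
    then obtain l m n where lmn: "has_dir_deriv g x v l" "has_dir_deriv g x w m" "has_dir_deriv g x (v + w) n" by blast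
    have "n - l - m = 0" using limI[OF conv[OF lmn]] elim(2) by (simp add: \<delta>_def)
    then have "n = l + m" by simp
    then have lm: "has_dir_deriv g x (v + w) (l + m)" using lmn by simp
    show ?case
    proof (intro allI impI)
      fix l' m' assume "has_dir_deriv g x v l'" "has_dir_deriv g x w m'"
      then have "l' = l" "m' = m"
        using has_dir_deriv_unique[OF _ lmn(1)] has_dir_deriv_unique[OF _ lmn(2)] by simp_all
      then show "has_dir_deriv g x (v + w) (l' + m')" using lm by simp
    qed
  qed
qed

text \<open>\<open>c\<close> stands for the candidate gradient. It is quantified inside the
  almost-everywhere statement because it depends on \<open>x\<close>; additivity is applied once per
  basis vector.\<close>

lemma AE_has_dir_deriv_linear:
  "AE x in lborel. \<forall>c. (\<forall>b\<in>Basis. has_dir_deriv g x b (c \<bullet> b)) \<longrightarrow> has_dir_deriv g x v (c \<bullet> v)"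
proof -
  have "AE x in lborel. \<forall>c. (\<forall>b\<in>Basis. has_dir_deriv g x b (c \<bullet> b)) \<longrightarrow>
     has_dir_deriv g x (\<Sum>b\<in>F. (v \<bullet> b) *\<^sub>R b) (c \<bullet> (\<Sum>b\<in>F. (v \<bullet> b) *\<^sub>R b))" if "finite F" "F \<subseteq> Basis" for F
    using that
  proof (induction F)
    case empty then show ?case by (simp add: has_dir_deriv_0)
  next
    case (insert b F)
    from insert have "AE x in lborel. \<forall>c. (\<forall>b\<in>Basis. has_dir_deriv g x b (c \<bullet> b)) \<longrightarrow>
        has_dir_deriv g x (\<Sum>b\<in>F. (v \<bullet> b) *\<^sub>R b) (c \<bullet> (\<Sum>b\<in>F. (v \<bullet> b) *\<^sub>R b))" by simp
    with AE_has_dir_deriv_add[of "(v \<bullet> b) *\<^sub>R b" "\<Sum>b\<in>F. (v \<bullet> b) *\<^sub>R b"] show ?case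
    proof eventually_elim
      case (elim x)
      show ?case
      proof (intro allI impI)
        fix c assume c: "\<forall>b\<in>Basis. has_dir_deriv g x b (c \<bullet> b)"
        then have "has_dir_deriv g x ((v \<bullet> b) *\<^sub>R b) ((v \<bullet> b) * (c \<bullet> b))" using insert by (intro has_dir_deriv_scale) auto
        with elim c show "has_dir_deriv g x (\<Sum>b\<in>insert b F. (v \<bullet> b) *\<^sub>R b) (c \<bullet> (\<Sum>b\<in>insert b F. (v \<bullet> b) *\<^sub>R b))"
          using insert by (simp add: inner_add_right)
      qed
    qed
  qed
  from this[of Basis] show ?thesis by (simp add: euclidean_representation)
qed

text \<open>By compactness, finitely many directions of \<open>D\<close> form a fine net of the unit
  sphere, and their quotients converge uniformly; the Lipschitz bound carries the estimate from the
  nearest net direction to an arbitrary one.\<close>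

lemma has_derivative_of_dense_dir_deriv:
  assumes D: "closure D = UNIV" and dd: "\<And>v. v \<in> D \<Longrightarrow> has_dir_deriv g x v (c \<bullet> v)"
  shows "(g has_derivative (\<lambda>h. c \<bullet> h)) (at x)"
  unfolding has_derivative_at_alt
proof (intro conjI allI impI)
  show "bounded_linear (\<lambda>h. c \<bullet> h)" by (rule bounded_linear_inner_right)
  fix e :: real assume e: "e > 0"
  \<comment> \<open>Per unit length the three errors are \<open>\<eta>\<close> at the net direction,
    \<open>L * \<eta>\<close> for moving the argument of \<open>g\<close> and
    \<open>norm c * \<eta>\<close> for moving that of the linear part; together at most
    \<open>e\<close>.\<close>
  define \<eta> where "\<eta> = e / (L + 1 + norm c)"
  have pos: "L + 1 + norm c > 0" using lipschitz_real_nonneg by (simp add: add_nonneg_pos add_pos_nonneg)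
  then have \<eta>: "\<eta> > 0" using e by (simp add: \<eta>_def)
  have "sphere (0::'a) 1 \<subseteq> (\<Union>v\<in>D. ball v \<eta>)"
  proof
    fix u :: 'a
    have "u \<in> closure D" using D by simp
    then obtain v where "v \<in> D" "dist v u < \<eta>" using \<eta> closure_approachable by blast
    then show "u \<in> (\<Union>v\<in>D. ball v \<eta>)" by auto
  qed
  then obtain F where F: "F \<subseteq> D" "finite F" "sphere (0::'a) 1 \<subseteq> (\<Union>v\<in>F. ball v \<eta>)"
    using compactE_image[of "sphere (0::'a) 1" D "\<lambda>v. ball v \<eta>"] by (auto simp: compact_sphere)
  have "\<forall>v\<in>F. \<forall>\<^sub>F s in at 0. \<bar>(g (x + s *\<^sub>R v) - g x) / s - c \<bullet> v\<bar> < \<eta>"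
  proof
    fix v assume "v \<in> F"
    then have "((\<lambda>s. (g (x + s *\<^sub>R v) - g x) / s) \<longlongrightarrow> c \<bullet> v) (at 0)"
      using F(1) dd unfolding has_dir_deriv_def by blast
    from tendstoD[OF this \<eta>] show "\<forall>\<^sub>F s in at 0. \<bar>(g (x + s *\<^sub>R v) - g x) / s - c \<bullet> v\<bar> < \<eta>"
      by (simp add: dist_real_def)
  qed
  then have "\<forall>\<^sub>F s in at 0. \<forall>v\<in>F. \<bar>(g (x + s *\<^sub>R v) - g x) / s - c \<bullet> v\<bar> < \<eta>"
    using F(2) by (simp add: eventually_ball_finite)
  then obtain d where d: "d > 0" "\<And>s v. s \<noteq> 0 \<Longrightarrow> \<bar>s\<bar> < d \<Longrightarrow> v \<in> F \<Longrightarrow> \<bar>(g (x + s *\<^sub>R v) - g x) / s - c \<bullet> v\<bar> < \<eta>"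
    unfolding eventually_at by (auto simp: dist_real_def)
  have "\<bar>g y - g x - c \<bullet> (y - x)\<bar> \<le> e * norm (y - x)" if y: "norm (y - x) < d" for y
  proof (cases "y = x")
    case False
    define s where "s = norm (y - x)"
    have s: "s > 0" "s < d" using False y by (auto simp: s_def)
    define u where "u = (1 / s) *\<^sub>R (y - x)"
    have u: "norm u = 1" "y = x + s *\<^sub>R u" using s by (auto simp: u_def s_def)
    then obtain v where v: "v \<in> F" "norm (v - u) < \<eta>" using F(3) by (force simp: dist_norm)
    have "\<bar>(g (x + s *\<^sub>R v) - g x) / s - c \<bullet> v\<bar> < \<eta>" using d(2)[of s v] s v by simp
    then have "\<bar>((g (x + s *\<^sub>R v) - g x) - s * (c \<bullet> v)) / s\<bar> < \<eta>" using s by (simp add: diff_divide_distrib)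
    then have 1: "\<bar>g (x + s *\<^sub>R v) - g x - s * (c \<bullet> v)\<bar> \<le> s * \<eta>" using s by (simp add: field_simps)
    have "norm (y - (x + s *\<^sub>R v)) = s * norm (v - u)"
      using s u(2) by (metis abs_of_pos add_diff_cancel_left norm_minus_commute norm_scaleR scaleR_diff_right)
    then have 2: "\<bar>g y - g (x + s *\<^sub>R v)\<bar> \<le> L * (s * \<eta>)"
      using lip[of y "x + s *\<^sub>R v"] v s lipschitz_real_nonneg
      by (smt (verit, best) mult_left_mono mult_le_cancel_left_pos)
    have "\<bar>c \<bullet> (v - u)\<bar> \<le> norm c * norm (v - u)" by (rule Cauchy_Schwarz_ineq2)
    also have "\<dots> \<le> norm c * \<eta>" using v by (intro mult_left_mono) auto
    finally have 3: "\<bar>s * (c \<bullet> v) - s * (c \<bullet> u)\<bar> \<le> s * (norm c * \<eta>)"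
      using s by (simp add: inner_diff_right abs_mult flip: right_diff_distrib)
    have "c \<bullet> (y - x) = s * (c \<bullet> u)" using u by simp
    then have "\<bar>g y - g x - c \<bullet> (y - x)\<bar> \<le> s * \<eta> + L * (s * \<eta>) + s * (norm c * \<eta>)"
      using 1 2 3 by linarith
    also have "\<dots> = s * (\<eta> * (L + 1 + norm c))" by (simp add: algebra_simps)
    also have "\<dots> = e * s" using pos by (simp add: \<eta>_def)
    finally show ?thesis by (simp add: s_def)
  qed simp
  then show "\<exists>d>0. \<forall>y. norm (y - x) < d \<longrightarrow> norm (g y - g x - c \<bullet> (y - x)) \<le> e * norm (y - x)"
    using d(1) by auto
qed

lemma AE_differentiable_real: "AE x in lborel. g differentiable (at x)"
proof -
  \<comment> \<open>Countability of \<open>D\<close> lets the almost-everywhere statements for its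
    directions hold at one common point.\<close>
  obtain D :: "'a set" where D: "countable D" "closure D = UNIV"
  proof -
    obtain D :: "'a set" where "countable D" and D: "\<And>X. open X \<Longrightarrow> X \<noteq> {} \<Longrightarrow> \<exists>d\<in>D. d \<in> X"
      using countable_dense_setE by blast
    moreover have "x \<in> closure D" for x
    proof (rule ccontr)
      assume "x \<notin> closure D"
      then have "- closure D \<noteq> {}" by auto
      then obtain d where "d \<in> D" "d \<in> - closure D" using D[of "- closure D"] by auto
      then show False using closure_subset by blast
    qed
    ultimately show thesis using that by blast
  qed
  have "AE x in lborel. \<forall>b\<in>Basis. \<exists>l. has_dir_deriv g x b l"
    using AE_has_dir_deriv by (intro AE_finite_allI) auto
  moreover have "AE x in lborel. \<forall>v\<in>D. \<forall>c. (\<forall>b\<in>Basis. has_dir_deriv g x b (c \<bullet> b)) \<longrightarrow> has_dir_deriv g x v (c \<bullet> v)"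
    using AE_has_dir_deriv_linear D(1) by (simp add: AE_ball_countable)
  ultimately show ?thesis
  proof eventually_elim
    case (elim x)
    then obtain l where l: "\<And>b. b \<in> Basis \<Longrightarrow> has_dir_deriv g x b (l b)" by metis
    define c where "c = (\<Sum>b\<in>Basis. l b *\<^sub>R b)"
    have "c \<bullet> b = l b" if "b \<in> Basis" for b using that by (simp add: c_def inner_sum_left_Basis)
    then have "has_dir_deriv g x v (c \<bullet> v)" if "v \<in> D" for v using elim l that by simp
    then show ?case using has_derivative_of_dense_dir_deriv[OF D(2)] differentiable_def by blast
  qed
qed

end

theorem rademacher:
  fixes f :: "'a::euclidean_space \<Rightarrow> 'b::euclidean_space"
  assumes lip: "\<And>x y. norm (f x - f y) \<le> L * norm (x - y)"
  shows "AE x in lborel. f differentiable (at x)"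
proof -
  have "AE x in lborel. \<forall>b\<in>Basis. (\<lambda>x. f x \<bullet> b) differentiable (at x)"
  proof (intro AE_finite_allI AE_differentiable_real)
    fix b :: 'b and x y assume "b \<in> Basis"
    then show "\<bar>f x \<bullet> b - f y \<bullet> b\<bar> \<le> L * norm (x - y)"
      using Basis_le_norm[of b "f x - f y"] lip[of x y] by (simp add: inner_diff_left)
  qed auto
  then show ?thesis
    by eventually_elim (subst differentiable_componentwise_within, simp)
qed

section \<open>Images under differentiable maps\<close>

lemma measure_differentiable_image_le_wellorder:
  fixes f g :: "real^'n::{finite,wellorder} \<Rightarrow> real^'n::_"
  assumes S: "S \<in> lmeasurable"
    and f: "\<And>x. x \<in> S \<Longrightarrow> (f has_derivative (\<lambda>h. A x *v h)) (at x)"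
    and g: "\<And>x. x \<in> S \<Longrightarrow> (g has_derivative (\<lambda>h. B x *v h)) (at x)"
    and le: "\<And>x. x \<in> S \<Longrightarrow> \<bar>det (A x)\<bar> \<le> C * \<bar>det (B x)\<bar>"
    and bd: "\<And>x. x \<in> S \<Longrightarrow> \<bar>det (B x)\<bar> \<le> K" and C: "C \<ge> 0"
    and inj: "inj_on g {x \<in> S. det (B x) \<noteq> 0}"
  shows "f ` S \<in> lmeasurable" "g ` S \<in> lmeasurable" "measure lebesgue (f ` S) \<le> C * measure lebesgue (g ` S)"
proof -
  have f': "(f has_derivative (\<lambda>h. A x *v h)) (at x within S)" if "x \<in> S" for x
    using f[OF that] has_derivative_at_withinI by blast
  have g': "(g has_derivative (\<lambda>h. B x *v h)) (at x within S)" if "x \<in> S" for x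
    using g[OF that] has_derivative_at_withinI by blast
  have Ss: "S \<in> sets lebesgue" using S by auto
  have mA: "(\<lambda>x. det (A x)) \<in> borel_measurable (lebesgue_on S)"
    using borel_measurable_det_Jacobian[OF Ss f'] by (simp add: matrix_of_matrix_vector_mul)
  have mB: "(\<lambda>x. det (B x)) \<in> borel_measurable (lebesgue_on S)"
    using borel_measurable_det_Jacobian[OF Ss g'] by (simp add: matrix_of_matrix_vector_mul)
  have const: "(\<lambda>x. c) integrable_on S" for c :: real
    using S by (simp add: integrable_on_const)
  have iA: "(\<lambda>x. \<bar>det (A x)\<bar>) integrable_on S"
    by (rule measurable_bounded_by_integrable_imp_integrable[OF _ const[of "C * K"] _ Ss])
      (use mA le bd C in \<open>auto intro!: borel_measurable_abs intro: order_trans[OF le mult_left_mono]\<close>)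
  have iB: "(\<lambda>x. \<bar>det (B x)\<bar>) integrable_on S"
    by (rule measurable_bounded_by_integrable_imp_integrable[OF _ const[of K] _ Ss])
      (use mB bd in \<open>auto intro!: borel_measurable_abs\<close>)
  show fS: "f ` S \<in> lmeasurable"
    using measurable_differentiable_image[OF Ss f'] iA by (simp add: matrix_of_matrix_vector_mul)
  show gS: "g ` S \<in> lmeasurable"
    using measurable_differentiable_image[OF Ss g'] iB by (simp add: matrix_of_matrix_vector_mul)
  define T where "T = {x \<in> S. det (B x) \<noteq> 0}"
  have Ts: "T \<in> sets lebesgue"
  proof -
    have "T = {x \<in> space (lebesgue_on S). det (B x) \<in> - {0}}" by (auto simp: T_def)
    also have "\<dots> \<in> sets (lebesgue_on S)" using mB by measurable
    finally show ?thesis using Ss by (metis sets_restrict_space_iff sets.Int_space_eq2 inf.absorb_iff2 T_def mem_Collect_eq subsetI sets_restrict_space_iff space_lebesgue_on Int_absorb1 Int_lower1 sets_lebesgue_on_refl)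
  qed
  have gT: "(g has_derivative (\<lambda>h. B x *v h)) (at x within T)" if "x \<in> T" for x
    using g[of x] that has_derivative_at_withinI T_def by blast
  have iBT: "((\<lambda>x. \<bar>det (B x)\<bar>) has_integral integral S (\<lambda>x. \<bar>det (B x)\<bar>)) T"
  proof (subst has_integral_restrict[symmetric])
    show "T \<subseteq> S" by (auto simp: T_def)
    show "((\<lambda>x. if x \<in> T then \<bar>det (B x)\<bar> else 0) has_integral integral S (\<lambda>x. \<bar>det (B x)\<bar>)) S"
      using iB by (rule has_integral_eq[OF _ integrable_integral, rotated]) (auto simp: T_def)
  qed
  have "measure lebesgue (f ` S) \<le> integral S (\<lambda>x. \<bar>det (A x)\<bar>)"
    using measure_differentiable_image[OF Ss f'] iA by (simp add: matrix_of_matrix_vector_mul)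
  also have "\<dots> \<le> integral S (\<lambda>x. C * \<bar>det (B x)\<bar>)"
    using iA iB le by (intro integral_le integrable_on_mult_right)
  also have "\<dots> = C * integral S (\<lambda>x. \<bar>det (B x)\<bar>)" by simp
  also have "integral S (\<lambda>x. \<bar>det (B x)\<bar>) = measure lebesgue (g ` T)"
    using has_measure_differentiable_image[OF Ts gT inj[folded T_def], of "integral S (\<lambda>x. \<bar>det (B x)\<bar>)"] iBT
    by (simp add: matrix_of_matrix_vector_mul)
  also have "C * measure lebesgue (g ` T) \<le> C * measure lebesgue (g ` S)"
  proof (rule mult_left_mono[OF _ C])
    have "g ` T \<in> sets lebesgue"
      using has_measure_differentiable_image[OF Ts gT inj[folded T_def], of "integral S (\<lambda>x. \<bar>det (B x)\<bar>)"] iBT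
      by (simp add: matrix_of_matrix_vector_mul fmeasurableD)
    then show "measure lebesgue (g ` T) \<le> measure lebesgue (g ` S)"
      using gS by (intro measure_mono_fmeasurable) (auto simp: T_def)
  qed
  finally show "measure lebesgue (f ` S) \<le> C * measure lebesgue (g ` S)" .
qed


text \<open>
  The library's change of variables theorems require the index type to be well-ordered; this
  well-ordered copy of a finite type is used to transport them to arbitrary finite index types.
\<close>
typedef (overloaded) ('a::finite) initial_segment = "{..<CARD('a)}"
  by (rule exI[of _ 0]) simp

instantiation initial_segment :: (finite) wellorder
begin

definition "x \<le> y \<longleftrightarrow> Rep_initial_segment x \<le> Rep_initial_segment y"
definition "x < y \<longleftrightarrow> Rep_initial_segment x < Rep_initial_segment y"

instance
proof
  fix P :: "'a initial_segment \<Rightarrow> bool" and a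
  assume *: "\<And>x. (\<And>y. y < x \<Longrightarrow> P y) \<Longrightarrow> P x"
  show "P a"
    by (induction a rule: measure_induct_rule[of Rep_initial_segment]) (metis * less_initial_segment_def)
qed (auto simp: less_eq_initial_segment_def less_initial_segment_def Rep_initial_segment_inject)

end

lemma card_initial_segment: "card (UNIV :: 'a::finite initial_segment set) = CARD('a)"
  using type_definition.card[OF type_definition_initial_segment[where 'a='a]] by simp

instance initial_segment :: (finite) finite
proof
  have "inj_on Rep_initial_segment (UNIV :: 'a initial_segment set)" by (simp add: inj_on_def Rep_initial_segment_inject)
  moreover have "Rep_initial_segment x < CARD('a)" for x :: "'a initial_segment"
    using Rep_initial_segment[of x] by simp
  then have "range (Rep_initial_segment :: 'a initial_segment \<Rightarrow> nat) \<subseteq> {..<CARD('a)}" by auto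
  ultimately show "finite (UNIV :: 'a initial_segment set)"
    by (meson finite_lessThan finite_imageD finite_subset)
qed

text \<open>Conjugation by \<open>\<pi>\<close> matches the permutations in the two Leibniz sums and
  preserves their signs.\<close>

lemma det_reindex:
  fixes A :: "real^'n^'n" and \<pi> :: "'m::finite \<Rightarrow> 'n::finite"
  assumes \<pi>: "bij \<pi>"
  shows "det (\<chi> i j. A $ \<pi> i $ \<pi> j) = det A"
proof -
  let ?c = "\<lambda>p. map_permutation UNIV \<pi> p"
  have inj: "inj \<pi>" and surj: "range \<pi> = UNIV" using \<pi> by (auto simp: bij_def)
  have c: "?c p (\<pi> i) = \<pi> (p i)" for p i
    using inj surj by (simp add: map_permutation_def restrict_id_def)
  have surj': "range (inv \<pi>) = UNIV" and inv': "inv (inv \<pi>) = \<pi>"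
    using bij_imp_bij_inv[OF \<pi>] inv_inv_eq[OF \<pi>] by (auto simp: bij_def)
  have bij: "bij_betw ?c {p. p permutes (UNIV::'m set)} {p. p permutes (UNIV::'n set)}"
  proof (rule bij_betwI[where g="\<lambda>p. map_permutation UNIV (inv \<pi>) p"])
    show "?c \<in> {p. p permutes UNIV} \<rightarrow> {p. p permutes UNIV}"
      using map_permutation_permutes[OF \<pi>] by auto
    show "map_permutation UNIV (inv \<pi>) \<in> {p. p permutes UNIV} \<rightarrow> {p. p permutes UNIV}"
      using map_permutation_permutes[OF bij_imp_bij_inv[OF \<pi>]] by auto
    show "map_permutation UNIV (inv \<pi>) (?c p) = p" for p
      by (simp add: map_permutation_def restrict_id_def fun_eq_iff surj surj' inv' inv_f_f[OF inj])
    show "?c (map_permutation UNIV (inv \<pi>) p) = p" for p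
      by (simp add: map_permutation_def restrict_id_def fun_eq_iff surj surj' inv' surj_f_inv_f[OF surj])
  qed
  have "det A = (\<Sum>p | p permutes UNIV. of_int (sign p) * (\<Prod>i\<in>UNIV. A $ i $ p i))"
    by (simp add: det_def)
  also have "\<dots> = (\<Sum>p | p permutes UNIV. of_int (sign (?c p)) * (\<Prod>i\<in>UNIV. A $ i $ ?c p i))"
    using sum.reindex_bij_betw[OF bij, of "\<lambda>p. of_int (sign p) * (\<Prod>i\<in>UNIV. A $ i $ p i)"] by simp
  also have "\<dots> = (\<Sum>p | p permutes UNIV. of_int (sign p) * (\<Prod>i\<in>UNIV. A $ \<pi> i $ \<pi> (p i)))"
  proof (rule sum.cong[OF refl])
    fix p :: "'m \<Rightarrow> 'm" assume p: "p \<in> {p. p permutes UNIV}"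
    have "sign (?c p) = sign p" using p inj by (intro sign_map_permutation) auto
    moreover have "(\<Prod>i\<in>UNIV. A $ i $ ?c p i) = (\<Prod>i\<in>UNIV. A $ \<pi> i $ \<pi> (p i))"
      using prod.reindex_bij_betw[OF \<pi>, of "\<lambda>i. A $ i $ ?c p i"] by (simp add: c)
    ultimately show "of_int (sign (?c p)) * (\<Prod>i\<in>UNIV. A $ i $ ?c p i) = of_int (sign p) * (\<Prod>i\<in>UNIV. A $ \<pi> i $ \<pi> (p i))" by simp
  qed
  also have "\<dots> = det (\<chi> i j. A $ \<pi> i $ \<pi> j)" by (simp add: det_def)
  finally show ?thesis by simp
qed

definition reindex :: "('m \<Rightarrow> 'n) \<Rightarrow> real^'n \<Rightarrow> real^'m" where
  "reindex \<pi> x = (\<chi> i. x $ \<pi> i)"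

lemma reindex_inverse:
  assumes "bij \<pi>"
  shows "reindex (inv \<pi>) (reindex \<pi> x) = x" "reindex \<pi> (reindex (inv \<pi>) y) = y"
  using assms by (simp_all add: reindex_def vec_eq_iff bij_def inv_f_f surj_f_inv_f)

lemma bounded_linear_reindex: "bounded_linear (reindex (\<pi> :: 'm::finite \<Rightarrow> 'n::finite))"
proof -
  have "linear (reindex \<pi>)" by (rule linearI) (simp_all add: reindex_def vec_eq_iff)
  then show ?thesis by (rule linear_conv_bounded_linear[THEN iffD1])
qed

lemma prod_Basis_cart: "(\<Prod>b\<in>Basis. (x :: real^'n) \<bullet> b) = (\<Prod>i\<in>UNIV. x $ i)"
proof -
  have "inj (\<lambda>i::'n. axis i (1::real))" by (auto simp: inj_on_def axis_eq_axis)
  moreover have "(Basis :: (real^'n) set) = range (\<lambda>i. axis i 1)" by (auto simp: Basis_vec_def)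
  ultimately have "(\<Prod>b\<in>Basis. x \<bullet> b) = (\<Prod>i\<in>UNIV. x \<bullet> axis i 1)"
    using prod.reindex[of "\<lambda>i::'n. axis i (1::real)" UNIV "\<lambda>b. x \<bullet> b"] by (simp add: o_def)
  then show ?thesis by (simp add: inner_axis)
qed

lemma distr_lborel_reindex:
  fixes \<pi> :: "'m::finite \<Rightarrow> 'n::finite"
  assumes \<pi>: "bij \<pi>"
  shows "distr lborel borel (reindex \<pi>) = lborel"
proof (rule lborel_eqI[symmetric])
  have [measurable]: "reindex \<pi> \<in> borel_measurable borel"
    by (intro borel_measurable_continuous_onI linear_continuous_on bounded_linear_reindex)
  fix l u :: "real^'m" assume lu: "\<And>b. b \<in> Basis \<Longrightarrow> l \<bullet> b \<le> u \<bullet> b"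
  have sets: "reindex \<pi> -` box l u = box (reindex (inv \<pi>) l) (reindex (inv \<pi>) u)"
  proof -
    have "(\<forall>i. l $ i < x $ \<pi> i \<and> x $ \<pi> i < u $ i) \<longleftrightarrow> (\<forall>j. l $ inv \<pi> j < x $ j \<and> x $ j < u $ inv \<pi> j)" for x
      using \<pi> by (metis bij_inv_eq_iff)
    then show ?thesis by (auto simp: mem_box_cart reindex_def)
  qed
  have le: "l $ i \<le> u $ i" for i using lu[of "axis i 1"] by (auto simp: inner_axis Basis_vec_def)
  have "emeasure (distr lborel borel (reindex \<pi>)) (box l u) = emeasure lborel (box (reindex (inv \<pi>) l) (reindex (inv \<pi>) u))"
    by (simp add: emeasure_distr sets)
  also have "\<dots> = (\<Prod>b\<in>Basis. (reindex (inv \<pi>) u - reindex (inv \<pi>) l) \<bullet> b)"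
    by (rule emeasure_lborel_box) (auto simp: Basis_vec_def inner_axis reindex_def le)
  also have "\<dots> = (\<Prod>j\<in>UNIV. (u - l) $ inv \<pi> j)"
    by (simp only: prod_Basis_cart) (simp add: reindex_def)
  also have "\<dots> = (\<Prod>i\<in>UNIV. (u - l) $ i)"
    using prod.reindex_bij_betw[OF bij_imp_bij_inv[OF \<pi>], of "\<lambda>i. (u - l) $ i"] by simp
  also have "\<dots> = (\<Prod>b\<in>Basis. (u - l) \<bullet> b)" by (simp only: prod_Basis_cart)
  finally show "emeasure (distr lborel borel (reindex \<pi>)) (box l u) = (\<Prod>b\<in>Basis. (u - l) \<bullet> b)" .
qed simp

text \<open>The box computation settles Borel sets; a Lebesgue set differs from a Borel set by part
  of a Borel null set, whose image is again null.\<close>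

lemma reindex_lebesgue:
  fixes \<pi> :: "'m::finite \<Rightarrow> 'n::finite"
  assumes \<pi>: "bij \<pi>" and S: "S \<in> sets lebesgue"
  shows "reindex \<pi> ` S \<in> sets lebesgue" "emeasure lebesgue (reindex \<pi> ` S) = emeasure lebesgue S"
proof -
  have meas: "reindex p \<in> borel_measurable borel" for p :: "'a::finite \<Rightarrow> 'b::finite"
    by (intro borel_measurable_continuous_onI linear_continuous_on bounded_linear_reindex)
  have vim: "reindex \<pi> ` T = reindex (inv \<pi>) -` T" for T
  proof safe
    fix x assume "x \<in> T"
    then show "reindex \<pi> x \<in> reindex (inv \<pi>) -` T" by (simp add: reindex_inverse[OF \<pi>])
  next
    fix y assume "reindex (inv \<pi>) y \<in> T"
    then show "y \<in> reindex \<pi> ` T" by (metis imageI reindex_inverse(2)[OF \<pi>])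
  qed
  have "inj (reindex \<pi> :: real^'n \<Rightarrow> real^'m)" by (metis injI reindex_inverse(1)[OF \<pi>])
  then have vim': "reindex \<pi> -` (reindex \<pi> ` T) = T" for T :: "(real^'n) set"
    by (rule inj_vimage_image_eq)
  have b: "reindex \<pi> ` T \<in> sets borel \<and> emeasure lborel (reindex \<pi> ` T) = emeasure lborel T" if T: "T \<in> sets borel" for T
  proof
    show TT: "reindex \<pi> ` T \<in> sets borel"
      using measurable_sets[OF meas T, of "inv \<pi>"] by (simp add: vim)
    have "emeasure lborel (reindex \<pi> ` T) = emeasure (distr lborel borel (reindex \<pi>)) (reindex \<pi> ` T)"
      by (simp add: distr_lborel_reindex[OF \<pi>])
    also have "\<dots> = emeasure lborel T" using emeasure_distr[of "reindex \<pi>" lborel borel "reindex \<pi> ` T"] TT meas[of \<pi>] by (simp add: vim')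
    finally show "emeasure lborel (reindex \<pi> ` T) = emeasure lborel T" .
  qed
  obtain B N N' where B: "B \<in> sets lborel" "S = B \<union> N" "N \<subseteq> N'" "N' \<in> null_sets lborel"
    using S by (rule sets_completionE)
  have "reindex \<pi> ` N' \<in> null_sets lborel" using b[of N'] B by (auto simp: null_sets_def)
  moreover have "reindex \<pi> ` N \<subseteq> reindex \<pi> ` N'" using B by auto
  ultimately have N: "reindex \<pi> ` N \<in> null_sets lebesgue" by (metis null_sets_completion_subset null_sets_completionI)
  have N0: "N \<in> null_sets lebesgue" using B by (metis null_sets_completion_subset null_sets_completionI)
  have B': "reindex \<pi> ` B \<in> sets lebesgue" "B \<in> sets lebesgue" using b[of B] B by (auto intro: sets_completionI_sets)
  show "reindex \<pi> ` S \<in> sets lebesgue" using B' N B by (auto simp: image_Un null_setsD2)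
  have "emeasure lebesgue (reindex \<pi> ` S) = emeasure lebesgue (reindex \<pi> ` B)"
    using B' N B by (simp add: image_Un emeasure_Un_null_set)
  also have "\<dots> = emeasure lebesgue B" using b[of B] B by simp
  also have "\<dots> = emeasure lebesgue S" using B' N0 B by (simp add: emeasure_Un_null_set)
  finally show "emeasure lebesgue (reindex \<pi> ` S) = emeasure lebesgue S" .
qed

lemma reindex_measure:
  fixes \<pi> :: "'m::finite \<Rightarrow> 'n::finite"
  assumes \<pi>: "bij \<pi>"
  shows "reindex \<pi> ` S \<in> lmeasurable \<longleftrightarrow> S \<in> lmeasurable"
    "S \<in> sets lebesgue \<Longrightarrow> measure lebesgue (reindex \<pi> ` S) = measure lebesgue S"
proof -
  have imp: "reindex \<pi> ` S \<in> lmeasurable" if "S \<in> lmeasurable" "bij \<pi>" for S and \<pi> :: "'a::finite \<Rightarrow> 'b::finite"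
    using that reindex_lebesgue[OF that(2), of S] by (auto simp: fmeasurable_def)
  show "reindex \<pi> ` S \<in> lmeasurable \<longleftrightarrow> S \<in> lmeasurable"
  proof
    assume "reindex \<pi> ` S \<in> lmeasurable"
    from imp[OF this bij_imp_bij_inv[OF \<pi>]] show "S \<in> lmeasurable"
      by (simp add: image_image reindex_inverse[OF \<pi>])
  qed (use imp \<pi> in blast)
  show "measure lebesgue (reindex \<pi> ` S) = measure lebesgue S" if "S \<in> sets lebesgue"
    using reindex_lebesgue[OF \<pi> that] by (simp add: measure_def)
qed

lemma has_derivative_reindex:
  fixes \<pi> :: "'m::finite \<Rightarrow> 'n::finite" and f :: "real^'n \<Rightarrow> real^'n"
  assumes \<pi>: "bij \<pi>" and f: "(f has_derivative (\<lambda>h. A *v h)) (at x)"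
  shows "((\<lambda>y. reindex \<pi> (f (reindex (inv \<pi>) y))) has_derivative (\<lambda>h. (\<chi> i j. A $ \<pi> i $ \<pi> j) *v h)) (at (reindex \<pi> x))"
proof -
  have "((\<lambda>y. reindex (inv \<pi>) y) has_derivative reindex (inv \<pi>)) (at (reindex \<pi> x))"
    by (rule bounded_linear_imp_has_derivative[OF bounded_linear_reindex])
  moreover have "(f has_derivative (\<lambda>h. A *v h)) (at (reindex (inv \<pi>) (reindex \<pi> x)))"
    using f by (simp add: reindex_inverse[OF \<pi>])
  ultimately have "((\<lambda>y. f (reindex (inv \<pi>) y)) has_derivative (\<lambda>h. A *v reindex (inv \<pi>) h)) (at (reindex \<pi> x))"
    by (rule has_derivative_compose)
  then have "((\<lambda>y. reindex \<pi> (f (reindex (inv \<pi>) y))) has_derivative (\<lambda>h. reindex \<pi> (A *v reindex (inv \<pi>) h))) (at (reindex \<pi> x))"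
    by (rule bounded_linear.has_derivative[OF bounded_linear_reindex])
  moreover have "reindex \<pi> (A *v reindex (inv \<pi>) h) = (\<chi> i j. A $ \<pi> i $ \<pi> j) *v h" for h
  proof -
    have "(\<Sum>j\<in>UNIV. A $ \<pi> i $ j * h $ inv \<pi> j) = (\<Sum>j\<in>UNIV. A $ \<pi> i $ \<pi> j * h $ j)" for i
      using sum.reindex_bij_betw[OF \<pi>, of "\<lambda>j. A $ \<pi> i $ j * h $ inv \<pi> j"] \<pi> by (simp add: bij_def inv_f_f)
    then show ?thesis by (simp add: reindex_def matrix_vector_mult_def vec_eq_iff)
  qed
  ultimately show ?thesis by simp
qed

text \<open>In the application the parameter is a slope variable, \<open>g\<close> is the gradient
  of the conjugate and yields contact points, and \<open>f\<close> yields the slopes themselves.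
  Comparing the two images directly avoids inverting \<open>g\<close>, which can fail where its
  Jacobian is singular.\<close>

theorem measure_differentiable_image_le:
  fixes f g :: "real^'n \<Rightarrow> real^'n"
  assumes S: "S \<in> lmeasurable"
    and f: "\<And>x. x \<in> S \<Longrightarrow> (f has_derivative (\<lambda>h. A x *v h)) (at x)"
    and g: "\<And>x. x \<in> S \<Longrightarrow> (g has_derivative (\<lambda>h. B x *v h)) (at x)"
    and le: "\<And>x. x \<in> S \<Longrightarrow> \<bar>det (A x)\<bar> \<le> C * \<bar>det (B x)\<bar>"
    and bd: "\<And>x. x \<in> S \<Longrightarrow> \<bar>det (B x)\<bar> \<le> K" and C: "C \<ge> 0"
    and inj: "inj_on g {x \<in> S. det (B x) \<noteq> 0}"
  shows "f ` S \<in> lmeasurable" "g ` S \<in> lmeasurable" "measure lebesgue (f ` S) \<le> C * measure lebesgue (g ` S)"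
proof -
  obtain \<pi> :: "'n initial_segment \<Rightarrow> 'n" where \<pi>: "bij \<pi>"
    using finite_same_card_bij[of "UNIV :: 'n initial_segment set" "UNIV :: 'n set"] card_initial_segment by auto
  let ?r = "reindex \<pi>" and ?q = "reindex (inv \<pi>)"
  note rq = reindex_inverse[OF \<pi>]
  let ?A = "\<lambda>y. (\<chi> i j. A (?q y) $ \<pi> i $ \<pi> j) :: real^'n initial_segment^'n initial_segment"
  let ?B = "\<lambda>y. (\<chi> i j. B (?q y) $ \<pi> i $ \<pi> j) :: real^'n initial_segment^'n initial_segment"
  have im: "(\<lambda>y. ?r (h (?q y))) ` ?r ` S = ?r ` h ` S" for h :: "real^'n \<Rightarrow> real^'n"
    by (simp add: image_image rq)
  have S': "?r ` S \<in> lmeasurable" using S reindex_measure[OF \<pi>] by blast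
  have H: "((\<lambda>y. ?r (f (?q y))) has_derivative (\<lambda>h. ?A y *v h)) (at y)"
      "((\<lambda>y. ?r (g (?q y))) has_derivative (\<lambda>h. ?B y *v h)) (at y)"
      "\<bar>det (?A y)\<bar> \<le> C * \<bar>det (?B y)\<bar>" "\<bar>det (?B y)\<bar> \<le> K" if y: "y \<in> ?r ` S" for y
  proof -
    obtain x where x: "x \<in> S" "y = ?r x" using y by blast
    show "((\<lambda>y. ?r (f (?q y))) has_derivative (\<lambda>h. ?A y *v h)) (at y)"
      using has_derivative_reindex[OF \<pi> f[OF x(1)]] by (simp add: x rq)
    show "((\<lambda>y. ?r (g (?q y))) has_derivative (\<lambda>h. ?B y *v h)) (at y)"
      using has_derivative_reindex[OF \<pi> g[OF x(1)]] by (simp add: x rq)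
    show "\<bar>det (?A y)\<bar> \<le> C * \<bar>det (?B y)\<bar>" using le[OF x(1)] by (simp add: x rq det_reindex[OF \<pi>])
    show "\<bar>det (?B y)\<bar> \<le> K" using bd[OF x(1)] by (simp add: x rq det_reindex[OF \<pi>])
  qed
  have inj': "inj_on (\<lambda>y. ?r (g (?q y))) {y \<in> ?r ` S. det (?B y) \<noteq> 0}"
  proof (rule inj_onI)
    fix y z assume yz: "y \<in> {y \<in> ?r ` S. det (?B y) \<noteq> 0}" "z \<in> {y \<in> ?r ` S. det (?B y) \<noteq> 0}" "?r (g (?q y)) = ?r (g (?q z))"
    then have "g (?q y) = g (?q z)" by (metis rq(1))
    moreover have "?q y \<in> {x \<in> S. det (B x) \<noteq> 0}" "?q z \<in> {x \<in> S. det (B x) \<noteq> 0}"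
      using yz by (auto simp: rq det_reindex[OF \<pi>])
    ultimately have "?q y = ?q z" using inj by (auto dest: inj_onD)
    then show "y = z" by (metis rq(2))
  qed
  note T = measure_differentiable_image_le_wellorder[OF S' H C inj']
  then show fS: "f ` S \<in> lmeasurable" and gS: "g ` S \<in> lmeasurable" unfolding im reindex_measure(1)[OF \<pi>] by auto
  show "measure lebesgue (f ` S) \<le> C * measure lebesgue (g ` S)"
    using T fS gS reindex_measure(2)[OF \<pi>] unfolding im by (auto dest: fmeasurableD)
qed

section \<open>The Pucci inequality\<close>

text \<open>The choice operator in \<open>pucci_minus\<close> is replaced by an existential
  statement; all later arguments work with one eigenbasis that satisfies the inequality.\<close>

definition pucci_nonpos :: "real \<Rightarrow> real^'n^'n \<Rightarrow> bool" where
  "pucci_nonpos \<Lambda> N \<longleftrightarrow> (\<exists>e lam. eigenbasis N e lam \<and>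
      (\<Sum>i\<in>UNIV. if lam i > 0 then lam i else \<Lambda> * lam i) \<le> 0)"

lemma pucci_minus_imp_pucci_nonpos:
  assumes "transpose N = N" "pucci_minus \<Lambda> N \<le> 0"
  shows "pucci_nonpos \<Lambda> N"
proof -
  obtain e lam where e: "eigenbasis N e lam" using symmetric_eigenbasis_exists[OF assms(1)] .
  let ?P = "\<lambda>s. \<exists>(b :: 'a \<Rightarrow> real^'a) (lam :: 'a \<Rightarrow> real).
      (\<forall>i j. b i \<bullet> b j = (if i = j then 1 else 0)) \<and>
      (\<forall>i. N *v b i = lam i *\<^sub>R b i) \<and>
      s = (\<Sum>i\<in>UNIV. if lam i > 0 then lam i else \<Lambda> * lam i)"
  have "?P (\<Sum>i\<in>UNIV. if lam i > 0 then lam i else \<Lambda> * lam i)"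
    by (intro exI[of _ e] exI[of _ lam]) (use e in \<open>auto simp: eigenbasis_def\<close>)
  then have "?P (pucci_minus \<Lambda> N)" unfolding pucci_minus_def by (rule someI)
  then obtain b lam' where "eigenbasis N b lam'"
    "pucci_minus \<Lambda> N = (\<Sum>i\<in>UNIV. if lam' i > 0 then lam' i else \<Lambda> * lam' i)"
    unfolding eigenbasis_def by (elim exE conjE) simp
  then show ?thesis using assms(2) unfolding pucci_nonpos_def
    by (intro exI[of _ b] exI[of _ lam']) simp
qed

lemma mat1_mult_scaleR: "(c *\<^sub>R (mat 1 :: real^'n^'n)) *v x = c *\<^sub>R x"
  by (simp add: scaleR_matrix_vector_assoc[symmetric])

lemma eigenbasis_affine:
  assumes "eigenbasis M e lam"
  shows "eigenbasis (a *\<^sub>R M + c *\<^sub>R mat 1) e (\<lambda>i. a * lam i + c)"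
  using assms unfolding eigenbasis_def
  by (simp add: matrix_vector_mult_add_rdistrib mat1_mult_scaleR scaleR_matrix_vector_assoc[symmetric] algebra_simps)

lemma posdef_inverse:
  fixes K :: "real^'n^'n"
  assumes K: "transpose K = K" and pos: "\<And>x. x \<bullet> (K *v x) \<ge> c * (x \<bullet> x)" and c: "c > 0"
  obtains R where "transpose R = R" "K ** R = mat 1" "R ** K = mat 1"
proof -
  obtain e lam where e: "eigenbasis K e lam" using symmetric_eigenbasis_exists[OF K] .
  have "lam i > 0" for i
    using pos[of "e i"] e c by (simp add: eigenbasis_def)
  then have "det K \<noteq> 0" using eigenbasis_det[OF e] by (metis less_irrefl prod_zero_iff finite_class.finite_UNIV)
  then have "invertible K" by (simp add: invertible_det_nz)
  then obtain R where R: "K ** R = mat 1" "R ** K = mat 1" by (auto simp: invertible_def)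
  have "transpose R ** K = mat 1" by (metis K R(1) matrix_transpose_mul transpose_mat)
  then have "transpose R = R" by (metis R(1) matrix_mul_assoc matrix_mul_lid matrix_mul_rid)
  with R show thesis using that by blast
qed

text \<open>
  \<open>M\<close> plays the role of the inverse of \<open>D\<^sup>2v + 2b\<close>; since it may be singular it is perturbed by \<open>\<epsilon>\<close>. An eigenvalue
  \<open>\<lambda>\<close> of the Hessian corresponds to the eigenvalue \<open>1 / (\<lambda> + 2b)\<close> of \<open>M\<close>, so that the quotient of the two
  determinants is, up to \<open>\<epsilon>\<close>, the determinant of \<open>I + D\<^sup>2v / b\<close>.
\<close>
lemma pucci_det_bound_eps:
  fixes M R :: "real^'n^'n"
  assumes \<Lambda>: "\<Lambda> \<ge> 1" and b: "b > 0" and eps: "\<epsilon> > 0"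
    and lo: "\<And>x. 0 \<le> x \<bullet> (M *v x)" and hi: "\<And>x. x \<bullet> (M *v x) \<le> (1 / b) * (x \<bullet> x)"
    and KR: "(M + \<epsilon> *\<^sub>R mat 1) ** R = mat 1"
    and P: "pucci_nonpos \<Lambda> (R - (2 * b) *\<^sub>R mat 1)"
  shows "det (mat 1 - b *\<^sub>R M) \<le> (1 + 2 * (b * \<epsilon>)) *
     (real CARD('n) * \<Lambda> * (1 + 2 * (b * \<epsilon>)) * (1 + b * \<epsilon>)) ^ (CARD('n) - 1) * (b ^ CARD('n) * det (M + \<epsilon> *\<^sub>R mat 1))"
proof -
  let ?n = "real CARD('n)"
  define \<delta> where "\<delta> = b * \<epsilon>"
  have \<delta>: "\<delta> > 0" using b eps by (simp add: \<delta>_def)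
  obtain e lam where el: "eigenbasis (R - (2 * b) *\<^sub>R mat 1) e lam"
      and sum: "(\<Sum>i\<in>UNIV. if lam i > 0 then lam i else \<Lambda> * lam i) \<le> 0"
    using P by (auto simp: pucci_nonpos_def)
  have e: "\<And>i j. e i \<bullet> e j = (if i = j then 1 else 0)" using el by (auto simp: eigenbasis_def)
  define \<kappa> where "\<kappa> i = 1 / (lam i + 2 * b)" for i
  have Re: "R *v e i = (lam i + 2 * b) *\<^sub>R e i" for i
    using el unfolding eigenbasis_def
    by (simp add: matrix_vector_mult_diff_rdistrib mat1_mult_scaleR algebra_simps)
  have eK: "e i = (lam i + 2 * b) *\<^sub>R ((M + \<epsilon> *\<^sub>R mat 1) *v e i)" for i
  proof -
    have "e i = ((M + \<epsilon> *\<^sub>R mat 1) ** R) *v e i" by (simp add: KR)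
    also have "\<dots> = (M + \<epsilon> *\<^sub>R mat 1) *v (R *v e i)" by (simp add: matrix_vector_mul_assoc)
    finally show ?thesis by (simp add: Re matrix_vector_mult_scaleR)
  qed
  have nz: "lam i + 2 * b \<noteq> 0" for i using eK[of i] e[of i i] by auto
  have Ke: "(M + \<epsilon> *\<^sub>R mat 1) *v e i = \<kappa> i *\<^sub>R e i" for i
    using arg_cong[OF eK[of i], of "\<lambda>z. \<kappa> i *\<^sub>R z"] nz[of i] by (simp add: \<kappa>_def)
  have eK': "eigenbasis (M + \<epsilon> *\<^sub>R mat 1) e \<kappa>" using e Ke by (simp add: eigenbasis_def)
  have Me: "M *v e i = (\<kappa> i - \<epsilon>) *\<^sub>R e i" for i
    using Ke[of i] by (simp add: matrix_vector_mult_add_rdistrib mat1_mult_scaleR algebra_simps)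
  then have eM: "eigenbasis M e (\<lambda>i. \<kappa> i - \<epsilon>)" using e by (simp add: eigenbasis_def)
  have \<mu>lo: "\<kappa> i \<ge> \<epsilon>" for i using lo[of "e i"] by (simp add: Me e)
  have \<mu>hi: "b * (\<kappa> i - \<epsilon>) \<le> 1" for i
  proof -
    have "e i \<bullet> (M *v e i) = \<kappa> i - \<epsilon>" by (simp add: Me e)
    then have "\<kappa> i - \<epsilon> \<le> 1 / b" using hi[of "e i"] e[of i i] by simp
    then show ?thesis using b by (simp add: pos_le_divide_eq mult.commute)
  qed
  have \<kappa>pos: "\<kappa> i > 0" for i using \<mu>lo[of i] eps by linarith
  \<comment> \<open>\<open>\<rho> i\<close> is the eigenvalue of I - b M divided by that of b (M +
    \<epsilon> I); for vanishing \<epsilon> it becomes \<open>1 + lam i / b\<close>.\<close>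
  define \<rho> where "\<rho> i = 1 + 2 * \<delta> + lam i * (1 + \<delta>) / b" for i
  have \<rho>: "1 - b * (\<kappa> i - \<epsilon>) = b * \<kappa> i * \<rho> i" for i
  proof -
    have "b * \<kappa> i * \<rho> i = \<kappa> i * (b + 2 * \<delta> * b + lam i * (1 + \<delta>))" using b by (simp add: \<rho>_def field_simps)
    also have "\<dots> = \<kappa> i * ((lam i + 2 * b) * (1 + \<delta>) - b)" by (simp add: algebra_simps)
    also have "\<dots> = (1 + \<delta>) - b * \<kappa> i" using nz[of i] by (simp add: \<kappa>_def field_simps)
    finally show ?thesis by (simp add: \<delta>_def algebra_simps)
  qed
  have \<rho>0: "\<rho> i \<ge> 0" for i
  proof (rule ccontr)
    assume "\<not> \<rho> i \<ge> 0"
    then have "b * \<kappa> i * \<rho> i < 0" using b \<kappa>pos[of i] by (intro mult_pos_neg) auto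
    then show False using \<rho>[of i] \<mu>hi[of i] by linarith
  qed
  \<comment> \<open>Nonnegativity of the quotient, which comes from M being at most 1/b, bounds the
    Hessian from below by about -b.\<close>
  have lamlo: "lam i \<ge> - (b * (1 + 2 * \<delta>))" for i
  proof (cases "lam i \<ge> 0")
    case True
    have "b * (1 + 2 * \<delta>) \<ge> 0" using b \<delta> by simp
    then show ?thesis using True by linarith
  next
    case False
    have "0 \<le> b * \<rho> i" using \<rho>0[of i] b by simp
    also have "\<dots> = b * (1 + 2 * \<delta>) + lam i * (1 + \<delta>)" using b by (simp add: \<rho>_def field_simps)
    also have "\<dots> \<le> b * (1 + 2 * \<delta>) + lam i" using False \<delta> by (simp add: mult_le_0_iff algebra_simps)
    finally show ?thesis by simp
  qed
  \<comment> \<open>Otherwise the Pucci sum would be positive. This eigenvalue supplies the one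
    factor close to 1, which is why the exponent in the bound is n - 1 and not n.\<close>
  have "\<exists>j. lam j \<le> 0"
  proof (rule ccontr)
    assume "\<not> (\<exists>j. lam j \<le> 0)"
    then have "(\<Sum>i\<in>UNIV. if lam i > 0 then lam i else \<Lambda> * lam i) > 0"
      by (intro sum_pos) (auto simp: not_le)
    then show False using sum by simp
  qed
  then obtain j where j: "lam j \<le> 0" by blast
  define B where "B = ?n * \<Lambda> * (1 + 2 * \<delta>) * (1 + \<delta>)"
  have n1: "?n \<ge> 1" by (simp add: Suc_le_eq)
  have \<rho>j: "\<rho> i \<le> 1 + 2 * \<delta>" if "lam i \<le> 0" for i
    using that b \<delta> by (simp add: \<rho>_def divide_nonpos_pos mult_nonpos_nonneg)
  have B1: "1 + 2 * \<delta> \<le> B"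
  proof -
    have "1 \<le> ?n * \<Lambda>" using n1 \<Lambda> mult_mono[of 1 ?n 1 \<Lambda>] by simp
    then have "1 * 1 \<le> (?n * \<Lambda>) * (1 + \<delta>)" using \<delta> by (intro mult_mono) auto
    then have "(1 + 2 * \<delta>) * 1 \<le> (1 + 2 * \<delta>) * ((?n * \<Lambda>) * (1 + \<delta>))" using \<delta> by (intro mult_left_mono) auto
    then show ?thesis by (simp add: B_def algebra_simps)
  qed
  have \<rho>B: "\<rho> i \<le> B" for i
  proof (cases "lam i \<le> 0")
    case True then show ?thesis using \<rho>j B1 by (meson order_trans)
  next
    case False
    let ?t = "\<lambda>i. if lam i > 0 then lam i else \<Lambda> * lam i"
    \<comment> \<open>A positive eigenvalue is balanced by the other n - 1, each contributing at
      least \<open>- (\<Lambda> * (b * (1 + 2 * \<delta>)))\<close>; this is the source of the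
      factor n \<Lambda>.\<close>
    have "(\<Sum>k\<in>UNIV. ?t k) = lam i + (\<Sum>k\<in>UNIV - {i}. ?t k)"
      using False by (subst sum.remove[of UNIV i]) auto
    moreover have "(\<Sum>k\<in>UNIV - {i}. ?t k) \<ge> (\<Sum>k\<in>UNIV - {i}. - (\<Lambda> * (b * (1 + 2 * \<delta>))))"
    proof (rule sum_mono)
      fix k
      have nn: "\<Lambda> * (b * (1 + 2 * \<delta>)) \<ge> 0" using \<Lambda> b \<delta> by simp
      have "\<Lambda> * lam k \<ge> \<Lambda> * (- (b * (1 + 2 * \<delta>)))" using lamlo[of k] \<Lambda> by (intro mult_left_mono) auto
      then show "?t k \<ge> - (\<Lambda> * (b * (1 + 2 * \<delta>)))" using nn by auto
    qed
    moreover have "real (card (UNIV - {i})) = ?n - 1"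
      using n1 by (simp add: card_Diff_singleton of_nat_diff Suc_le_eq)
    ultimately have "lam i \<le> (?n - 1) * (\<Lambda> * (b * (1 + 2 * \<delta>)))" using sum by simp
    then have "lam i * (1 + \<delta>) / b \<le> (?n - 1) * (\<Lambda> * (b * (1 + 2 * \<delta>))) * (1 + \<delta>) / b"
      using b \<delta> by (intro divide_right_mono mult_right_mono) auto
    also have "\<dots> = (?n - 1) * \<Lambda> * (1 + 2 * \<delta>) * (1 + \<delta>)" using b by simp
    finally have "\<rho> i \<le> (1 + 2 * \<delta>) + (?n - 1) * \<Lambda> * (1 + 2 * \<delta>) * (1 + \<delta>)" by (simp add: \<rho>_def)
    moreover have "(1 + 2 * \<delta>) \<le> \<Lambda> * (1 + 2 * \<delta>) * (1 + \<delta>)"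
    proof -
      have "1 * 1 \<le> \<Lambda> * (1 + \<delta>)" using \<delta> \<Lambda> by (intro mult_mono) auto
      then have "(1 + 2 * \<delta>) * 1 \<le> (1 + 2 * \<delta>) * (\<Lambda> * (1 + \<delta>))" using \<delta> by (intro mult_left_mono) auto
      then show ?thesis by (simp add: algebra_simps)
    qed
    ultimately show ?thesis by (simp add: B_def algebra_simps)
  qed
  have "det (mat 1 - b *\<^sub>R M) = det ((- b) *\<^sub>R M + 1 *\<^sub>R mat 1)" by simp
  also have "\<dots> = (\<Prod>i\<in>UNIV. (- b) * (\<kappa> i - \<epsilon>) + 1)"
    by (rule eigenbasis_det[OF eigenbasis_affine[OF eM]])
  also have "\<dots> = (\<Prod>i\<in>UNIV. b * \<kappa> i * \<rho> i)" using \<rho> by (intro prod.cong) (auto simp: algebra_simps)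
  also have "\<dots> = (\<Prod>i\<in>UNIV. \<rho> i) * (b ^ CARD('n) * det (M + \<epsilon> *\<^sub>R mat 1))"
    using eigenbasis_det[OF eK'] by (simp add: prod.distrib)
  also have "\<dots> \<le> ((1 + 2 * \<delta>) * B ^ (CARD('n) - 1)) * (b ^ CARD('n) * det (M + \<epsilon> *\<^sub>R mat 1))"
  proof (rule mult_right_mono)
    have "(\<Prod>i\<in>UNIV. \<rho> i) = \<rho> j * (\<Prod>i\<in>UNIV - {j}. \<rho> i)" by (rule prod.remove) auto
    also have "\<dots> \<le> (1 + 2 * \<delta>) * (\<Prod>i\<in>UNIV - {j}. B)"
      using \<rho>j[OF j] \<rho>0 \<rho>B \<delta> by (intro mult_mono prod_mono prod_nonneg) auto
    finally show "(\<Prod>i\<in>UNIV. \<rho> i) \<le> (1 + 2 * \<delta>) * B ^ (CARD('n) - 1)"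
      by (simp add: card_Diff_singleton)
    have "det (M + \<epsilon> *\<^sub>R mat 1) \<ge> 0" using eigenbasis_det[OF eK'] \<kappa>pos by (simp add: prod_nonneg less_imp_le)
    then show "0 \<le> b ^ CARD('n) * det (M + \<epsilon> *\<^sub>R mat 1)" using b by simp
  qed
  finally show ?thesis by (simp add: B_def \<delta>_def)
qed

text \<open>Both sides of the perturbed estimate are continuous in \<epsilon>, so it passes to the
  limit. The inverse \<open>R\<close> depends on \<epsilon> and may blow up, but it does not occur
  in the estimate.\<close>

lemma pucci_det_bound:
  fixes M :: "real^'n^'n"
  assumes \<Lambda>: "\<Lambda> \<ge> 1" and b: "b > 0"
    and lo: "\<And>x. 0 \<le> x \<bullet> (M *v x)" and hi: "\<And>x. x \<bullet> (M *v x) \<le> (1 / b) * (x \<bullet> x)"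
    and R: "\<And>\<epsilon>. \<epsilon> > 0 \<Longrightarrow> \<exists>R. (M + \<epsilon> *\<^sub>R mat 1) ** R = mat 1 \<and> pucci_nonpos \<Lambda> (R - (2 * b) *\<^sub>R mat 1)"
  shows "det (mat 1 - b *\<^sub>R M) \<le> (real CARD('n) * \<Lambda>) ^ (CARD('n) - 1) * (b ^ CARD('n) * det M)"
proof (rule tendsto_le[OF _ _ tendsto_const])
  let ?F = "\<lambda>\<epsilon>. (1 + 2 * (b * \<epsilon>)) *
     (real CARD('n) * \<Lambda> * (1 + 2 * (b * \<epsilon>)) * (1 + b * \<epsilon>)) ^ (CARD('n) - 1) * (b ^ CARD('n) * det (M + \<epsilon> *\<^sub>R mat 1))"
  have d: "((\<lambda>\<epsilon>. det (M + \<epsilon> *\<^sub>R mat 1)) \<longlongrightarrow> det (M + 0 *\<^sub>R mat 1)) (at_right 0)"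
    unfolding det_def by (intro tendsto_intros)
  have "(?F \<longlongrightarrow> (1 + 2 * (b * 0)) *
     (real CARD('n) * \<Lambda> * (1 + 2 * (b * 0)) * (1 + b * 0)) ^ (CARD('n) - 1) * (b ^ CARD('n) * det (M + 0 *\<^sub>R mat 1))) (at_right 0)"
    by (intro tendsto_intros d)
  then show "(?F \<longlongrightarrow> (real CARD('n) * \<Lambda>) ^ (CARD('n) - 1) * (b ^ CARD('n) * det M)) (at_right 0)" by simp
  show "\<forall>\<^sub>F \<epsilon> in at_right 0. det (mat 1 - b *\<^sub>R M) \<le> ?F \<epsilon>"
  proof (rule eventually_mono[OF eventually_at_right_less])
    fix \<epsilon> :: real assume "0 < \<epsilon>"
    then obtain R where "(M + \<epsilon> *\<^sub>R mat 1) ** R = mat 1" "pucci_nonpos \<Lambda> (R - (2 * b) *\<^sub>R mat 1)" using R by blast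
    then show "det (mat 1 - b *\<^sub>R M) \<le> ?F \<epsilon>" using pucci_det_bound_eps[OF \<Lambda> b \<open>0 < \<epsilon>\<close> lo hi] by blast
  qed
qed simp

text \<open>All eigenvalues of \<open>M\<close> lie between 0 and 1/b, hence those of I - b M
  between 0 and 1.\<close>

lemma det_contraction_bounds:
  fixes M :: "real^'n^'n"
  assumes M: "transpose M = M" and b: "b > 0"
    and lo: "\<And>x. 0 \<le> x \<bullet> (M *v x)" and hi: "\<And>x. x \<bullet> (M *v x) \<le> (1 / b) * (x \<bullet> x)"
  shows "0 \<le> det M" "det M \<le> (1 / b) ^ CARD('n)" "0 \<le> det (mat 1 - b *\<^sub>R M)"
proof -
  obtain e lam where e: "eigenbasis M e lam" using symmetric_eigenbasis_exists[OF M] .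
  have l: "0 \<le> lam i" "lam i \<le> 1 / b" for i
    using lo[of "e i"] hi[of "e i"] e by (simp_all add: eigenbasis_def)
  then show "0 \<le> det M" using eigenbasis_det[OF e] by (simp add: prod_nonneg)
  have "(\<Prod>i\<in>UNIV. lam i) \<le> (\<Prod>i\<in>(UNIV::'n set). 1 / b)" using l by (intro prod_mono) auto
  then show "det M \<le> (1 / b) ^ CARD('n)" using eigenbasis_det[OF e] by simp
  have "det (mat 1 - b *\<^sub>R M) = det ((- b) *\<^sub>R M + 1 *\<^sub>R mat 1)" by simp
  also have "\<dots> = (\<Prod>i\<in>UNIV. (- b) * lam i + 1)"
    by (rule eigenbasis_det[OF eigenbasis_affine[OF e]])
  also have "\<dots> \<ge> 0" using l(2) b by (intro prod_nonneg) (auto simp: field_simps)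
  finally show "0 \<le> det (mat 1 - b *\<^sub>R M)" .
qed

text \<open>Subtracting a large multiple of \<open>\<bar>x - x0\<bar>\<^sup>4\<close> makes a local test function global without changing its Hessian at \<open>x0\<close>.\<close>
lemma pucci_nonpos_local_quadratic:
  fixes u :: "real^'n \<Rightarrow> real"
  assumes cont: "continuous_on (cball 0 1) u" and sup: "visc_pucci_super \<Lambda> u (ball 0 1)"
    and x0: "x0 \<in> ball 0 1" and N: "transpose N = N" and r: "r > 0"
    and touch: "\<And>h. norm h < r \<Longrightarrow> x0 + h \<in> cball 0 1 \<Longrightarrow> u (x0 + h) \<ge> u x0 + p \<bullet> h + 1/2 * (h \<bullet> (N *v h))"
  shows "pucci_nonpos \<Lambda> N"
proof -
  let ?h = "\<lambda>x. x - x0"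
  define D where "D x = u x0 + p \<bullet> ?h x + 1/2 * (?h x \<bullet> (N *v ?h x)) - u x" for x
  have contN: "continuous_on A (\<lambda>x. N *v f x)" if "continuous_on A f" for A and f :: "real^'n \<Rightarrow> real^'n"
    using matrix_vector_mul_bounded_linear[of N] that by (rule bounded_linear.continuous_on)
  have "continuous_on (cball 0 1) D" unfolding D_def by (intro continuous_intros cont contN)
  then have "bounded (D ` cball 0 1)" by (intro compact_imp_bounded compact_continuous_image compact_cball)
  then obtain B where "\<forall>x\<in>cball 0 1. \<bar>D x\<bar> \<le> B" by (auto simp: bounded_iff)
  then have B: "\<And>x. x \<in> cball 0 1 \<Longrightarrow> \<bar>D x\<bar> \<le> B" by blast
  have B0: "B \<ge> 0" using B[of 0] by (simp add: order_trans[OF abs_ge_zero])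
  \<comment> \<open>At distance at least \<open>r\<close> from \<open>x0\<close> the quartic term is
    at least \<open>B\<close>, which bounds the excess of the quadratic over
    \<open>u\<close>.\<close>
  define K where "K = B / r ^ 4"
  have K0: "K \<ge> 0" using B0 r by (simp add: K_def)
  define \<phi> where "\<phi> x = u x0 + p \<bullet> ?h x + 1/2 * (?h x \<bullet> (N *v ?h x)) - K * (?h x \<bullet> ?h x)\<^sup>2" for x
  define g where "g x = p + N *v ?h x - (4 * K * (?h x \<bullet> ?h x)) *\<^sub>R ?h x" for x
  \<comment> \<open>The Hessian of K |h|^4 is 4 K |h|^2 I + 8 K h h^T, which vanishes at h =
    0.\<close>
  define H where "H x = N - (4 * K * (?h x \<bullet> ?h x)) *\<^sub>R mat 1 - (8 * K) *\<^sub>R (\<chi> i j. ?h x $ i * ?h x $ j)" for x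
  have le: "\<phi> x \<le> u x" if x: "x \<in> cball 0 1" for x
  proof (cases "norm (?h x) < r")
    case True
    have "K * (?h x \<bullet> ?h x)\<^sup>2 \<ge> 0" using K0 by simp
    then show ?thesis using touch[OF True] x unfolding \<phi>_def by simp
  next
    case False
    then have "r ^ 4 \<le> norm (?h x) ^ 4" using r by (intro power_mono) auto
    also have "norm (?h x) ^ 4 = (?h x \<bullet> ?h x)\<^sup>2" by (simp add: dot_square_norm)
    finally have "K * r ^ 4 \<le> K * (?h x \<bullet> ?h x)\<^sup>2" using K0 by (rule mult_left_mono)
    then have "B \<le> K * (?h x \<bullet> ?h x)\<^sup>2" using r by (simp add: K_def)
    then show ?thesis using B[OF x] unfolding \<phi>_def D_def by linarith
  qed
  have hI: "(?h has_derivative (\<lambda>h. h)) (at x)" for x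
    by (auto intro!: derivative_eq_intros)
  have hN: "((\<lambda>x. N *v ?h x) has_derivative (\<lambda>h. N *v h)) (at x)" for x
    by (rule bounded_linear.has_derivative[OF matrix_vector_mul_bounded_linear hI])
  have hQ: "((\<lambda>x. ?h x \<bullet> ?h x) has_derivative (\<lambda>h. 2 * (?h x \<bullet> h))) (at x)" for x
    by (rule has_derivative_eq_rhs[OF has_derivative_inner[OF hI hI]]) (simp add: fun_eq_iff inner_commute)
  have hQ2: "((\<lambda>x. K * (?h x \<bullet> ?h x)\<^sup>2) has_derivative (\<lambda>h. 4 * K * (?h x \<bullet> ?h x) * (?h x \<bullet> h))) (at x)" for x
    by (rule has_derivative_eq_rhs[OF has_derivative_mult_right[OF has_derivative_power[OF hQ]]]) (simp add: fun_eq_iff)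
  have hNN: "((\<lambda>x. 1/2 * (?h x \<bullet> (N *v ?h x))) has_derivative (\<lambda>h. (N *v ?h x) \<bullet> h)) (at x)" for x
  proof (rule has_derivative_eq_rhs[OF has_derivative_mult_right[OF has_derivative_inner[OF hI hN]]], rule ext)
    fix h
    have "?h x \<bullet> (N *v h) = (N *v ?h x) \<bullet> h" "h \<bullet> (N *v ?h x) = (N *v ?h x) \<bullet> h"
      by (rule symmetric_inner[OF N]) (rule inner_commute)
    then show "1/2 * (?h x \<bullet> (N *v h) + h \<bullet> (N *v ?h x)) = (N *v ?h x) \<bullet> h" by simp
  qed
  have hp: "((\<lambda>x. u x0 + p \<bullet> ?h x) has_derivative (\<lambda>h. p \<bullet> h)) (at x)" for x
    by (auto intro!: derivative_eq_intros)
  have d1: "(\<phi> has_derivative (\<lambda>h. g x \<bullet> h)) (at x)" for x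
    unfolding \<phi>_def g_def
    by (rule has_derivative_eq_rhs[OF has_derivative_diff[OF has_derivative_add[OF hp hNN] hQ2]])
      (simp add: fun_eq_iff inner_add_left inner_diff_left)
  have d2: "(g has_derivative (\<lambda>h. H x *v h)) (at x)" for x
  proof -
    have "(g has_derivative (\<lambda>h. N *v h - ((4 * K * (2 * (?h x \<bullet> h))) *\<^sub>R ?h x + (4 * K * (?h x \<bullet> ?h x)) *\<^sub>R h))) (at x)"
      unfolding g_def
      by (rule has_derivative_eq_rhs[OF has_derivative_diff[OF has_derivative_add[OF has_derivative_const hN]
            has_derivative_scaleR[OF has_derivative_mult_right[OF hQ] hI]]])
        (simp add: fun_eq_iff algebra_simps)
    moreover have "N *v h - ((4 * K * (2 * (?h x \<bullet> h))) *\<^sub>R ?h x + (4 * K * (?h x \<bullet> ?h x)) *\<^sub>R h) = H x *v h" for h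
    proof -
      obtain d where d: "x - x0 = d" by simp
      have "(\<chi> i j. d $ i * d $ j) *v h = (d \<bullet> h) *\<^sub>R d"
        by (simp add: matrix_vector_mult_def inner_vec_def vec_eq_iff sum_distrib_left mult.assoc mult.left_commute mult.commute)
      then have "H x *v h = N *v h - (4 * K * (d \<bullet> d)) *\<^sub>R h - (8 * K) *\<^sub>R ((d \<bullet> h) *\<^sub>R d)"
        unfolding H_def d
        by (simp add: matrix_vector_mult_diff_rdistrib mat1_mult_scaleR scaleR_matrix_vector_assoc[symmetric])
      then show ?thesis unfolding d by (simp add: algebra_simps)
    qed
    ultimately show ?thesis by simp
  qed
  have uc: "uniformly_continuous_on (ball 0 1) f" if "continuous_on UNIV f" for f :: "real^'n \<Rightarrow> 'c::metric_space"
  proof -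
    have "uniformly_continuous_on (cball 0 1) f"
      using that by (intro compact_uniformly_continuous continuous_on_subset[OF that]) auto
    then show ?thesis unfolding uniformly_continuous_on_def by (meson ball_subset_cball subsetD)
  qed
  have "C2_closure \<phi> g H (ball 0 1)"
    unfolding C2_closure_def
  proof (intro conjI ballI d1 d2 uc)
    show "continuous_on (closure (ball 0 1)) \<phi>" unfolding \<phi>_def by (intro continuous_intros contN)
    show "continuous_on UNIV g" unfolding g_def by (intro continuous_intros contN)
    show "continuous_on UNIV H" unfolding H_def by (intro continuous_intros continuous_on_vec_lambda)
  qed
  moreover have "tangent_below \<phi> u (ball 0 1) x0"
    using x0 le unfolding tangent_below_def by (simp add: \<phi>_def)
  ultimately have "pucci_minus \<Lambda> (H x0) \<le> 0" using sup unfolding visc_pucci_super_def by blast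
  moreover have "H x0 = N" by (simp add: H_def vec_eq_iff)
  ultimately show ?thesis using pucci_minus_imp_pucci_nonpos[OF N] by simp
qed

section \<open>Convex conjugates and envelopes\<close>

text \<open>It is also applied to functions that are not convex, where it asks for a global
  supporting affine function; for \<open>v\<close> plus a quadratic this is a paraboloid touching
  \<open>v\<close> from below.\<close>

definition is_subgrad :: "('a::real_inner \<Rightarrow> real) \<Rightarrow> 'a \<Rightarrow> 'a \<Rightarrow> bool" where
  "is_subgrad \<Gamma> x p \<longleftrightarrow> (\<forall>z. \<Gamma> z \<ge> \<Gamma> x + p \<bullet> (z - x))"

lemma is_subgradD: "is_subgrad \<Gamma> x p \<Longrightarrow> \<Gamma> x + p \<bullet> (z - x) \<le> \<Gamma> z"
  by (simp add: is_subgrad_def)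

lemma coercive_attains_min:
  fixes F :: "'a::euclidean_space \<Rightarrow> real"
  assumes cont: "continuous_on UNIV F" and c: "c > 0"
    and low: "\<And>x. F x \<ge> m + c * (norm x)\<^sup>2 - q * norm x"
  obtains x where "\<And>z. F x \<le> F z"
proof -
  define d where "d = \<bar>F 0 - m\<bar>"
  define R where "R = (\<bar>q\<bar> + d + 1) / c + 1"
  have R: "R \<ge> 1" using c by (simp add: R_def d_def)
  have out: "F x > F 0" if "norm x > R" for x
  proof -
    have "c * norm x > c * ((\<bar>q\<bar> + d + 1) / c)" using that c by (intro mult_strict_left_mono) (auto simp: R_def)
    then have 1: "c * norm x - q > d + 1" using c by auto
    have "norm x * (c * norm x - q) \<ge> 1 * (d + 1)" using 1 that R by (intro mult_mono) (auto simp: d_def)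
    then have "c * (norm x)\<^sup>2 - q * norm x \<ge> d + 1" by (simp add: power2_eq_square algebra_simps)
    then show ?thesis using low[of x] unfolding d_def by linarith
  qed
  have "\<exists>x\<in>cball 0 R. \<forall>y\<in>cball 0 R. F x \<le> F y"
    using R by (intro continuous_attains_inf continuous_on_subset[OF cont]) auto
  then obtain x where "\<forall>y\<in>cball 0 R. F x \<le> F y" by blast
  then have x: "\<And>y. norm y \<le> R \<Longrightarrow> F x \<le> F y" by simp
  have "F x \<le> F z" for z
  proof (cases "norm z \<le> R")
    case False
    then have "F z > F 0" using out by simp
    moreover have "F x \<le> F 0" using x R by simp
    ultimately show ?thesis by simp
  qed (use x in blast)
  then show thesis by (rule that)
qed

lemma convex_on_UNIV_continuous:
  fixes \<Gamma> :: "'a::euclidean_space \<Rightarrow> real"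
  assumes "convex_on UNIV \<Gamma>"
  shows "continuous_on A \<Gamma>"
  using convex_on_continuous[OF open_UNIV assms] continuous_on_subset by blast

text \<open>A hyperplane separating the strict epigraph from the point of the graph over
  \<open>x\<close> cannot be vertical, because the epigraph lies over every base point; dividing by
  \<open>- s\<close> yields the subgradient.\<close>

lemma subgrad_exists:
  fixes \<Gamma> :: "'a::euclidean_space \<Rightarrow> real"
  assumes conv: "convex_on UNIV \<Gamma>"
  obtains p where "is_subgrad \<Gamma> x p"
proof -
  let ?S = "{z :: 'a \<times> real. \<Gamma> (fst z) < snd z}"
  have cS: "convex ?S"
  proof (rule convexI)
    fix y z :: "'a \<times> real" and u w :: real
    assume yz: "y \<in> ?S" "z \<in> ?S" and uw: "0 \<le> u" "0 \<le> w" "u + w = 1"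
    have "\<Gamma> (u *\<^sub>R fst y + w *\<^sub>R fst z) \<le> u * \<Gamma> (fst y) + w * \<Gamma> (fst z)"
      using conv uw by (auto simp: convex_on_def)
    also have "\<dots> < u * snd y + w * snd z"
    proof (cases "u = 0")
      case False
      then have "u * \<Gamma> (fst y) < u * snd y" using yz uw by (intro mult_strict_left_mono) auto
      moreover have "w * \<Gamma> (fst z) \<le> w * snd z" using yz uw by (intro mult_left_mono) auto
      ultimately show ?thesis by simp
    qed (use yz uw in simp)
    finally show "u *\<^sub>R y + w *\<^sub>R z \<in> ?S" by simp
  qed
  have ne: "(x, \<Gamma> x + 1) \<in> ?S" by simp
  have dis: "?S \<inter> {(x, \<Gamma> x)} = {}" by auto
  obtain a \<beta> where a: "a \<noteq> 0" "\<And>z. z \<in> ?S \<Longrightarrow> a \<bullet> z \<le> \<beta>" "\<beta> \<le> a \<bullet> (x, \<Gamma> x)"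
  proof -
    have "?S \<noteq> {}" using ne by blast
    from separating_hyperplane_sets[OF cS convex_singleton this insert_not_empty dis]
    obtain a \<beta> where "a \<noteq> 0" "\<forall>z\<in>?S. a \<bullet> z \<le> \<beta>" "\<forall>z\<in>{(x, \<Gamma> x)}. \<beta> \<le> a \<bullet> z" by blast
    then show thesis by (intro that[of a \<beta>]) blast+
  qed
  obtain p s where ps: "a = (p, s)" by (cases a)
  have *: "p \<bullet> y + s * r \<le> p \<bullet> x + s * \<Gamma> x" if "r > \<Gamma> y" for y r
    using a(2)[of "(y, r)"] a(3) that by (simp add: ps)
  have s0: "s \<le> 0" using *[of x "\<Gamma> x + 1"] by (simp add: algebra_simps)
  have s: "s < 0"
  proof (rule ccontr)
    assume "\<not> s < 0"
    then have "s = 0" using s0 by simp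
    then have "p \<bullet> p \<le> 0" using *[of "x + p" "\<Gamma> (x + p) + 1"] by (simp add: inner_add_right)
    then have "p = 0" by (metis inner_ge_zero inner_eq_zero_iff order_antisym)
    then show False using a(1) ps \<open>s = 0\<close> by (simp add: zero_prod_def)
  qed
  have "is_subgrad \<Gamma> x ((1 / (- s)) *\<^sub>R p)"
    unfolding is_subgrad_def
  proof
    fix z
    have "p \<bullet> z + s * \<Gamma> z \<le> p \<bullet> x + s * \<Gamma> x"
    proof (rule tendsto_le[OF _ tendsto_const])
      show "((\<lambda>r. p \<bullet> z + s * r) \<longlongrightarrow> p \<bullet> z + s * \<Gamma> z) (at_right (\<Gamma> z))" by (intro tendsto_intros)
      show "\<forall>\<^sub>F r in at_right (\<Gamma> z). p \<bullet> z + s * r \<le> p \<bullet> x + s * \<Gamma> x"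
        by (rule eventually_mono[OF eventually_at_right_less *])
    qed simp
    then have "p \<bullet> (z - x) \<le> (- s) * (\<Gamma> z - \<Gamma> x)" by (simp add: inner_diff_right algebra_simps)
    then have "p \<bullet> (z - x) / (- s) \<le> \<Gamma> z - \<Gamma> x" using s by (subst pos_divide_le_eq) (auto simp: mult.commute)
    then show "\<Gamma> x + (1 / (- s)) *\<^sub>R p \<bullet> (z - x) \<le> \<Gamma> z" by simp
  qed
  then show thesis by (rule that)
qed

lemma subgrad_monotone:
  assumes "is_subgrad \<Gamma> x p" "is_subgrad \<Gamma> x' p'"
  shows "0 \<le> (p - p') \<bullet> (x - x')"
  using is_subgradD[OF assms(1), of x'] is_subgradD[OF assms(2), of x]
  by (simp add: inner_diff_left inner_diff_right)

text \<open>For convex \<open>\<Gamma>\<close>, the vector \<open>q - b *\<^sub>R x\<close> is a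
  subgradient of \<open>\<Gamma>\<close> at \<open>x\<close> exactly when \<open>q\<close> is one of
  \<Gamma> + b/2 |x|^2. This is the strong monotonicity of the latter subdifferential, in the form
  in which \<open>q\<close> occurs below.\<close>

lemma subgrad_shift_monotone:
  assumes "is_subgrad \<Gamma> x (q - b *\<^sub>R x)" "is_subgrad \<Gamma> x' (q' - b *\<^sub>R x')"
  shows "b * (norm (x - x'))\<^sup>2 \<le> (q - q') \<bullet> (x - x')"
proof -
  have "0 \<le> ((q - b *\<^sub>R x) - (q' - b *\<^sub>R x')) \<bullet> (x - x')" by (rule subgrad_monotone[OF assms])
  moreover have "(q - b *\<^sub>R x) - (q' - b *\<^sub>R x') = (q - q') - b *\<^sub>R (x - x')" by (simp add: algebra_simps)
  ultimately show ?thesis by (simp add: inner_diff_left power2_norm_eq_inner)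
qed

text \<open>\<open>x\<close> minimizes \<Gamma> + b/2 |x|^2 - q . x. Comparing it with points at
  parameter \<open>t\<close> on the segment to \<open>z\<close> and letting \<open>t\<close> tend to
  0 removes the quadratic error and leaves a subgradient inequality for \<open>\<Gamma>\<close>
  alone.\<close>

lemma envelope_subgrad_exists:
  fixes \<Gamma> :: "'a::euclidean_space \<Rightarrow> real"
  assumes conv: "convex_on UNIV \<Gamma>" and low: "\<And>x. \<Gamma> x \<ge> m" and b: "b > 0"
  obtains x where "is_subgrad \<Gamma> x (q - b *\<^sub>R x)"
proof -
  define F where "F x = \<Gamma> x + b / 2 * (x \<bullet> x) - q \<bullet> x" for x
  have "continuous_on UNIV F" unfolding F_def by (intro continuous_intros convex_on_UNIV_continuous conv)
  moreover have "F x \<ge> m + b / 2 * (norm x)\<^sup>2 - norm q * norm x" for x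
    using low[of x] norm_cauchy_schwarz[of q x] by (simp add: F_def power2_norm_eq_inner)
  ultimately obtain x where x: "\<And>z. F x \<le> F z" using coercive_attains_min[of F "b / 2" m "norm q"] b by auto
  have "is_subgrad \<Gamma> x (q - b *\<^sub>R x)"
    unfolding is_subgrad_def
  proof
    fix z
    let ?d = "z - x"
    have *: "(q - b *\<^sub>R x) \<bullet> ?d - (b / 2 * (?d \<bullet> ?d)) * t \<le> \<Gamma> z - \<Gamma> x" if t: "0 < t" "t < 1" for t
    proof -
      have "\<Gamma> (x + t *\<^sub>R ?d) = \<Gamma> ((1 - t) *\<^sub>R x + t *\<^sub>R z)" by (simp add: algebra_simps)
      also have "\<dots> \<le> (1 - t) * \<Gamma> x + t * \<Gamma> z" using conv t by (auto simp: convex_on_def)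
      finally have "\<Gamma> (x + t *\<^sub>R ?d) \<le> \<Gamma> x + t * (\<Gamma> z - \<Gamma> x)" by (simp add: algebra_simps)
      moreover have "\<Gamma> x + b / 2 * (x \<bullet> x) - q \<bullet> x \<le> \<Gamma> (x + t *\<^sub>R ?d) + b / 2 * ((x + t *\<^sub>R ?d) \<bullet> (x + t *\<^sub>R ?d)) - q \<bullet> (x + t *\<^sub>R ?d)"
        using x[of "x + t *\<^sub>R ?d"] by (simp add: F_def)
      moreover have "b / 2 * ((x + t *\<^sub>R ?d) \<bullet> (x + t *\<^sub>R ?d)) = b / 2 * (x \<bullet> x) + t * (b * (x \<bullet> ?d)) + t * (b / 2 * (?d \<bullet> ?d) * t)"
        by (simp only: inner_add_left inner_add_right inner_scaleR_left inner_scaleR_right inner_commute[of ?d x])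
           (simp add: field_simps)
      moreover have "q \<bullet> (x + t *\<^sub>R ?d) = q \<bullet> x + t * (q \<bullet> ?d)"
        by (simp only: inner_add_right inner_scaleR_right)
      ultimately have "t * (q \<bullet> ?d) - t * (b * (x \<bullet> ?d)) - t * (b / 2 * (?d \<bullet> ?d) * t) \<le> t * (\<Gamma> z - \<Gamma> x)" by linarith
      then have "t * (q \<bullet> ?d - b * (x \<bullet> ?d) - b / 2 * (?d \<bullet> ?d) * t) \<le> t * (\<Gamma> z - \<Gamma> x)"
        by (simp only: right_diff_distrib)
      then have "q \<bullet> ?d - b * (x \<bullet> ?d) - b / 2 * (?d \<bullet> ?d) * t \<le> \<Gamma> z - \<Gamma> x"
        using t(1) by (simp only: mult_le_cancel_left_pos)
      moreover have "(q - b *\<^sub>R x) \<bullet> ?d = q \<bullet> ?d - b * (x \<bullet> ?d)" by (simp only: inner_diff_left inner_scaleR_left)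
      ultimately show ?thesis by linarith
    qed
    have "(q - b *\<^sub>R x) \<bullet> ?d \<le> \<Gamma> z - \<Gamma> x"
    proof (rule tendsto_le[OF _ tendsto_const])
      have "((\<lambda>t. (q - b *\<^sub>R x) \<bullet> ?d - (b / 2 * (?d \<bullet> ?d)) * t) \<longlongrightarrow> (q - b *\<^sub>R x) \<bullet> ?d - (b / 2 * (?d \<bullet> ?d)) * 0) (at_right 0)"
        by (intro tendsto_intros)
      then show "((\<lambda>t. (q - b *\<^sub>R x) \<bullet> ?d - (b / 2 * (?d \<bullet> ?d)) * t) \<longlongrightarrow> (q - b *\<^sub>R x) \<bullet> ?d) (at_right 0)" by simp
      show "\<forall>\<^sub>F t in at_right 0. (q - b *\<^sub>R x) \<bullet> ?d - (b / 2 * (?d \<bullet> ?d)) * t \<le> \<Gamma> z - \<Gamma> x"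
        using * by (auto simp: eventually_at_right_field intro!: exI[of _ 1])
    qed simp
    then show "\<Gamma> x + (q - b *\<^sub>R x) \<bullet> ?d \<le> \<Gamma> z" by simp
  qed
  then show thesis by (rule that)
qed

text \<open>The gradient at \<open>q\<close> of the convex conjugate of \<open>\<Gamma> + b/2 \<bar>x\<bar>\<^sup>2\<close>, and that conjugate itself.\<close>
definition grad_conj :: "('a::euclidean_space \<Rightarrow> real) \<Rightarrow> real \<Rightarrow> 'a \<Rightarrow> 'a" where
  "grad_conj \<Gamma> b q = (SOME x. is_subgrad \<Gamma> x (q - b *\<^sub>R x))"

definition shifted_conj :: "('a::euclidean_space \<Rightarrow> real) \<Rightarrow> real \<Rightarrow> 'a \<Rightarrow> real" where
  "shifted_conj \<Gamma> b q = q \<bullet> grad_conj \<Gamma> b q - \<Gamma> (grad_conj \<Gamma> b q) - b / 2 * (norm (grad_conj \<Gamma> b q))\<^sup>2"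

section \<open>The conjugate of a convex function plus a quadratic\<close>

locale bounded_below_convex =
  fixes \<Gamma> :: "'a::euclidean_space \<Rightarrow> real" and b :: real
  assumes conv: "convex_on UNIV \<Gamma>" and low: "\<exists>m. \<forall>x. \<Gamma> x \<ge> m" and b: "b > 0"
begin

abbreviation "G \<equiv> grad_conj \<Gamma> b"
abbreviation "f \<equiv> shifted_conj \<Gamma> b"

lemma G_subgrad: "is_subgrad \<Gamma> (G q) (q - b *\<^sub>R G q)"
proof -
  obtain m where m: "\<And>x. \<Gamma> x \<ge> m" using low by blast
  obtain x where "is_subgrad \<Gamma> x (q - b *\<^sub>R x)" by (rule envelope_subgrad_exists[OF conv m b])
  then show ?thesis unfolding grad_conj_def by (rule someI)
qed

text \<open>Strong monotonicity makes the base point unique, so the choice in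
  \<open>grad_conj\<close> is forced: \<open>G\<close> is the single-valued inverse of the
  subdifferential of \<Gamma> + b/2 |x|^2, even where that subdifferential is multivalued.\<close>

lemma G_eqI:
  assumes "is_subgrad \<Gamma> x p"
  shows "G (p + b *\<^sub>R x) = x"
proof -
  have "is_subgrad \<Gamma> x ((p + b *\<^sub>R x) - b *\<^sub>R x)" using assms by simp
  from subgrad_shift_monotone[OF G_subgrad this, of "p + b *\<^sub>R x"]
  have "b * (norm (G (p + b *\<^sub>R x) - x))\<^sup>2 \<le> 0" by simp
  then show ?thesis using b by (simp add: mult_le_0_iff)
qed

lemma G_monotone: "b * (norm (G q - G q'))\<^sup>2 \<le> (q - q') \<bullet> (G q - G q')"
  by (rule subgrad_shift_monotone[OF G_subgrad G_subgrad])

lemma G_lipschitz: "norm (G q - G q') \<le> (1 / b) * norm (q - q')"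
proof (cases "G q = G q'")
  case False
  have "b * (norm (G q - G q') * norm (G q - G q')) \<le> norm (q - q') * norm (G q - G q')"
    using G_monotone[of q q'] norm_cauchy_schwarz[of "q - q'" "G q - G q'"] by (simp add: power2_eq_square)
  then have "(b * norm (G q - G q')) * norm (G q - G q') \<le> norm (q - q') * norm (G q - G q')" by (simp add: mult.assoc)
  then have "b * norm (G q - G q') \<le> norm (q - q')" by (rule mult_right_le_imp_le) (use False in simp)
  then show ?thesis using b by (simp add: field_simps)
qed (use b in simp)

text \<open>The Fenchel-Young inequality: completing the square shows that the slack is at least b/2
  |z - G q|^2.\<close>

lemma shifted_conj_ge: "q \<bullet> z - \<Gamma> z - b / 2 * (norm z)\<^sup>2 \<le> f q"
proof -
  let ?x = "G q"
  have "\<Gamma> ?x + (q - b *\<^sub>R ?x) \<bullet> (z - ?x) \<le> \<Gamma> z" by (rule is_subgradD[OF G_subgrad])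
  moreover have "0 \<le> b / 2 * (norm (z - ?x))\<^sup>2" using b by simp
  moreover have "b / 2 * (norm (z - ?x))\<^sup>2 = b / 2 * (norm z)\<^sup>2 - b * (?x \<bullet> z) + b / 2 * (norm ?x)\<^sup>2"
    by (simp add: power2_norm_eq_inner inner_diff_left inner_diff_right inner_commute[of z "G q"] algebra_simps)
  moreover have "(q - b *\<^sub>R ?x) \<bullet> (z - ?x) = q \<bullet> z - q \<bullet> ?x - b * (?x \<bullet> z) + b * (norm ?x)\<^sup>2"
    by (simp add: power2_norm_eq_inner inner_diff_left inner_diff_right algebra_simps)
  ultimately show ?thesis
    unfolding shifted_conj_def by linarith
qed

lemma shifted_conj_subgrad: "f q + G q \<bullet> (q' - q) \<le> f q'"
proof -
  have "G q \<bullet> (q' - q) = q' \<bullet> G q - q \<bullet> G q" by (simp add: inner_diff_left inner_diff_right inner_commute)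
  then show ?thesis using shifted_conj_ge[of q' "G q"] unfolding shifted_conj_def[of \<Gamma> b q] by linarith
qed

text \<open>The supporting affine functions at \<open>q\<close> and at \<open>q'\<close> squeeze the
  error between 0 and (G q' - G q) . (q' - q), which is quadratic because \<open>G\<close> is
  Lipschitz.\<close>

lemma has_derivative_shifted_conj: "(f has_derivative (\<lambda>h. G q \<bullet> h)) (at q)"
  unfolding has_derivative_at_alt
proof (intro conjI allI impI)
  show "bounded_linear (\<lambda>h. G q \<bullet> h)" by (rule bounded_linear_inner_right)
  fix e :: real assume e: "e > 0"
  have "norm (f q' - f q - G q \<bullet> (q' - q)) \<le> e * norm (q' - q)" if q': "norm (q' - q) < e * b" for q'
  proof -
    have "f q' - f q - G q \<bullet> (q' - q) \<le> (G q' - G q) \<bullet> (q' - q)"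
      using shifted_conj_subgrad[of q' q] by (simp add: inner_diff_left inner_diff_right)
    also have "\<dots> \<le> norm (G q' - G q) * norm (q' - q)" by (rule norm_cauchy_schwarz)
    also have "\<dots> \<le> (1 / b * norm (q' - q)) * norm (q' - q)" by (intro mult_right_mono G_lipschitz) simp
    also have "\<dots> \<le> e * norm (q' - q)" using q' b by (intro mult_right_mono) (auto simp: field_simps)
    finally show ?thesis using shifted_conj_subgrad[of q q'] by simp
  qed
  then show "\<exists>d>0. \<forall>q'. norm (q' - q) < d \<longrightarrow> norm (f q' - f q - G q \<bullet> (q' - q)) \<le> e * norm (q' - q)"
    using e b by (intro exI[of _ "e * b"]) auto
qed

lemma shifted_conj_line: "((\<lambda>t. f (y + t *\<^sub>R k)) has_real_derivative G (y + t *\<^sub>R k) \<bullet> k) (at t)"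
proof -
  have "((\<lambda>t. y + t *\<^sub>R k) has_derivative (\<lambda>h. h *\<^sub>R k)) (at t)" by (auto intro!: derivative_eq_intros)
  from has_derivative_compose[OF this has_derivative_shifted_conj]
  have "((\<lambda>t. f (y + t *\<^sub>R k)) has_derivative (\<lambda>h. G (y + t *\<^sub>R k) \<bullet> (h *\<^sub>R k))) (at t)" .
  then show ?thesis by (rule has_derivative_imp_has_field_derivative) (simp add: mult.commute)
qed

section \<open>Second-order behaviour where the gradient of the conjugate is differentiable\<close>

context
  fixes y :: 'a and D :: "'a \<Rightarrow> 'a"
  assumes D: "(G has_derivative D) (at y)"
begin

lemma bounded_linear_D: "bounded_linear D"
  using D by (rule has_derivative_bounded_linear)

text \<open>The mean value theorem along the segment from \<open>y\<close> to \<open>y + k\<close>,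
  applied to \<open>f\<close> minus its quadratic model; it evaluates \<open>G\<close> near
  \<open>y\<close> but differentiates it at \<open>y\<close> alone.\<close>

lemma second_order_expansion:
  assumes e: "e > 0"
  obtains d where "d > 0"
    "\<And>k. norm k < d \<Longrightarrow> norm (G (y + k) - G y - D k) \<le> e * norm k"
    "\<And>k. norm k < d \<Longrightarrow> \<bar>f (y + k) - f y - G y \<bullet> k - 1/2 * (k \<bullet> D k)\<bar> \<le> e * (norm k)\<^sup>2"
proof -
  interpret D: bounded_linear D by (rule bounded_linear_D)
  obtain d where d: "d > 0" "\<And>z. norm (z - y) < d \<Longrightarrow> norm (G z - G y - D (z - y)) \<le> e * norm (z - y)"
    using D e unfolding has_derivative_at_alt by blast
  have 1: "norm (G (y + k) - G y - D k) \<le> e * norm k" if "norm k < d" for k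
    using d(2)[of "y + k"] that by simp
  have 2: "\<bar>f (y + k) - f y - G y \<bullet> k - 1/2 * (k \<bullet> D k)\<bar> \<le> e * (norm k)\<^sup>2" if k: "norm k < d" for k
  proof -
    define \<phi> where "\<phi> t = f (y + t *\<^sub>R k) - t * (G y \<bullet> k) - t\<^sup>2 / 2 * (k \<bullet> D k)" for t
    define \<phi>' where "\<phi>' t = G (y + t *\<^sub>R k) \<bullet> k - G y \<bullet> k - t * (k \<bullet> D k)" for t
    have der: "(\<phi> has_real_derivative \<phi>' t) (at t)" for t
      unfolding \<phi>_def \<phi>'_def by (auto intro!: derivative_eq_intros shifted_conj_line)
    obtain t where t: "0 < t" "t < 1" "\<phi> 1 - \<phi> 0 = (1 - 0) * \<phi>' t"
      using MVT2[of 0 1 \<phi> \<phi>'] der by auto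
    have "\<phi>' t = (G (y + t *\<^sub>R k) - G y - D (t *\<^sub>R k)) \<bullet> k"
      by (simp add: \<phi>'_def inner_diff_left D.scaleR inner_commute[of k "D k"])
    then have "\<bar>\<phi>' t\<bar> \<le> norm (G (y + t *\<^sub>R k) - G y - D (t *\<^sub>R k)) * norm k"
      using Cauchy_Schwarz_ineq2 by metis
    also have "\<dots> \<le> (e * norm (t *\<^sub>R k)) * norm k"
    proof (intro mult_right_mono 1)
      have "norm (t *\<^sub>R k) \<le> norm k" using t by (simp add: mult_left_le_one_le)
      then show "norm (t *\<^sub>R k) < d" using k by simp
    qed simp
    also have "\<dots> \<le> (e * norm k) * norm k"
      using t e by (intro mult_right_mono mult_left_mono) (auto simp: mult_left_le_one_le)
    finally show ?thesis using t(3) by (simp add: \<phi>_def power2_eq_square)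
  qed
  show thesis using that[OF d(1) 1 2] .
qed

text \<open>\<open>G\<close> is known to be differentiable only at \<open>y\<close>, so the second
  difference \<open>S\<close> of \<open>f\<close> over a small parallelogram is evaluated in two
  ways: the expansion at the corners gives an expression symmetric in \<open>k\<close> and
  \<open>l\<close>, and the mean value theorem in direction \<open>l\<close> gives
  \<open>l \<bullet> D k\<close>.\<close>

lemma D_symmetric: "k \<bullet> D l = l \<bullet> D k"
proof -
  interpret D: bounded_linear D by (rule bounded_linear_D)
  define C where "C = (norm (k + l))\<^sup>2 + (norm k)\<^sup>2 + (norm l)\<^sup>2 + norm l * (norm k + 2 * norm l)"
  have C0: "C \<ge> 0" by (simp add: C_def)
  have bd: "\<bar>1/2 * (k \<bullet> D l + l \<bullet> D k) - l \<bullet> D k\<bar> \<le> e * C" if e: "e > 0" for e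
  proof -
    obtain d where d: "d > 0"
      and d1: "\<And>k. norm k < d \<Longrightarrow> norm (G (y + k) - G y - D k) \<le> e * norm k"
      and d2: "\<And>k. norm k < d \<Longrightarrow> \<bar>f (y + k) - f y - G y \<bullet> k - 1/2 * (k \<bullet> D k)\<bar> \<le> e * (norm k)\<^sup>2"
      using second_order_expansion[OF e] by blast
    \<comment> \<open>Keeps every point of the parallelogram inside the expansion radius; the common
      factor s^2 is divided out at the end.\<close>
    define s where "s = d / (2 * (norm k + norm l + 1))"
    have kl: "norm k + norm l + 1 > 0" by (simp add: add_nonneg_pos)
    have s: "s > 0" using d kl by (simp add: s_def)
    have sd: "s * (norm k + norm l) < d"
    proof -
      have "s * (norm k + norm l) \<le> s * (norm k + norm l + 1)" using s by (intro mult_left_mono) auto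
      also have "\<dots> = d / 2" using kl unfolding s_def by (simp only: times_divide_eq_left) (simp add: field_simps)
      finally show ?thesis using d by simp
    qed
    have small: "norm (s *\<^sub>R (c *\<^sub>R k + t *\<^sub>R l)) < d" if "0 \<le> c" "c \<le> 1" "0 \<le> t" "t \<le> 1" for c t
    proof -
      have "norm (c *\<^sub>R k + t *\<^sub>R l) \<le> c * norm k + t * norm l"
        using norm_triangle_ineq[of "c *\<^sub>R k" "t *\<^sub>R l"] that by simp
      also have "\<dots> \<le> norm k + norm l" using that by (intro add_mono mult_left_le_one_le) auto
      finally have "s * norm (c *\<^sub>R k + t *\<^sub>R l) \<le> s * (norm k + norm l)" using s by (intro mult_left_mono) auto
      moreover have "norm (s *\<^sub>R (c *\<^sub>R k + t *\<^sub>R l)) = s * norm (c *\<^sub>R k + t *\<^sub>R l)" using s by simp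
      ultimately show ?thesis using sd by linarith
    qed
    define S where "S = f (y + s *\<^sub>R (k + l)) - f (y + s *\<^sub>R k) - f (y + s *\<^sub>R l) + f y"
    have n: "norm (s *\<^sub>R (k + l)) < d" "norm (s *\<^sub>R k) < d" "norm (s *\<^sub>R l) < d"
      using small[of 1 1] small[of 1 0] small[of 0 1] by auto
    have sq: "s *\<^sub>R h \<bullet> D (s *\<^sub>R h) = s\<^sup>2 * (h \<bullet> D h)" "(norm (s *\<^sub>R h))\<^sup>2 = s\<^sup>2 * (norm h)\<^sup>2" for h
      by (simp_all add: D.scaleR power2_eq_square power_mult_distrib)
    have e1: "\<bar>S - s\<^sup>2 * (1/2 * (k \<bullet> D l + l \<bullet> D k))\<bar> \<le> e * (s\<^sup>2 * (norm (k + l))\<^sup>2) + e * (s\<^sup>2 * (norm k)\<^sup>2) + e * (s\<^sup>2 * (norm l)\<^sup>2)"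
    proof -
      have a: "s\<^sup>2 * ((k + l) \<bullet> D (k + l)) = s\<^sup>2 * (k \<bullet> D k) + s\<^sup>2 * (l \<bullet> D l) + s\<^sup>2 * (k \<bullet> D l + l \<bullet> D k)"
        by (simp add: D.add inner_add_left inner_add_right algebra_simps)
      have a': "s\<^sup>2 * (1/2 * (k \<bullet> D l + l \<bullet> D k)) = 1/2 * (s\<^sup>2 * (k \<bullet> D l + l \<bullet> D k))" by simp
      have g: "G y \<bullet> (s *\<^sub>R (k + l)) = G y \<bullet> (s *\<^sub>R k) + G y \<bullet> (s *\<^sub>R l)" by (simp add: inner_add_right algebra_simps)
      have lin: "\<bar>F1 - F2 - F3 + F0 - 1/2 * T\<bar> \<le> E1 + E2 + E3"
        if "\<bar>F1 - F0 - (a1 + a2) - 1/2 * (P + Q + T)\<bar> \<le> E1" "\<bar>F2 - F0 - a1 - 1/2 * P\<bar> \<le> E2" "\<bar>F3 - F0 - a2 - 1/2 * Q\<bar> \<le> E3"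
        for F0 F1 F2 F3 a1 a2 P Q T E1 E2 E3 :: real
        using that unfolding abs_le_iff by (elim conjE, intro conjI) (simp_all add: field_simps)
      show ?thesis
        unfolding S_def a' by (rule lin[OF d2[OF n(1), unfolded sq a g] d2[OF n(2), unfolded sq] d2[OF n(3), unfolded sq]])
    qed
    define \<psi> where "\<psi> t = f ((y + s *\<^sub>R k) + t *\<^sub>R (s *\<^sub>R l)) - f (y + t *\<^sub>R (s *\<^sub>R l))" for t
    define \<psi>' where "\<psi>' t = G ((y + s *\<^sub>R k) + t *\<^sub>R (s *\<^sub>R l)) \<bullet> (s *\<^sub>R l) - G (y + t *\<^sub>R (s *\<^sub>R l)) \<bullet> (s *\<^sub>R l)" for t
    have "(\<psi> has_real_derivative \<psi>' t) (at t)" for t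
      unfolding \<psi>_def \<psi>'_def by (intro DERIV_diff shifted_conj_line)
    then obtain t where t: "0 < t" "t < 1" "\<psi> 1 - \<psi> 0 = (1 - 0) * \<psi>' t"
      using MVT2[of 0 1 \<psi> \<psi>'] by auto
    have S\<psi>: "S = \<psi>' t" using t(3) by (simp add: S_def \<psi>_def algebra_simps)
    let ?u = "s *\<^sub>R (1 *\<^sub>R k + t *\<^sub>R l)" and ?w = "s *\<^sub>R (0 *\<^sub>R k + t *\<^sub>R l)"
    have u: "norm ?u < d" "norm ?w < d" using small[of 1 t] small[of 0 t] t by auto
    have nu: "norm ?u \<le> s * (norm k + norm l)"
    proof -
      have "norm (1 *\<^sub>R k + t *\<^sub>R l) \<le> norm k + t * norm l" using norm_triangle_ineq[of k "t *\<^sub>R l"] t by simp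
      also have "\<dots> \<le> norm k + norm l" using t by (intro add_mono mult_left_le_one_le) auto
      finally show ?thesis using s by simp
    qed
    have nw: "norm ?w \<le> s * norm l" using s t by (simp add: mult_left_le_one_le)
    have yu: "(y + s *\<^sub>R k) + t *\<^sub>R (s *\<^sub>R l) = y + ?u" "y + t *\<^sub>R (s *\<^sub>R l) = y + ?w"
      by (simp_all add: algebra_simps)
    have Duw: "D ?u - D ?w = s *\<^sub>R D k" by (simp add: D.scaleR D.add algebra_simps)
    have "S - s\<^sup>2 * (l \<bullet> D k) = ((G (y + ?u) - G y - D ?u) - (G (y + ?w) - G y - D ?w)) \<bullet> (s *\<^sub>R l)"
    proof -
      have "((G (y + ?u) - G y - D ?u) - (G (y + ?w) - G y - D ?w)) = (G (y + ?u) - G (y + ?w)) - s *\<^sub>R D k"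
        using Duw by (simp add: algebra_simps)
      then show ?thesis unfolding S\<psi> \<psi>'_def yu
        by (simp only: inner_diff_left) (simp add: power2_eq_square inner_commute)
    qed
    then have "\<bar>S - s\<^sup>2 * (l \<bullet> D k)\<bar> \<le> norm ((G (y + ?u) - G y - D ?u) - (G (y + ?w) - G y - D ?w)) * norm (s *\<^sub>R l)"
      using Cauchy_Schwarz_ineq2 by metis
    also have "\<dots> \<le> (e * (s * (norm k + norm l)) + e * (s * norm l)) * norm (s *\<^sub>R l)"
    proof (rule mult_right_mono)
      have "norm ((G (y + ?u) - G y - D ?u) - (G (y + ?w) - G y - D ?w)) \<le> e * norm ?u + e * norm ?w"
        by (rule order_trans[OF norm_triangle_ineq4 add_mono[OF d1[OF u(1)] d1[OF u(2)]]])
      also have "\<dots> \<le> e * (s * (norm k + norm l)) + e * (s * norm l)"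
        using nu nw e by (intro add_mono mult_left_mono) auto
      finally show "norm ((G (y + ?u) - G y - D ?u) - (G (y + ?w) - G y - D ?w)) \<le> e * (s * (norm k + norm l)) + e * (s * norm l)" .
    qed simp
    also have "\<dots> = e * (s\<^sup>2 * (norm l * (norm k + 2 * norm l)))" using s by (simp add: power2_eq_square algebra_simps)
    finally have e2: "\<bar>S - s\<^sup>2 * (l \<bullet> D k)\<bar> \<le> e * (s\<^sup>2 * (norm l * (norm k + 2 * norm l)))" .
    have eC: "s\<^sup>2 * (e * C) = e * (s\<^sup>2 * (norm (k + l))\<^sup>2) + e * (s\<^sup>2 * (norm k)\<^sup>2) + e * (s\<^sup>2 * (norm l)\<^sup>2)
        + e * (s\<^sup>2 * (norm l * (norm k + 2 * norm l)))"
      by (simp add: C_def algebra_simps)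
    have lin: "\<bar>A - B\<bar> \<le> E + E'" if "\<bar>X - A\<bar> \<le> E" "\<bar>X - B\<bar> \<le> E'" for A B X E E' :: real
      using that by linarith
    have "\<bar>s\<^sup>2 * (1/2 * (k \<bullet> D l + l \<bullet> D k)) - s\<^sup>2 * (l \<bullet> D k)\<bar> \<le> s\<^sup>2 * (e * C)"
      unfolding eC by (rule lin[OF e1 e2])
    then have "\<bar>s\<^sup>2 * (1/2 * (k \<bullet> D l + l \<bullet> D k) - l \<bullet> D k)\<bar> \<le> s\<^sup>2 * (e * C)"
      by (simp only: right_diff_distrib)
    then have "s\<^sup>2 * \<bar>1/2 * (k \<bullet> D l + l \<bullet> D k) - l \<bullet> D k\<bar> \<le> s\<^sup>2 * (e * C)"
      by (simp only: abs_mult abs_power2)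
    then show ?thesis by (rule mult_left_le_imp_le) (use s in simp)
  qed
  have "\<bar>1/2 * (k \<bullet> D l + l \<bullet> D k) - l \<bullet> D k\<bar> \<le> 0"
  proof (rule field_le_epsilon)
    fix e :: real assume "e > 0"
    then have "e / (C + 1) > 0" using C0 by simp
    from bd[OF this] have "\<bar>1/2 * (k \<bullet> D l + l \<bullet> D k) - l \<bullet> D k\<bar> \<le> e / (C + 1) * C" .
    also have "\<dots> \<le> e" using C0 \<open>e > 0\<close> by (simp add: field_simps)
    finally show "\<bar>1/2 * (k \<bullet> D l + l \<bullet> D k) - l \<bullet> D k\<bar> \<le> 0 + e" by simp
  qed
  then show ?thesis by simp
qed

lemma D_line_tendsto: "((\<lambda>s. (1 / s) *\<^sub>R (G (y + s *\<^sub>R k) - G y)) \<longlongrightarrow> D k) (at_right 0)"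
proof (rule tendstoI)
  interpret D: bounded_linear D by (rule bounded_linear_D)
  fix e :: real assume e: "e > 0"
  define e' where "e' = e / (norm k + 1)"
  have k1: "norm k + 1 > 0" by (simp add: add_nonneg_pos)
  then have e': "e' > 0" using e by (simp add: e'_def)
  obtain d where d: "d > 0" and d1: "\<And>k. norm k < d \<Longrightarrow> norm (G (y + k) - G y - D k) \<le> e' * norm k"
    by (rule second_order_expansion[OF e']) (rule that, assumption+)
  have "dist ((1 / s) *\<^sub>R (G (y + s *\<^sub>R k) - G y)) (D k) < e" if s: "0 < s" "s < d / (norm k + 1)" for s
  proof -
    have "s * (norm k + 1) < d" using s k1 by (simp add: pos_less_divide_eq)
    then have "norm (s *\<^sub>R k) < d" using s by (simp add: algebra_simps)
    from d1[OF this] have "norm (G (y + s *\<^sub>R k) - G y - s *\<^sub>R D k) \<le> s * (e' * norm k)"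
      using s by (simp add: D.scaleR algebra_simps)
    then have "(1 / s) * norm (G (y + s *\<^sub>R k) - G y - s *\<^sub>R D k) \<le> (1 / s) * (s * (e' * norm k))"
      using s by (intro mult_left_mono) auto
    also have "\<dots> = e' * norm k" using s by simp
    also have "\<dots> < e" using e k1 by (simp add: e'_def field_simps)
    also have "(1 / s) * norm (G (y + s *\<^sub>R k) - G y - s *\<^sub>R D k) = norm ((1 / s) *\<^sub>R (G (y + s *\<^sub>R k) - G y - s *\<^sub>R D k))"
      using s by simp
    also have "(1 / s) *\<^sub>R (G (y + s *\<^sub>R k) - G y - s *\<^sub>R D k) = (1 / s) *\<^sub>R (G (y + s *\<^sub>R k) - G y) - D k"
      using s by (simp add: scaleR_diff_right)
    finally show ?thesis by (simp add: dist_norm)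
  qed
  then show "\<forall>\<^sub>F s in at_right 0. dist ((1 / s) *\<^sub>R (G (y + s *\<^sub>R k) - G y)) (D k) < e"
    using d k1 by (auto simp: eventually_at_right_field intro!: exI[of _ "d / (norm k + 1)"])
qed

text \<open>The limit of \<open>G_monotone\<close> along rays. It is stronger than positivity of
  \<open>D\<close>: it also yields the upper bound 1/b, and \<open>k \<bullet> D k = 0\<close>
  forces \<open>D k = 0\<close>.\<close>

lemma D_bounds: "b * (norm (D k))\<^sup>2 \<le> k \<bullet> D k"
proof (rule tendsto_le)
  let ?d = "\<lambda>s. (1 / s) *\<^sub>R (G (y + s *\<^sub>R k) - G y)"
  show "((\<lambda>s. b * (norm (?d s))\<^sup>2) \<longlongrightarrow> b * (norm (D k))\<^sup>2) (at_right 0)" by (intro tendsto_intros D_line_tendsto)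
  show "((\<lambda>s. k \<bullet> ?d s) \<longlongrightarrow> k \<bullet> D k) (at_right 0)" by (intro tendsto_intros D_line_tendsto)
  show "\<forall>\<^sub>F s in at_right 0. b * (norm (?d s))\<^sup>2 \<le> k \<bullet> ?d s"
  proof (rule eventually_mono[OF eventually_at_right_less])
    fix s :: real assume s: "0 < s"
    have "b * (norm (G (y + s *\<^sub>R k) - G y))\<^sup>2 \<le> s * (k \<bullet> (G (y + s *\<^sub>R k) - G y))"
      using G_monotone[of "y + s *\<^sub>R k" y] by simp
    then have "(1 / s\<^sup>2) * (b * (norm (G (y + s *\<^sub>R k) - G y))\<^sup>2) \<le> (1 / s\<^sup>2) * (s * (k \<bullet> (G (y + s *\<^sub>R k) - G y)))"
      by (rule mult_left_mono) simp
    then show "b * (norm (?d s))\<^sup>2 \<le> k \<bullet> ?d s" using s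
      by (simp add: power_mult_distrib power_divide power2_eq_square)
  qed
qed simp

lemma D_nonneg: "0 \<le> k \<bullet> D k"
  using D_bounds[of k] b by (meson mult_nonneg_nonneg less_imp_le order_trans zero_le_power2)

lemma D_le: "k \<bullet> D k \<le> (1 / b) * (k \<bullet> k)"
proof -
  have "b * norm (D k) \<le> norm k"
  proof (cases "D k = 0")
    case False
    have "(b * norm (D k)) * norm (D k) \<le> norm k * norm (D k)"
      using D_bounds[of k] norm_cauchy_schwarz[of k "D k"] by (simp add: power2_eq_square)
    then show ?thesis by (rule mult_right_le_imp_le) (use False in simp)
  qed simp
  then have "norm k * norm (D k) \<le> norm k * (norm k / b)" using b by (intro mult_left_mono) (auto simp: field_simps)
  moreover have "k \<bullet> D k \<le> norm k * norm (D k)" by (rule norm_cauchy_schwarz)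
  ultimately show ?thesis by (simp add: power2_norm_eq_inner[symmetric] power2_eq_square)
qed

text \<open>On the segment between \<open>y\<close> and \<open>y'\<close>, monotonicity against the
  two endpoints, where \<open>G\<close> takes the same value, gives opposite inequalities for the
  increment of \<open>G\<close> in direction \<open>y' - y\<close>; so it vanishes.\<close>

lemma G_eq_imp_D_kernel:
  assumes "G y' = G y"
  shows "(y' - y) \<bullet> D (y' - y) = 0"
proof -
  let ?k = "y' - y"
  have const: "?k \<bullet> (G (y + s *\<^sub>R ?k) - G y) = 0" if s: "0 < s" "s < 1" for s
  proof -
    let ?z = "y + s *\<^sub>R ?k"
    have nn: "0 \<le> (q - q') \<bullet> (G q - G q')" for q q'
      using G_monotone[of q q'] b by (meson mult_nonneg_nonneg less_imp_le order_trans zero_le_power2)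
    have "0 \<le> s * (?k \<bullet> (G ?z - G y))" using nn[of ?z y] by simp
    moreover have "?z - y' = (s - 1) *\<^sub>R ?k" by (simp add: algebra_simps)
    then have "0 \<le> (s - 1) * (?k \<bullet> (G ?z - G y))" using nn[of ?z y'] assms by simp
    ultimately show ?thesis using s by (simp add: zero_le_mult_iff)
  qed
  have "((\<lambda>s. ?k \<bullet> ((1 / s) *\<^sub>R (G (y + s *\<^sub>R ?k) - G y))) \<longlongrightarrow> ?k \<bullet> D ?k) (at_right 0)"
    by (intro tendsto_intros D_line_tendsto)
  moreover have "\<forall>\<^sub>F s in at_right 0. ?k \<bullet> ((1 / s) *\<^sub>R (G (y + s *\<^sub>R ?k) - G y)) = 0"
    unfolding eventually_at_right_field
    by (rule exI[of _ 1]) (use const in auto)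
  ultimately have "((\<lambda>s::real. 0) \<longlongrightarrow> ?k \<bullet> D ?k) (at_right 0)" by (rule Lim_transform_eventually)
  then show ?thesis using tendsto_unique[OF trivial_limit_at_right_real _ tendsto_const] by blast
qed

end

end

section \<open>Convex envelopes as suprema of affine minorants\<close>

definition convex_envelope :: "('a::euclidean_space \<Rightarrow> real) \<Rightarrow> 'a \<Rightarrow> real" where
  "convex_envelope w x = (SUP (p, c)\<in>{(p, c). \<forall>z. c + p \<bullet> z \<le> w z}. c + p \<bullet> x)"

lemma bdd_above_convex_envelope: "bdd_above ((\<lambda>(p, c). c + p \<bullet> x) ` {(p, c). \<forall>z. c + p \<bullet> z \<le> w z})"
  by (rule bdd_aboveI[of _ "w x"]) auto

lemma convex_envelope_ge: "(\<And>z. c + p \<bullet> z \<le> w z) \<Longrightarrow> c + p \<bullet> x \<le> convex_envelope w x"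
  unfolding convex_envelope_def by (rule cSUP_upper2[OF bdd_above_convex_envelope, of "(p, c)"]) auto

lemma convex_envelope_le:
  assumes "\<And>z. m \<le> w z" "\<And>p c. (\<And>z. c + p \<bullet> z \<le> w z) \<Longrightarrow> c + p \<bullet> x \<le> B"
  shows "convex_envelope w x \<le> B"
  unfolding convex_envelope_def
proof (rule cSUP_least)
  have "(0, m) \<in> {(p, c). \<forall>z. c + p \<bullet> z \<le> w z}" using assms(1) by simp
  then show "{(p, c). \<forall>z. c + p \<bullet> z \<le> w z} \<noteq> {}" by blast
qed (use assms(2) in auto)

lemma convex_envelope_below:
  assumes "\<And>z. m \<le> w z"
  shows "convex_envelope w x \<le> w x"
  by (rule convex_envelope_le[OF assms])

lemma convex_envelope_lower:
  assumes "\<And>z. m \<le> w z"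
  shows "m \<le> convex_envelope w x"
  using convex_envelope_ge[of m 0 w x] assms by simp

lemma convex_on_convex_envelope:
  assumes m: "\<And>z. m \<le> w z"
  shows "convex_on UNIV (convex_envelope w)"
proof (rule convex_onI)
  fix t :: real and x y assume t: "0 < t" "t < 1"
  show "convex_envelope w ((1 - t) *\<^sub>R x + t *\<^sub>R y) \<le> (1 - t) * convex_envelope w x + t * convex_envelope w y"
  proof (rule convex_envelope_le[OF m])
    fix p c assume pc: "\<And>z. c + p \<bullet> z \<le> w z"
    have "c + p \<bullet> ((1 - t) *\<^sub>R x + t *\<^sub>R y) = (1 - t) * (c + p \<bullet> x) + t * (c + p \<bullet> y)"
      by (simp add: inner_add_right algebra_simps)
    also have "\<dots> \<le> (1 - t) * convex_envelope w x + t * convex_envelope w y"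
      using t by (intro add_mono mult_left_mono convex_envelope_ge pc) auto
    finally show "c + p \<bullet> ((1 - t) *\<^sub>R x + t *\<^sub>R y) \<le> (1 - t) * convex_envelope w x + t * convex_envelope w y" .
  qed
qed simp

text \<open>A subgradient of \<open>w\<close> itself is an affine minorant that touches
  \<open>w\<close> at \<open>x\<close>, hence a competitor in the supremum. Together with
  \<open>convex_envelope_eq_imp_subgrad\<close> and the existence of subgradients of the envelope,
  contact points are exactly those where \<open>w\<close> has a subgradient.\<close>

lemma subgrad_imp_convex_envelope_eq:
  assumes m: "\<And>z. m \<le> w z" and "is_subgrad w x p"
  shows "convex_envelope w x = w x" "is_subgrad (convex_envelope w) x p"
proof -
  have *: "w x + p \<bullet> (z - x) \<le> convex_envelope w z" for z
  proof -
    have "w x - p \<bullet> x + p \<bullet> y \<le> w y" for y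
      using is_subgradD[OF assms(2), of y] by (simp add: inner_diff_right)
    from convex_envelope_ge[of "w x - p \<bullet> x" p w z, OF this] show ?thesis by (simp add: inner_diff_right)
  qed
  show eq: "convex_envelope w x = w x"
    using *[of x] convex_envelope_below[of m w x] m by simp
  show "is_subgrad (convex_envelope w) x p" using * by (simp add: is_subgrad_def eq)
qed

lemma convex_envelope_eq_imp_subgrad:
  assumes m: "\<And>z. m \<le> w z" and eq: "convex_envelope w x = w x" and sub: "is_subgrad (convex_envelope w) x p"
  shows "is_subgrad w x p"
  unfolding is_subgrad_def
proof
  fix z
  show "w x + p \<bullet> (z - x) \<le> w z"
    using is_subgradD[OF sub, of z] convex_envelope_below[of m w z] m eq by simp
qed

section \<open>Contact sets of supersolutions\<close>

text \<open>Off \<open>diff_pts\<close> the Frechet derivative is an arbitrary choice; the matrix is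
  used on \<open>diff_pts\<close>, whose complement is null by Rademacher's theorem.\<close>

definition jac :: "(real^'n \<Rightarrow> real) \<Rightarrow> real \<Rightarrow> real^'n \<Rightarrow> real^'n^'n" where
  "jac \<Gamma> b y = matrix (frechet_derivative (grad_conj \<Gamma> b) (at y))"

definition diff_pts :: "(real^'n \<Rightarrow> real) \<Rightarrow> real \<Rightarrow> (real^'n) set" where
  "diff_pts \<Gamma> b = {y. grad_conj \<Gamma> b differentiable (at y)}"

text \<open>The last item is the injectivity for the change of variables: two points with the same
  image differ by a kernel vector of the Jacobian, so a nonsingular Jacobian makes the fibre a
  single point.\<close>

lemma jac_properties:
  fixes \<Gamma> :: "real^'n \<Rightarrow> real"
  assumes \<Gamma>: "bounded_below_convex \<Gamma> b" and y: "y \<in> diff_pts \<Gamma> b"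
  shows "(grad_conj \<Gamma> b has_derivative (\<lambda>h. jac \<Gamma> b y *v h)) (at y)"
    and "transpose (jac \<Gamma> b y) = jac \<Gamma> b y"
    and "0 \<le> k \<bullet> (jac \<Gamma> b y *v k)"
    and "k \<bullet> (jac \<Gamma> b y *v k) \<le> (1 / b) * (k \<bullet> k)"
    and "grad_conj \<Gamma> b y' = grad_conj \<Gamma> b y \<Longrightarrow> det (jac \<Gamma> b y) \<noteq> 0 \<Longrightarrow> y' = y"
proof -
  interpret bounded_below_convex \<Gamma> b by (rule \<Gamma>)
  have "(G has_derivative frechet_derivative G (at y)) (at y)"
    using y unfolding diff_pts_def by (simp add: frechet_derivative_works)
  moreover have "frechet_derivative G (at y) = (\<lambda>h. jac \<Gamma> b y *v h)"
    using calculation unfolding jac_def by (simp add: matrix_works has_derivative_linear)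
  ultimately show D: "(G has_derivative (\<lambda>h. jac \<Gamma> b y *v h)) (at y)" by simp
  have "transpose (jac \<Gamma> b y) *v k = jac \<Gamma> b y *v k" for k
  proof (rule vector_eq_ldot[THEN iffD1], rule allI)
    fix l
    have "l \<bullet> (transpose (jac \<Gamma> b y) *v k) = (jac \<Gamma> b y *v l) \<bullet> k"
      by (metis dot_lmul_matrix inner_commute transpose_matrix_vector transpose_transpose)
    also have "\<dots> = l \<bullet> (jac \<Gamma> b y *v k)" using D_symmetric[OF D, of k l] by (simp add: inner_commute)
    finally show "l \<bullet> (transpose (jac \<Gamma> b y) *v k) = l \<bullet> (jac \<Gamma> b y *v k)" .
  qed
  then show "transpose (jac \<Gamma> b y) = jac \<Gamma> b y" by (simp add: matrix_eq)
  show "0 \<le> k \<bullet> (jac \<Gamma> b y *v k)" by (rule D_nonneg[OF D])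
  show "k \<bullet> (jac \<Gamma> b y *v k) \<le> (1 / b) * (k \<bullet> k)" by (rule D_le[OF D])
  assume eq: "G y' = G y" and det: "det (jac \<Gamma> b y) \<noteq> 0"
  have "b * (norm (jac \<Gamma> b y *v (y' - y)))\<^sup>2 \<le> 0"
    using D_bounds[OF D, of "y' - y"] G_eq_imp_D_kernel[OF D eq] by simp
  then have "jac \<Gamma> b y *v (y' - y) = 0" using b by (simp add: mult_le_0_iff)
  moreover have "invertible (jac \<Gamma> b y)" using det by (simp add: invertible_det_nz)
  ultimately have "y' - y = 0"
    by (metis invertible_def matrix_left_invertible_ker)
  then show "y' = y" by simp
qed

lemma negligible_not_diff_pts:
  fixes \<Gamma> :: "real^'n \<Rightarrow> real"
  assumes "bounded_below_convex \<Gamma> b"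
  shows "negligible (- diff_pts \<Gamma> b)"
proof -
  have "AE x in lborel. grad_conj \<Gamma> b differentiable (at x)"
    by (rule rademacher[OF bounded_below_convex.G_lipschitz[OF assms]])
  then obtain N where N: "{x \<in> space lborel. \<not> grad_conj \<Gamma> b differentiable (at x)} \<subseteq> N"
      "emeasure lborel N = 0" "N \<in> sets lborel" by (rule AE_E)
  have "N \<in> null_sets lborel" using N by (intro null_setsI)
  then have "negligible N" by (simp add: negligible_iff_null_sets null_sets_completionI)
  then show ?thesis by (rule negligible_subset) (use N(1) in \<open>auto simp: diff_pts_def\<close>)
qed

lemma negligible_lipschitz_image:
  fixes f :: "'a::euclidean_space \<Rightarrow> 'a"
  assumes "\<And>x y. norm (f x - f y) \<le> L * norm (x - y)" "negligible N"
  shows "negligible (f ` N)"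
  by (rule negligible_locally_Lipschitz_image[OF _ assms(2)])
    (auto intro!: exI[of _ UNIV] exI[of _ L] simp: assms(1))

lemma measure_le_insert_negligible:
  fixes A :: "'a::euclidean_space set"
  assumes "A \<subseteq> B \<union> N" "A \<in> sets lebesgue" "B \<in> lmeasurable" "negligible N"
  shows "measure lebesgue A \<le> measure lebesgue B"
proof -
  have N: "N \<in> lmeasurable" "measure lebesgue N = 0"
    using assms(4) negligible_imp_measurable negligible_imp_measure0 by auto
  have "measure lebesgue A \<le> measure lebesgue (B \<union> N)"
    using assms N by (intro measure_mono_fmeasurable) (auto intro: fmeasurable.Un)
  also have "\<dots> \<le> measure lebesgue B + measure lebesgue N"
    using assms N by (intro measure_Un_le) (auto intro: fmeasurableD)
  finally show ?thesis using N by simp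
qed

text \<open>The Jacobian of \<open>G\<close> has eigenvalues between 0 and 1/b, so \<open>G\<close>
  multiplies volumes by at most (1/b)^n; the comparison map is the identity. Points of
  nondifferentiability have a null image because \<open>G\<close> is Lipschitz.\<close>

lemma measure_grad_conj_image_le:
  fixes \<Gamma> :: "real^'n \<Rightarrow> real"
  assumes \<Gamma>: "bounded_below_convex \<Gamma> b" and Q: "Q \<in> lmeasurable" and W: "W \<in> sets lebesgue" "W \<subseteq> grad_conj \<Gamma> b ` Q"
  shows "measure lebesgue W \<le> (1 / b) ^ CARD('n) * measure lebesgue Q"
proof -
  interpret bounded_below_convex \<Gamma> b by (rule \<Gamma>)
  note neg = negligible_not_diff_pts[OF \<Gamma>]
  have Q0: "Q - - diff_pts \<Gamma> b \<in> lmeasurable"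
    using Q neg by (meson fmeasurable_Diff negligible_imp_sets)
  let ?Q = "Q - - diff_pts \<Gamma> b"
  have 1: "\<bar>det (jac \<Gamma> b y)\<bar> \<le> (1 / b) ^ CARD('n) * \<bar>det (mat 1 :: real^'n^'n)\<bar>" if "y \<in> ?Q" for y
    using that det_contraction_bounds[OF jac_properties(2)[OF \<Gamma>] b jac_properties(3)[OF \<Gamma>] jac_properties(4)[OF \<Gamma>], of y]
    by auto
  have "G ` ?Q \<in> lmeasurable \<and> measure lebesgue (G ` ?Q) \<le> (1 / b) ^ CARD('n) * measure lebesgue ((\<lambda>y. y) ` ?Q)"
  proof (intro conjI measure_differentiable_image_le(1,3)[OF Q0 jac_properties(1)[OF \<Gamma>] _ 1, where g="\<lambda>y. y" and K=1])
    show "((\<lambda>y. y) has_derivative (\<lambda>h. mat 1 *v h)) (at y)" for y :: "real^'n" by simp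
  qed (use b in auto)
  then have "G ` ?Q \<in> lmeasurable" "measure lebesgue (G ` ?Q) \<le> (1 / b) ^ CARD('n) * measure lebesgue ?Q" by auto
  moreover have "measure lebesgue W \<le> measure lebesgue (G ` ?Q)"
  proof (rule measure_le_insert_negligible)
    show "W \<subseteq> G ` ?Q \<union> G ` (- diff_pts \<Gamma> b)" using W(2) by blast
    show "negligible (G ` (- diff_pts \<Gamma> b))" by (rule negligible_lipschitz_image[OF G_lipschitz neg])
  qed (use W calculation in auto)
  moreover have "(1 / b) ^ CARD('n) * measure lebesgue ?Q \<le> (1 / b) ^ CARD('n) * measure lebesgue Q"
    using Q Q0 b by (intro mult_left_mono measure_mono_fmeasurable) (auto intro: fmeasurableD)
  ultimately show ?thesis by linarith
qed

text \<open>\<open>q\<close> is a subgradient at \<open>G q\<close> plus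
  \<open>b *\<^sub>R G q\<close>. A unit step from \<open>G q\<close> along that subgradient raises
  \<open>\<Gamma>\<close> by at least its norm, while \<open>\<Gamma>\<close> is bounded on a
  slightly larger ball.\<close>

lemma bounded_vimage_grad_conj:
  fixes \<Gamma> :: "real^'n \<Rightarrow> real"
  assumes \<Gamma>: "bounded_below_convex \<Gamma> b" and W: "bounded W"
  shows "bounded (grad_conj \<Gamma> b -` W)"
proof -
  interpret bounded_below_convex \<Gamma> b by (rule \<Gamma>)
  obtain m where m: "\<And>x. m \<le> \<Gamma> x" using low by blast
  obtain R where R: "R > 0" "\<And>x. x \<in> W \<Longrightarrow> norm x \<le> R" using W by (auto simp: bounded_pos)
  have "bounded (\<Gamma> ` cball 0 (R + 1))"
    by (intro compact_imp_bounded compact_continuous_image convex_on_UNIV_continuous conv compact_cball)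
  then obtain B where B: "\<forall>x\<in>cball 0 (R + 1). \<bar>\<Gamma> x\<bar> \<le> B" by (auto simp: bounded_iff)
  show ?thesis
  proof (rule boundedI)
    fix q assume "q \<in> G -` W"
    then have x: "norm (G q) \<le> R" using R by auto
    \<comment> \<open>If \<open>?p = 0\<close>, division by zero makes \<open>?u = 0\<close>, for
      which the two claims below remain true.\<close>
    let ?p = "q - b *\<^sub>R G q" and ?u = "(1 / norm (q - b *\<^sub>R G q)) *\<^sub>R (q - b *\<^sub>R G q)"
    have nu: "norm ?u \<le> 1" by simp
    have "norm (G q + ?u) \<le> R + 1" using norm_triangle_ineq[of "G q" ?u] x nu by linarith
    then have "\<bar>\<Gamma> (G q + ?u)\<bar> \<le> B" using B by simp
    moreover have "\<Gamma> (G q) + ?p \<bullet> ((G q + ?u) - G q) \<le> \<Gamma> (G q + ?u)" by (rule is_subgradD[OF G_subgrad])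
    moreover have "?p \<bullet> ((G q + ?u) - G q) = norm ?p"
      by (cases "?p = 0") (simp_all add: power2_norm_eq_inner[symmetric] power2_eq_square)
    ultimately have "norm ?p \<le> B - m" using m[of "G q"] by linarith
    moreover have "norm q \<le> norm ?p + norm (b *\<^sub>R G q)" using norm_triangle_ineq[of ?p "b *\<^sub>R G q"] by simp
    moreover have "norm (b *\<^sub>R G q) \<le> b * R" using x b by simp
    ultimately show "norm q \<le> B - m + b * R" by linarith
  qed
qed

text \<open>The viscosity condition is reduced to quadratic polynomials lying below \<open>v\<close>
  in a small ball. By \<open>low\<close>, some paraboloid of opening \<open>- a0\<close> lies below
  \<open>v\<close>, so that \<open>v\<close> has a finite envelope at every opening from
  \<open>a0\<close> on.\<close>

locale pucci_supersolution =
  fixes v :: "real^'n \<Rightarrow> real" and \<Lambda> a0 m :: real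
  assumes \<Lambda>: "\<Lambda> \<ge> 1" and a0: "a0 > 0"
    and cont: "continuous_on UNIV v"
    and low: "\<And>x. m \<le> v x + a0 / 2 * (norm x)\<^sup>2"
    and touch: "\<And>x p N r. transpose N = N \<Longrightarrow> r > 0 \<Longrightarrow>
      (\<And>h. norm h < r \<Longrightarrow> v x + p \<bullet> h + 1/2 * (h \<bullet> (N *v h)) \<le> v (x + h)) \<Longrightarrow> pucci_nonpos \<Lambda> N"
begin

definition va :: "real \<Rightarrow> real^'n \<Rightarrow> real" where "va a x = v x + a / 2 * (norm x)\<^sup>2"
definition env :: "real \<Rightarrow> real^'n \<Rightarrow> real" where "env a = convex_envelope (va a)"
text \<open>Contact is agreement with the envelope, so closedness follows from continuity; the
  lemmas on subgradients of \<open>va\<close> identify it with touching by paraboloids.\<close>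

definition contact :: "real \<Rightarrow> (real^'n) set" where "contact a = {x. env a x = va a x}"

lemma va_low: "a0 \<le> a \<Longrightarrow> m + (a - a0) / 2 * (norm x)\<^sup>2 \<le> va a x"
  using low[of x] by (simp add: va_def field_simps)

lemma va_ge: "a0 \<le> a \<Longrightarrow> m \<le> va a x"
  using va_low[of a x] zero_le_power2[of "norm x"]
  by (smt (verit) divide_nonneg_nonneg mult_nonneg_nonneg)

lemma continuous_va: "continuous_on A (va a)"
  unfolding va_def by (intro continuous_intros continuous_on_subset[OF cont]) auto

lemma env_locale: "a0 \<le> a \<Longrightarrow> bounded_below_convex (env a) a"
  unfolding bounded_below_convex_def env_def
  using convex_on_convex_envelope[OF va_ge] convex_envelope_lower[OF va_ge] a0 by (auto intro!: exI[of _ m])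

lemma env_le: "a0 \<le> a \<Longrightarrow> env a x \<le> va a x"
  unfolding env_def by (rule convex_envelope_below[OF va_ge])

lemma subgrad_va_imp_contact:
  assumes "a0 \<le> a" "is_subgrad (va a) x p"
  shows "x \<in> contact a" "is_subgrad (env a) x p"
  using subgrad_imp_convex_envelope_eq[OF va_ge[OF assms(1)] assms(2)] by (simp_all add: contact_def env_def)

lemma contact_imp_subgrad_va:
  assumes "a0 \<le> a" "x \<in> contact a" "is_subgrad (env a) x p"
  shows "is_subgrad (va a) x p"
  using convex_envelope_eq_imp_subgrad[OF va_ge[OF assms(1)]] assms by (simp add: contact_def env_def)

lemma contact_subgrad_exists:
  assumes "a0 \<le> a" "x \<in> contact a"
  obtains p where "is_subgrad (va a) x p"
proof -
  have "convex_on UNIV (env a)" using env_locale[OF assms(1)] by (simp add: bounded_below_convex_def)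
  then obtain p where "is_subgrad (env a) x p" using subgrad_exists by blast
  then show thesis using contact_imp_subgrad_va[OF assms] that by blast
qed

lemma closed_contact:
  assumes "a0 \<le> a"
  shows "closed (contact a)"
proof -
  have "convex_on UNIV (env a)" using env_locale[OF assms] by (simp add: bounded_below_convex_def)
  then show ?thesis unfolding contact_def
    by (intro closed_Collect_eq convex_on_UNIV_continuous continuous_va)
qed

text \<open>Expanding the square about \<open>x\<close> turns a supporting affine function of
  \<open>va a\<close> into a paraboloid of opening \<open>- a\<close> below \<open>v\<close>, whose
  slope at \<open>x\<close> is \<open>p - a *\<^sub>R x\<close>.\<close>

lemma subgrad_va_iff:
  "is_subgrad (va a) x p \<longleftrightarrow> (\<forall>h. v x + (p - a *\<^sub>R x) \<bullet> h - a / 2 * (norm h)\<^sup>2 \<le> v (x + h))"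
proof -
  have "va a x + p \<bullet> h \<le> va a (x + h) \<longleftrightarrow> v x + (p - a *\<^sub>R x) \<bullet> h - a / 2 * (norm h)\<^sup>2 \<le> v (x + h)" for h
  proof -
    have "a / 2 * (norm (x + h))\<^sup>2 = a / 2 * (norm x)\<^sup>2 + a * (x \<bullet> h) + a / 2 * (norm h)\<^sup>2"
      by (simp add: power2_norm_eq_inner inner_add_left inner_add_right inner_commute[of h x] field_simps)
    then show ?thesis unfolding va_def inner_diff_left inner_scaleR_left by linarith
  qed
  moreover have "is_subgrad (va a) x p \<longleftrightarrow> (\<forall>h. va a x + p \<bullet> h \<le> va a (x + h))"
  proof
    assume "is_subgrad (va a) x p"
    from is_subgradD[OF this, of "x + _"] show "\<forall>h. va a x + p \<bullet> h \<le> va a (x + h)" by simp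
  next
    assume *: "\<forall>h. va a x + p \<bullet> h \<le> va a (x + h)"
    show "is_subgrad (va a) x p"
      unfolding is_subgrad_def
    proof
      fix z
      show "va a x + p \<bullet> (z - x) \<le> va a z" using *[rule_format, of "z - x"] by simp
    qed
  qed
  ultimately show ?thesis by simp
qed

lemma contact_mono:
  assumes "a0 \<le> a" "a \<le> b"
  shows "contact a \<subseteq> contact b"
proof
  fix x assume "x \<in> contact a"
  then obtain p where p: "is_subgrad (va a) x p" using contact_subgrad_exists assms by blast
  have "is_subgrad (va b) x (p - a *\<^sub>R x + b *\<^sub>R x)"
    unfolding subgrad_va_iff
  proof
    fix h :: "real^'n"
    have "a / 2 * (norm h)\<^sup>2 \<le> b / 2 * (norm h)\<^sup>2" using assms by (intro mult_right_mono) auto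
    then show "v x + (p - a *\<^sub>R x + b *\<^sub>R x - b *\<^sub>R x) \<bullet> h - b / 2 * (norm h)\<^sup>2 \<le> v (x + h)"
      using p[unfolded subgrad_va_iff, rule_format, of h] by simp
  qed
  then show "x \<in> contact b" using subgrad_va_imp_contact assms by (meson order_trans)
qed

text \<open>Testing with \<open>d\<close> shows that some eigenvalue is at least
  \<open>K * (d \<bullet> d) - c\<close>, while all are at least \<open>- c\<close>; the Pucci
  inequality then limits \<open>K\<close>.\<close>

lemma pucci_nonpos_rank_one_bound:
  fixes d :: "real^'n" and K c :: real
  assumes N: "\<And>h. h \<bullet> (N *v h) = K * (d \<bullet> h)\<^sup>2 - c * (h \<bullet> h)" and K: "K \<ge> 0" and c: "c \<ge> 0"
    and P: "pucci_nonpos \<Lambda> N"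
  shows "K * (d \<bullet> d) \<le> c + \<Lambda> * (real CARD('n) * c)"
proof (rule ccontr)
  assume "\<not> ?thesis"
  then have big: "K * (d \<bullet> d) - c > \<Lambda> * (real CARD('n) * c)" by simp
  obtain e lam where el: "eigenbasis N e lam"
      and sum: "(\<Sum>i\<in>UNIV. if lam i > 0 then lam i else \<Lambda> * lam i) \<le> 0"
    using P by (auto simp: pucci_nonpos_def)
  have lamlo: "lam i \<ge> - c" for i
  proof -
    have "lam i = e i \<bullet> (N *v e i)" "e i \<bullet> e i = 1" using el by (simp_all add: eigenbasis_def)
    then show ?thesis using N[of "e i"] K by simp
  qed
  have dpos: "d \<bullet> d > 0"
  proof (rule ccontr)
    assume "\<not> d \<bullet> d > 0"
    then have "d \<bullet> d = 0" by (metis inner_ge_zero less_eq_real_def)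
    then have "- c > \<Lambda> * (real CARD('n) * c)" using big by simp
    moreover have "\<Lambda> * (real CARD('n) * c) \<ge> 0" using \<Lambda> c by simp
    ultimately show False using c by linarith
  qed
  have "\<exists>i. lam i \<ge> K * (d \<bullet> d) - c"
  proof (rule ccontr)
    assume "\<not> ?thesis"
    then have lt: "lam i < K * (d \<bullet> d) - c" for i by (meson not_le)
    have "d \<bullet> (N *v d) = (\<Sum>i\<in>UNIV. lam i * (d \<bullet> e i)\<^sup>2)" by (rule eigenbasis_quadratic(1)[OF el])
    also have "\<dots> < (\<Sum>i\<in>UNIV. (K * (d \<bullet> d) - c) * (d \<bullet> e i)\<^sup>2)"
    proof (rule sum_strict_mono_ex1)
      show "\<forall>i\<in>UNIV. lam i * (d \<bullet> e i)\<^sup>2 \<le> (K * (d \<bullet> d) - c) * (d \<bullet> e i)\<^sup>2"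
        using lt by (intro ballI mult_right_mono) (auto intro: less_imp_le)
      have "\<exists>i. d \<bullet> e i \<noteq> 0"
        using eigenbasis_quadratic(2)[OF el, of d] dpos by (metis (no_types, lifting) less_irrefl power_zero_numeral sum.neutral)
      then show "\<exists>i\<in>UNIV. lam i * (d \<bullet> e i)\<^sup>2 < (K * (d \<bullet> d) - c) * (d \<bullet> e i)\<^sup>2"
        using lt by (auto intro!: mult_strict_right_mono)
    qed simp
    also have "\<dots> = (K * (d \<bullet> d) - c) * (d \<bullet> d)"
      using eigenbasis_quadratic(2)[OF el, of d] by (simp add: sum_distrib_left)
    also have "\<dots> = d \<bullet> (N *v d)" by (simp add: N power2_eq_square algebra_simps)
    finally show False by simp
  qed
  then obtain i where i: "lam i \<ge> K * (d \<bullet> d) - c" by blast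
  let ?t = "\<lambda>i. if lam i > 0 then lam i else \<Lambda> * lam i"
  have nn: "\<Lambda> * c \<ge> 0" using \<Lambda> c by simp
  have "\<Lambda> * (real CARD('n) * c) \<ge> 0" using \<Lambda> c by simp
  then have ipos: "lam i > 0" using i big by linarith
  have "(\<Sum>k\<in>UNIV. ?t k) = lam i + (\<Sum>k\<in>UNIV - {i}. ?t k)"
    using ipos by (subst sum.remove[of UNIV i]) auto
  moreover have "(\<Sum>k\<in>UNIV - {i}. ?t k) \<ge> (\<Sum>k\<in>UNIV - {i}. - (\<Lambda> * c))"
  proof (rule sum_mono)
    fix k
    have "\<Lambda> * lam k \<ge> \<Lambda> * (- c)" using lamlo[of k] \<Lambda> by (intro mult_left_mono) auto
    then show "?t k \<ge> - (\<Lambda> * c)" using nn by auto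
  qed
  moreover have "real (card (UNIV - {i})) * (\<Lambda> * c) \<le> real CARD('n) * (\<Lambda> * c)"
    using nn by (intro mult_right_mono) (auto simp: card_Diff_singleton)
  ultimately have "lam i \<le> real CARD('n) * (\<Lambda> * c)" using sum by simp
  then show False using i big by (simp add: algebra_simps)
qed

text \<open>
  If there were two slopes differing by \<open>d\<close>, the corner between the two paraboloids would lie above
  quadratics with Hessian \<open>K d d\<^sup>T - c I\<close> for every \<open>K\<close>.
\<close>
lemma slope_unique:
  assumes a: "a0 \<le> a" and b: "a0 \<le> b" and p: "is_subgrad (va a) z p" and q: "is_subgrad (va b) z q"
  shows "p - a *\<^sub>R z = q - b *\<^sub>R z"
proof (rule ccontr)
  define d where "d = (p - a *\<^sub>R z) - (q - b *\<^sub>R z)"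
  define s where "s = (1/2) *\<^sub>R ((p - a *\<^sub>R z) + (q - b *\<^sub>R z))"
  define c where "c = max a b"
  assume "p - a *\<^sub>R z \<noteq> q - b *\<^sub>R z"
  then have d0: "d \<bullet> d > 0" by (simp add: d_def inner_gt_zero_iff)
  have c: "c > 0" using a a0 by (simp add: c_def)
  \<comment> \<open>Makes \<open>K * (d \<bullet> d)\<close> exceed the bound of
    \<open>pucci_nonpos_rank_one_bound\<close> by exactly 1.\<close>
  define K where "K = (c + \<Lambda> * (real CARD('n) * c) + 1) / (d \<bullet> d)"
  have K: "K > 0" using c \<Lambda> d0 by (auto simp: K_def intro!: divide_pos_pos add_nonneg_pos)
  define N :: "real^'n^'n" where "N = K *\<^sub>R (\<chi> i j. d $ i * d $ j) - c *\<^sub>R mat 1"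
  have Nq: "h \<bullet> (N *v h) = K * (d \<bullet> h)\<^sup>2 - c * (h \<bullet> h)" for h
  proof -
    have "(\<chi> i j. d $ i * d $ j) *v h = (d \<bullet> h) *\<^sub>R d"
      by (simp add: matrix_vector_mult_def inner_vec_def vec_eq_iff sum_distrib_left mult.assoc mult.left_commute mult.commute)
    then have "N *v h = K *\<^sub>R ((d \<bullet> h) *\<^sub>R d) - c *\<^sub>R h"
      by (simp add: N_def matrix_vector_mult_diff_rdistrib mat1_mult_scaleR scaleR_matrix_vector_assoc[symmetric])
    then show ?thesis by (simp add: inner_diff_right power2_eq_square inner_commute[of h d])
  qed
  have "pucci_nonpos \<Lambda> N"
  proof (rule touch)
    show "transpose N = N" by (simp add: N_def transpose_def vec_eq_iff mat_def mult.commute)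
    show "1 / (K * norm d) > 0" using K d0 by auto
    fix h :: "real^'n" assume h: "norm h < 1 / (K * norm d)"
    have nd: "norm d > 0" using d0 by auto
    have "\<bar>d \<bullet> h\<bar> \<le> norm d * norm h" by (rule Cauchy_Schwarz_ineq2)
    then have "K * \<bar>d \<bullet> h\<bar> \<le> K * (norm d * norm h)" using K by (intro mult_left_mono) auto
    also have "\<dots> \<le> 1" using h K nd by (simp add: field_simps)
    finally have "K * \<bar>d \<bullet> h\<bar> * \<bar>d \<bullet> h\<bar> \<le> 1 * \<bar>d \<bullet> h\<bar>" by (intro mult_right_mono) auto
    then have 1: "K * (d \<bullet> h)\<^sup>2 \<le> \<bar>d \<bullet> h\<bar>" by (simp add: power2_eq_square mult.assoc)
    have 2: "v z + (p - a *\<^sub>R z) \<bullet> h - a / 2 * (norm h)\<^sup>2 \<le> v (z + h)" using p subgrad_va_iff by blast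
    have 3: "v z + (q - b *\<^sub>R z) \<bullet> h - b / 2 * (norm h)\<^sup>2 \<le> v (z + h)" using q subgrad_va_iff by blast
    have 4: "a / 2 * (norm h)\<^sup>2 \<le> c / 2 * (norm h)\<^sup>2" "b / 2 * (norm h)\<^sup>2 \<le> c / 2 * (norm h)\<^sup>2"
      by (auto simp: c_def intro!: mult_right_mono)
    have 5: "d \<bullet> h = (p - a *\<^sub>R z) \<bullet> h - (q - b *\<^sub>R z) \<bullet> h" by (simp add: d_def inner_diff_left)
    have 6: "s \<bullet> h = 1/2 * ((p - a *\<^sub>R z) \<bullet> h + (q - b *\<^sub>R z) \<bullet> h)" by (simp add: s_def inner_add_left)
    have 7: "1/2 * (h \<bullet> (N *v h)) = 1/2 * (K * (d \<bullet> h)\<^sup>2) - c / 2 * (norm h)\<^sup>2"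
      by (simp add: Nq power2_norm_eq_inner right_diff_distrib)
    show "v z + s \<bullet> h + 1/2 * (h \<bullet> (N *v h)) \<le> v (z + h)"
    proof -
      \<comment> \<open>The larger of \<open>P\<close> and \<open>Q\<close> is their mean plus half
        of \<open>\<bar>P - Q\<bar>\<close>. The radius was chosen so that
        \<open>K * (d \<bullet> h)\<^sup>2\<close> is at most
        \<open>\<bar>d \<bullet> h\<bar>\<close>, which fits the quadratic under the corner.\<close>
      have lin: "w + 1/2 * (P + Q) + (1/2 * E - C) \<le> V"
        if "E \<le> \<bar>P - Q\<bar>" "w + P - A \<le> V" "w + Q - B \<le> V" "A \<le> C" "B \<le> C" for w P Q E A B C V :: real
        using that by (cases "P \<le> Q") (simp_all add: field_simps)
      from 1 have sq: "K * (d \<bullet> h)\<^sup>2 \<le> \<bar>(p - a *\<^sub>R z) \<bullet> h - (q - b *\<^sub>R z) \<bullet> h\<bar>" by (subst 5[symmetric])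
      show ?thesis unfolding 7 6 by (rule lin[OF sq 2 3 4])
    qed
  qed
  from pucci_nonpos_rank_one_bound[OF Nq less_imp_le[OF K] less_imp_le[OF c] this]
  have "K * (d \<bullet> d) \<le> c + \<Lambda> * (real CARD('n) * c)" .
  moreover have "K * (d \<bullet> d) = c + \<Lambda> * (real CARD('n) * c) + 1" using d0 by (simp add: K_def)
  ultimately show False by simp
qed

text \<open>By Fenchel-Young, an upper second-order expansion of the conjugate at \<open>y\<close>
  is a lower one for env + b/2 |x|^2 at \<open>G y\<close>, hence for v + b |x|^2, with equality at
  \<open>G y\<close> because it is a contact point. So \<open>v\<close> is touched by a quadratic
  with Hessian R - 2b, where \<open>R\<close> inverts M + \<epsilon> I; one b comes from
  \<open>va\<close>, the other from the conjugate.\<close>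

lemma det_bound_at_contact:
  assumes b: "a0 \<le> b" and y: "y \<in> diff_pts (env b) b" and x: "grad_conj (env b) b y \<in> contact b"
  shows "det (mat 1 - b *\<^sub>R jac (env b) b y) \<le>
    (real CARD('n) * \<Lambda>) ^ (CARD('n) - 1) * (b ^ CARD('n) * det (jac (env b) b y))"
proof -
  interpret E: bounded_below_convex "env b" b by (rule env_locale[OF b])
  note J = jac_properties[OF env_locale[OF b] y]
  define M where "M = jac (env b) b y"
  define x where "x = E.G y"
  have xc: "env b x = va b x" using assms(3) by (simp add: contact_def x_def)
  have "\<exists>R. (M + \<epsilon> *\<^sub>R mat 1) ** R = mat 1 \<and> pucci_nonpos \<Lambda> (R - (2 * b) *\<^sub>R mat 1)" if eps: "\<epsilon> > 0" for \<epsilon>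
  proof -
    let ?K = "M + \<epsilon> *\<^sub>R mat 1"
    have tK: "transpose ?K = ?K"
      using J(2) unfolding M_def by (simp add: transpose_def vec_eq_iff mat_def)
    have Kv: "?K *v k = M *v k + \<epsilon> *\<^sub>R k" for k
      by (simp add: matrix_vector_mult_add_rdistrib mat1_mult_scaleR)
    have pK: "k \<bullet> (?K *v k) \<ge> \<epsilon> * (k \<bullet> k)" for k
      using J(3)[of k] unfolding M_def[symmetric] by (simp add: Kv inner_add_right)
    obtain R where R: "transpose R = R" "?K ** R = mat 1" "R ** ?K = mat 1"
      using posdef_inverse[OF tK pK eps] .
    obtain d where d: "d > 0" and d2: "\<And>k. norm k < d \<Longrightarrow>
        \<bar>E.f (y + k) - E.f y - E.G y \<bullet> k - 1/2 * (k \<bullet> (M *v k))\<bar> \<le> \<epsilon> / 2 * (norm k)\<^sup>2"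
      by (rule E.second_order_expansion[OF J(1), of "\<epsilon> / 2", folded M_def])
        (use eps in simp, rule that, assumption+)
    obtain C where C: "C > 0" "\<And>h. norm (R *v h) \<le> norm h * C"
      using bounded_linear.pos_bounded[OF matrix_vector_mul_bounded_linear[of R]] by blast
    have "pucci_nonpos \<Lambda> (R - (2 * b) *\<^sub>R mat 1)"
    proof (rule touch)
      show "transpose (R - (2 * b) *\<^sub>R mat 1) = R - (2 * b) *\<^sub>R mat 1"
        using R(1) by (simp add: transpose_def vec_eq_iff mat_def)
      show "d / C > 0" using d C by simp
      fix h :: "real^'n" assume h: "norm h < d / C"
      \<comment> \<open>This \<open>k\<close> maximizes k . h - 1/2 k . (M + \<epsilon> I) k, with
        value 1/2 h . R h; the expansion error \<epsilon>/2 |k|^2 is what turns M into M +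
        \<epsilon> I.\<close>
      define k where "k = R *v h"
      have "norm h * C < d" using h C by (simp add: pos_less_divide_eq)
      then have "norm k < d" unfolding k_def using C(2)[of h] by linarith
      from d2[OF this] have f: "E.f (y + k) \<le> E.f y + x \<bullet> k + 1/2 * (k \<bullet> (M *v k)) + \<epsilon> / 2 * (norm k)\<^sup>2"
        unfolding x_def by linarith
      have "?K *v k = h" unfolding k_def matrix_vector_mul_assoc R by simp
      then have "k \<bullet> h = k \<bullet> (M *v k) + \<epsilon> * (norm k)\<^sup>2"
        by (simp add: Kv power2_norm_eq_inner flip: inner_scaleR_right inner_add_right)
      then have kh: "1/2 * (k \<bullet> (M *v k)) + \<epsilon> / 2 * (norm k)\<^sup>2 = 1/2 * (k \<bullet> h)" by simp
      have 1: "(y + k) \<bullet> (x + h) - env b (x + h) - b / 2 * (norm (x + h))\<^sup>2 \<le> E.f (y + k)"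
        by (rule E.shifted_conj_ge)
      have 2: "env b (x + h) \<le> v (x + h) + b / 2 * (norm (x + h))\<^sup>2"
        using env_le[OF b, of "x + h"] by (simp add: va_def)
      have 3: "E.f y = y \<bullet> x - v x - b * (norm x)\<^sup>2"
        using xc by (simp add: shifted_conj_def x_def va_def)
      have 4: "b * (norm (x + h))\<^sup>2 = b * (norm x)\<^sup>2 + 2 * b * (x \<bullet> h) + b * (norm h)\<^sup>2"
        by (simp add: power2_norm_eq_inner inner_add_left inner_add_right inner_commute[of h x] algebra_simps)
      have 5: "(y + k) \<bullet> (x + h) = y \<bullet> x + y \<bullet> h + x \<bullet> k + k \<bullet> h"
        by (simp add: inner_add_left inner_add_right inner_commute[of x k])
      have 6: "(y - (2 * b) *\<^sub>R x) \<bullet> h = y \<bullet> h - 2 * b * (x \<bullet> h)" by (simp add: inner_diff_left)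
      have 7: "1/2 * (h \<bullet> ((R - (2 * b) *\<^sub>R mat 1) *v h)) = 1/2 * (k \<bullet> h) - b * (norm h)\<^sup>2"
        by (simp add: matrix_vector_mult_diff_rdistrib mat1_mult_scaleR inner_diff_right k_def power2_norm_eq_inner inner_commute[of h "R *v h"] algebra_simps)
      show "v x + (y - (2 * b) *\<^sub>R x) \<bullet> h + 1/2 * (h \<bullet> ((R - (2 * b) *\<^sub>R mat 1) *v h)) \<le> v (x + h)"
        using f 1 2 3 4 5 kh unfolding 6 7 by linarith
    qed
    with R show ?thesis by blast
  qed
  then show ?thesis unfolding M_def[symmetric]
    using pucci_det_bound[OF \<Lambda> E.b, of M] J(3,4) unfolding M_def[symmetric] by blast
qed

lemma measure_slopes_le:
  assumes b: "a0 \<le> b" and S: "S \<subseteq> contact b" "S \<in> sets borel" "bounded S"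
    and Q: "Q \<in> sets lebesgue" "Q \<subseteq> (\<lambda>y. y - b *\<^sub>R grad_conj (env b) b y) ` (grad_conj (env b) b -` S)"
  shows "measure lebesgue Q \<le> (real CARD('n) * \<Lambda>) ^ (CARD('n) - 1) * b ^ CARD('n) * measure lebesgue S"
proof -
  note L = env_locale[OF b]
  interpret E: bounded_below_convex "env b" b by (rule L)
  let ?C = "(real CARD('n) * \<Lambda>) ^ (CARD('n) - 1) * b ^ CARD('n)"
  let ?F = "\<lambda>y. y - b *\<^sub>R E.G y"
  note neg = negligible_not_diff_pts[OF L]
  have C: "?C \<ge> 0" using \<Lambda> E.b by simp
  have contG: "continuous_on UNIV E.G"
    by (rule lipschitz_on_continuous_on[of "1 / b"]) (use E.G_lipschitz E.b in \<open>auto simp: lipschitz_on_def dist_norm\<close>)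
  have "E.G -` S \<in> sets borel"
    using measurable_sets[OF borel_measurable_continuous_onI[OF contG] S(2)] by simp
  then have Y: "E.G -` S \<in> lmeasurable"
    using bounded_vimage_grad_conj[OF L S(3)] by (intro bounded_set_imp_lmeasurable) auto
  let ?Y = "E.G -` S - - diff_pts (env b) b"
  have Y0: "?Y \<in> lmeasurable" using Y neg by (meson fmeasurable_Diff negligible_imp_sets)
  have Yd: "y \<in> diff_pts (env b) b" "E.G y \<in> contact b" if "y \<in> ?Y" for y using that S by auto
  have dF: "(?F has_derivative (\<lambda>h. (mat 1 - b *\<^sub>R jac (env b) b y) *v h)) (at y)" if "y \<in> ?Y" for y
  proof -
    have "(?F has_derivative (\<lambda>h. h - b *\<^sub>R (jac (env b) b y *v h))) (at y)"
      using jac_properties(1)[OF L Yd(1)[OF that]] by (auto intro!: derivative_eq_intros)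
    then show ?thesis by (simp add: matrix_vector_mult_diff_rdistrib scaleR_matrix_vector_assoc)
  qed
  have det: "\<bar>det (mat 1 - b *\<^sub>R jac (env b) b y)\<bar> \<le> ?C * \<bar>det (jac (env b) b y)\<bar>"
     "\<bar>det (jac (env b) b y)\<bar> \<le> (1 / b) ^ CARD('n)" if y: "y \<in> ?Y" for y
  proof -
    note J = jac_properties[OF L Yd(1)[OF y]]
    note B = det_contraction_bounds[OF J(2) E.b J(3) J(4)]
    show "\<bar>det (mat 1 - b *\<^sub>R jac (env b) b y)\<bar> \<le> ?C * \<bar>det (jac (env b) b y)\<bar>"
      using det_bound_at_contact[OF b Yd[OF y]] B by (simp add: mult.assoc)
    show "\<bar>det (jac (env b) b y)\<bar> \<le> (1 / b) ^ CARD('n)" using B by simp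
  qed
  have inj: "inj_on E.G {y \<in> ?Y. det (jac (env b) b y) \<noteq> 0}"
    by (rule inj_onI) (use jac_properties(5)[OF L Yd(1)] in blast)
  note T = measure_differentiable_image_le[OF Y0 dF jac_properties(1)[OF L Yd(1)] det C inj]
  have "measure lebesgue Q \<le> measure lebesgue (?F ` ?Y)"
  proof (rule measure_le_insert_negligible[OF _ Q(1) T(1)])
    show "Q \<subseteq> ?F ` ?Y \<union> ?F ` (- diff_pts (env b) b)" using Q(2) by blast
    show "negligible (?F ` (- diff_pts (env b) b))"
    proof (rule negligible_lipschitz_image[OF _ neg])
      fix y z
      have "?F y - ?F z = (y - z) - b *\<^sub>R (E.G y - E.G z)" by (simp add: algebra_simps)
      then have "norm (?F y - ?F z) \<le> norm (y - z) + norm (b *\<^sub>R (E.G y - E.G z))"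
        by (metis norm_triangle_ineq4)
      also have "norm (b *\<^sub>R (E.G y - E.G z)) \<le> norm (y - z)"
      proof -
        have "b * norm (E.G y - E.G z) \<le> norm (y - z)" using E.G_lipschitz[of y z] E.b by (simp add: field_simps)
        moreover have "norm (b *\<^sub>R (E.G y - E.G z)) = b * norm (E.G y - E.G z)" using E.b by simp
        ultimately show ?thesis by linarith
      qed
      finally show "norm (?F y - ?F z) \<le> 2 * norm (y - z)" by simp
    qed
  qed
  also have "\<dots> \<le> ?C * measure lebesgue (E.G ` ?Y)" by (rule T(3))
  also have "\<dots> \<le> ?C * measure lebesgue S"
  proof (intro mult_left_mono[OF _ C] measure_mono_fmeasurable)
    show "S \<in> lmeasurable" using S by (intro bounded_set_imp_lmeasurable) auto
  qed (use T(2) in auto)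
  finally show ?thesis .
qed

text \<open>\<open>va b\<close> grows quadratically because \<open>b > a0\<close>, so
  \<open>va b z - q \<bullet> z\<close> has a minimum, a point of \<open>contact b\<close> with
  subgradient \<open>q\<close>. If it lay in \<open>contact a\<close>, uniqueness of slopes would
  express \<open>q\<close> through a subgradient at opening \<open>- a\<close> there, and the
  conjugate gradient at \<open>a\<close> would send \<open>q\<close> into
  \<open>contact a\<close>.\<close>

lemma slopes_subset:
  assumes a: "a0 \<le> a"
  defines "b \<equiv> 2 * a"
  shows "grad_conj (env a) a -` (- contact a) \<subseteq>
    (\<lambda>y. y - b *\<^sub>R grad_conj (env b) b y) ` (grad_conj (env b) b -` (contact b - contact a))"
proof
  have b: "a0 < b" "a0 \<le> b" using a a0 by (auto simp: b_def)
  interpret Ea: bounded_below_convex "env a" a by (rule env_locale[OF a])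
  interpret Eb: bounded_below_convex "env b" b by (rule env_locale[OF b(2)])
  fix q assume q: "q \<in> Ea.G -` (- contact a)"
  have "continuous_on UNIV (\<lambda>z. va b z - q \<bullet> z)" by (intro continuous_intros continuous_va)
  moreover have "m + (b - a0) / 2 * (norm z)\<^sup>2 - norm q * norm z \<le> va b z - q \<bullet> z" for z
    using va_low[OF b(2), of z] norm_cauchy_schwarz[of q z] by linarith
  ultimately obtain z where z: "\<And>z'. va b z - q \<bullet> z \<le> va b z' - q \<bullet> z'"
    using coercive_attains_min[of "\<lambda>z. va b z - q \<bullet> z" "(b - a0) / 2" m "norm q"] b by auto
  have sz: "is_subgrad (va b) z q"
    unfolding is_subgrad_def
  proof
    fix z'
    show "va b z + q \<bullet> (z' - z) \<le> va b z'" using z[of z'] by (simp add: inner_diff_right)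
  qed
  note zb = subgrad_va_imp_contact[OF b(2) sz]
  have Gz: "Eb.G (q + b *\<^sub>R z) = z" by (rule Eb.G_eqI[OF zb(2)])
  have "z \<notin> contact a"
  proof
    assume za: "z \<in> contact a"
    obtain p where p: "is_subgrad (va a) z p" using contact_subgrad_exists[OF a za] .
    have "p - a *\<^sub>R z = q - b *\<^sub>R z" by (rule slope_unique[OF a b(2) p sz])
    then have "q = p - a *\<^sub>R z + b *\<^sub>R z" by (simp add: algebra_simps)
    moreover have "b *\<^sub>R z = a *\<^sub>R z + a *\<^sub>R z" unfolding b_def by (simp only: mult_2 scaleR_add_left)
    ultimately have "q = p + a *\<^sub>R z" by simp
    then have "Ea.G q = z" using Ea.G_eqI[OF subgrad_va_imp_contact(2)[OF a p]] by simp
    then show False using q za by simp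
  qed
  then have "q + b *\<^sub>R z \<in> Eb.G -` (contact b - contact a)" using zb Gz by simp
  moreover have "q = (q + b *\<^sub>R z) - b *\<^sub>R Eb.G (q + b *\<^sub>R z)" by (simp add: Gz)
  ultimately show "q \<in> (\<lambda>y. y - b *\<^sub>R Eb.G y) ` (Eb.G -` (contact b - contact a))" by blast
qed

text \<open>Every noncontact point is the image of some slope because \<open>env a\<close> has
  subgradients everywhere. The scale cancels in (1/a)^n (2a)^n, so the constant does not depend on
  \<open>a\<close>.\<close>

lemma noncontact_measure_step:
  assumes a: "a0 \<le> a" and bd: "bounded (- contact a)"
  shows "measure lebesgue (- contact a) \<le>
    2 ^ CARD('n) * (real CARD('n) * \<Lambda>) ^ (CARD('n) - 1) * measure lebesgue (contact (2 * a) - contact a)"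
proof -
  define b where "b = 2 * a"
  have ap: "a > 0" using a a0 by simp
  have b: "a0 \<le> b" "b > 0" using a a0 by (auto simp: b_def)
  note L = env_locale[OF a]
  interpret Ea: bounded_below_convex "env a" a by (rule L)
  let ?Q = "Ea.G -` (- contact a)" and ?S = "contact b - contact a"
  have cl: "closed (contact a)" "closed (contact b)" using closed_contact a b by auto
  have contG: "continuous_on UNIV Ea.G"
    by (rule lipschitz_on_continuous_on[of "1 / a"]) (use Ea.G_lipschitz ap in \<open>auto simp: lipschitz_on_def dist_norm\<close>)
  have oQ: "open ?Q" using contG cl(1) by (auto intro!: open_vimage simp: open_Compl)
  have Q: "?Q \<in> lmeasurable"
    using bounded_vimage_grad_conj[OF L bd] oQ by (intro bounded_set_imp_lmeasurable) auto
  have "- contact a \<subseteq> Ea.G ` ?Q"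
  proof
    fix x assume x: "x \<in> - contact a"
    obtain p where "is_subgrad (env a) x p" using subgrad_exists[OF Ea.conv] .
    then have "Ea.G (p + a *\<^sub>R x) = x" by (rule Ea.G_eqI)
    then show "x \<in> Ea.G ` ?Q" using x by (metis image_eqI vimageI2)
  qed
  then have 1: "measure lebesgue (- contact a) \<le> (1 / a) ^ CARD('n) * measure lebesgue ?Q"
    using cl by (intro measure_grad_conj_image_le[OF L Q]) auto
  have 2: "measure lebesgue ?Q \<le> (real CARD('n) * \<Lambda>) ^ (CARD('n) - 1) * b ^ CARD('n) * measure lebesgue ?S"
  proof (rule measure_slopes_le[OF b(1)])
    show "?S \<in> sets borel" using cl by auto
    show "bounded ?S" using bd by (rule bounded_subset) auto
    show "?Q \<in> sets lebesgue" using Q by auto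
    show "?Q \<subseteq> (\<lambda>y. y - b *\<^sub>R grad_conj (env b) b y) ` (grad_conj (env b) b -` ?S)"
      unfolding b_def by (rule slopes_subset[OF a])
  qed auto
  have "measure lebesgue (- contact a) \<le> (1 / a) ^ CARD('n) * ((real CARD('n) * \<Lambda>) ^ (CARD('n) - 1) * b ^ CARD('n) * measure lebesgue ?S)"
    by (rule order_trans[OF 1 mult_left_mono[OF 2]]) (use ap in simp)
  also have "\<dots> = ((1 / a) ^ CARD('n) * b ^ CARD('n)) * (real CARD('n) * \<Lambda>) ^ (CARD('n) - 1) * measure lebesgue ?S"
    by (simp add: algebra_simps)
  also have "(1 / a) ^ CARD('n) * b ^ CARD('n) = 2 ^ CARD('n)"
  proof -
    have "(1 / a) ^ CARD('n) * b ^ CARD('n) = (1 / a * b) ^ CARD('n)" by (rule power_mult_distrib[symmetric])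
    also have "1 / a * b = 2" using ap by (simp add: b_def)
    finally show ?thesis .
  qed
  finally show ?thesis unfolding b_def .
qed

theorem noncontact_measure_decay:
  assumes a: "a0 \<le> a" and bd: "- contact a \<subseteq> ball 0 2"
  defines "c \<equiv> 1 / (2 ^ CARD('n) * (real CARD('n) * \<Lambda>) ^ (CARD('n) - 1))"
  shows "measure lebesgue (- contact (2 ^ k * a)) \<le> (1 - c) ^ k * measure lebesgue (ball (0::real^'n) 2)"
proof (induction k)
  case 0
  have "open (- contact a)" using closed_contact[OF a] by (simp add: open_Compl)
  then have "measure lebesgue (- contact a) \<le> measure lebesgue (ball (0::real^'n) 2)"
    by (intro measure_mono_fmeasurable[OF bd _ lmeasurable_ball]) auto
  then show ?case by simp
next
  case (Suc k)
  let ?a = "2 ^ k * a"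
  have C0: "2 ^ CARD('n) * (real CARD('n) * \<Lambda>) ^ (CARD('n) - 1) \<ge> 1"
  proof -
    have "1 \<le> real CARD('n) * \<Lambda>" using \<Lambda> mult_mono[of 1 "real CARD('n)" 1 \<Lambda>] by (simp add: Suc_le_eq)
    then have "1 * 1 \<le> 2 ^ CARD('n) * (real CARD('n) * \<Lambda>) ^ (CARD('n) - 1)"
      by (intro mult_mono one_le_power) auto
    then show ?thesis by simp
  qed
  then have c1: "c \<le> 1" unfolding c_def by (simp add: divide_le_eq_1)
  have "1 * a \<le> ?a" using a a0 by (intro mult_right_mono) auto
  then have a': "a0 \<le> ?a" "a \<le> ?a" using a by auto
  have a2: "a0 \<le> 2 * ?a" "?a \<le> 2 * ?a" using a' a0 by linarith+
  have sub: "- contact ?a \<subseteq> ball 0 2" using contact_mono[OF a a'(2)] bd by auto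
  then have bd': "bounded (- contact ?a)" using bounded_subset bounded_ball by blast
  have cl: "closed (contact ?a)" "closed (contact (2 * ?a))" using closed_contact a' a2 by auto
  let ?S = "contact (2 * ?a) - contact ?a"
  have m1: "- contact ?a \<in> lmeasurable" using bd' cl by (intro bounded_set_imp_lmeasurable) auto
  have m2: "?S \<in> lmeasurable"
    using bounded_subset[OF bd'] cl by (intro bounded_set_imp_lmeasurable) auto
  have "- contact (2 * ?a) = - contact ?a - ?S" using contact_mono[OF a'(1) a2(2)] by auto
  then have "measure lebesgue (- contact (2 * ?a)) = measure lebesgue (- contact ?a) - measure lebesgue ?S"
    using m1 m2 by (simp add: measurable_measure_Diff fmeasurableD Diff_subset_conv sup.coboundedI1 le_supI2) 
  moreover have "c * measure lebesgue (- contact ?a) \<le> measure lebesgue ?S"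
    using noncontact_measure_step[OF a'(1) bd'] C0 unfolding c_def by (simp add: divide_le_eq mult.commute)
  ultimately have "measure lebesgue (- contact (2 * ?a)) \<le> (1 - c) * measure lebesgue (- contact ?a)"
    by (simp add: algebra_simps)
  also have "\<dots> \<le> (1 - c) * ((1 - c) ^ k * measure lebesgue (ball (0::real^'n) 2))"
    using c1 Suc by (intro mult_left_mono) auto
  finally show ?case by (simp add: mult.assoc)
qed

end

section \<open>The estimate on the unit ball\<close>

lemma paraboloid_recenter:
  fixes x z :: "'a::real_inner"
  shows "c + p \<bullet> z - a / 2 * (norm z)\<^sup>2 =
    (c + p \<bullet> x - a / 2 * (norm x)\<^sup>2) + (p - a *\<^sub>R x) \<bullet> (z - x) - a / 2 * (norm (z - x))\<^sup>2"
proof -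
  have eq: "(norm (z - x))\<^sup>2 = (norm z)\<^sup>2 - 2 * (x \<bullet> z) + (norm x)\<^sup>2"
    by (simp add: power2_norm_eq_inner inner_diff_left inner_diff_right inner_commute[of z x])
  have "a / 2 * (norm (z - x))\<^sup>2 = a / 2 * (norm z)\<^sup>2 - a * (x \<bullet> z) + a / 2 * (norm x)\<^sup>2"
    unfolding eq by (simp add: field_simps)
  moreover have "(p - a *\<^sub>R x) \<bullet> (z - x) = p \<bullet> z - p \<bullet> x - a * (x \<bullet> z) + a * (norm x)\<^sup>2"
    by (simp add: inner_diff_left inner_diff_right power2_norm_eq_inner algebra_simps)
  ultimately show ?thesis by linarith
qed

text \<open>The paraboloid is written around the touching point: equality at \<open>x\<close> is
  built in, and the slope \<open>p\<close> is the only unknown.\<close>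

definition touched :: "(real^'n \<Rightarrow> real) \<Rightarrow> real \<Rightarrow> real^'n \<Rightarrow> bool" where
  "touched u a x \<longleftrightarrow> x \<in> ball 0 1 \<and>
     (\<exists>p. \<forall>z\<in>cball 0 1. u x + p \<bullet> (z - x) - a / 2 * (norm (z - x))\<^sup>2 \<le> u z)"

lemma tangent_paraboloid_iff_touched:
  fixes u :: "real^'n \<Rightarrow> real"
  shows "(\<exists>b c. tangent_below (\<lambda>y. c + b \<bullet> y - a / 2 * (norm y)\<^sup>2) u (ball 0 1) x) \<longleftrightarrow> touched u a x"
proof
  assume "\<exists>b c. tangent_below (\<lambda>y. c + b \<bullet> y - a / 2 * (norm y)\<^sup>2) u (ball 0 1) x"
  then obtain b c where "tangent_below (\<lambda>y. c + b \<bullet> y - a / 2 * (norm y)\<^sup>2) u (ball 0 1) x" by blast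
  then have bc: "x \<in> ball 0 1" "\<forall>z\<in>cball 0 1. c + b \<bullet> z - a / 2 * (norm z)\<^sup>2 \<le> u z"
      "c + b \<bullet> x - a / 2 * (norm x)\<^sup>2 = u x"
    by (simp_all add: tangent_below_def)
  have "u x + (b - a *\<^sub>R x) \<bullet> (z - x) - a / 2 * (norm (z - x))\<^sup>2 = c + b \<bullet> z - a / 2 * (norm z)\<^sup>2" for z
    using paraboloid_recenter[of c b z a x] bc(3) by simp
  then show "touched u a x"
    unfolding touched_def using bc(1,2) by (intro conjI exI[of _ "b - a *\<^sub>R x"]) auto
next
  assume "touched u a x"
  then obtain p where p: "x \<in> ball 0 1" "\<forall>z\<in>cball 0 1. u x + p \<bullet> (z - x) - a / 2 * (norm (z - x))\<^sup>2 \<le> u z"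
    unfolding touched_def by blast
  define b where "b = p + a *\<^sub>R x"
  define c where "c = u x - b \<bullet> x + a / 2 * (norm x)\<^sup>2"
  have "c + b \<bullet> z - a / 2 * (norm z)\<^sup>2 = u x + p \<bullet> (z - x) - a / 2 * (norm (z - x))\<^sup>2" for z
    unfolding paraboloid_recenter[of c b z a x] by (simp add: b_def c_def)
  moreover have "c + b \<bullet> x - a / 2 * (norm x)\<^sup>2 = u x" by (simp add: c_def)
  ultimately show "\<exists>b c. tangent_below (\<lambda>y. c + b \<bullet> y - a / 2 * (norm y)\<^sup>2) u (ball 0 1) x"
    using p unfolding tangent_below_def by (intro exI[of _ b] exI[of _ c]) auto
qed

lemma Theta_low_eq: "Theta_low u (ball 0 1) x = Inf (ereal ` {a. a \<ge> 0 \<and> touched u a x})"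
  unfolding Theta_low_def tangent_paraboloid_iff_touched ..

lemma touched_mono:
  assumes "touched u a x" "a \<le> b"
  shows "touched u b x"
proof -
  obtain p where p: "x \<in> ball 0 1" "\<forall>z\<in>cball 0 1. u x + p \<bullet> (z - x) - a / 2 * (norm (z - x))\<^sup>2 \<le> u z"
    using assms(1) unfolding touched_def by blast
  have "u x + p \<bullet> (z - x) - b / 2 * (norm (z - x))\<^sup>2 \<le> u z" if "z \<in> cball 0 1" for z
  proof -
    have "a / 2 * (norm (z - x))\<^sup>2 \<le> b / 2 * (norm (z - x))\<^sup>2" using assms(2) by (intro mult_right_mono) auto
    moreover have "u x + p \<bullet> (z - x) - a / 2 * (norm (z - x))\<^sup>2 \<le> u z" using p(2) that by blast
    ultimately show ?thesis by linarith
  qed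
  then show ?thesis using p(1) unfolding touched_def by blast
qed

text \<open>Countably many openings decreasing to \<open>K\<close> stand in for attainment of the
  infimum and give a Borel description of the superlevel sets.\<close>

lemma Theta_low_le_iff:
  assumes "K \<ge> 0"
  shows "Theta_low u (ball 0 1) x \<le> ereal K \<longleftrightarrow> (\<forall>j::nat. touched u (K + 1 / Suc j) x)"
proof
  assume le: "Theta_low u (ball 0 1) x \<le> ereal K"
  show "\<forall>j::nat. touched u (K + 1 / Suc j) x"
  proof
    fix j :: nat
    have "ereal K < ereal (K + 1 / Suc j)" by simp
    with le have "Inf (ereal ` {a. a \<ge> 0 \<and> touched u a x}) < ereal (K + 1 / Suc j)"
      unfolding Theta_low_eq by (rule le_less_trans)
    then obtain a where "touched u a x" "a < K + 1 / Suc j" by (auto simp: Inf_less_iff)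
    then show "touched u (K + 1 / Suc j) x" using touched_mono less_imp_le by blast
  qed
next
  assume t: "\<forall>j::nat. touched u (K + 1 / Suc j) x"
  show "Theta_low u (ball 0 1) x \<le> ereal K"
  proof (rule ereal_le_epsilon2)
    fix e :: real assume "0 < e"
    then obtain j where j: "1 / real (Suc j) < e" using nat_approx_posE by blast
    have "Theta_low u (ball 0 1) x \<le> ereal (K + 1 / Suc j)"
      unfolding Theta_low_eq using t assms by (intro Inf_lower) auto
    also have "\<dots> \<le> ereal K + ereal e" using j by simp
    finally show "Theta_low u (ball 0 1) x \<le> ereal K + ereal e" .
  qed
qed

text \<open>With slopes of norm at most \<open>R\<close>, the pairs of a point of the closed ball
  and a slope that satisfy the inequality form a compact set. The touched points are the part in the
  open ball of the countable union of its projections.\<close>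

lemma touched_borel:
  fixes u :: "real^'n \<Rightarrow> real"
  assumes u: "continuous_on (cball 0 1) u"
  shows "{x. touched u a x} \<in> sets borel"
proof -
  define C where "C R = {xp \<in> cball 0 1 \<times> cball (0::real^'n) (real R). \<forall>z\<in>cball 0 1.
     u (fst xp) + snd xp \<bullet> (z - fst xp) - a / 2 * (norm (z - fst xp))\<^sup>2 \<le> u z}" for R :: nat
  have "compact (C R)" for R
  proof -
    let ?B = "cball 0 1 \<times> cball (0::real^'n) (real R) :: ((real^'n) \<times> (real^'n)) set"
    have "C R = ?B \<inter> (\<Inter>z\<in>cball 0 1. {xp \<in> ?B. u (fst xp) + snd xp \<bullet> (z - fst xp) - a / 2 * (norm (z - fst xp))\<^sup>2 \<le> u z})"
      unfolding C_def by blast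
    moreover have "closed {xp \<in> ?B. u (fst xp) + snd xp \<bullet> (z - fst xp) - a / 2 * (norm (z - fst xp))\<^sup>2 \<le> u z}" for z
    proof (rule continuous_on_closed_Collect_le)
      show "continuous_on ?B (\<lambda>xp. u (fst xp) + snd xp \<bullet> (z - fst xp) - a / 2 * (norm (z - fst xp))\<^sup>2)"
        by (intro continuous_intros continuous_on_compose2[OF u]) auto
    qed (auto intro!: closed_Times)
    ultimately show ?thesis by (simp add: compact_Int_closed compact_Times closed_INT)
  qed
  then have "compact (fst ` C R)" for R by (intro compact_continuous_image continuous_intros)
  then have "fst ` C R \<in> sets borel" for R by (simp add: borel_compact)
  then have "ball 0 1 \<inter> (\<Union>R. fst ` C R) \<in> sets borel" by auto
  moreover have "{x. touched u a x} = ball 0 1 \<inter> (\<Union>R. fst ` C R)"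
  proof (intro set_eqI iffI)
    fix x assume "x \<in> {x. touched u a x}"
    then obtain p where p: "x \<in> ball 0 1" "\<forall>z\<in>cball 0 1. u x + p \<bullet> (z - x) - a / 2 * (norm (z - x))\<^sup>2 \<le> u z"
      by (auto simp: touched_def)
    obtain R :: nat where "norm p \<le> real R" using real_arch_simple by blast
    then have "(x, p) \<in> C R" using p by (auto simp: C_def)
    then have "x \<in> fst ` C R" by force
    then show "x \<in> ball 0 1 \<inter> (\<Union>R. fst ` C R)" using p by blast
  next
    fix x assume "x \<in> ball 0 1 \<inter> (\<Union>R. fst ` C R)"
    then show "x \<in> {x. touched u a x}" unfolding touched_def C_def by auto
  qed
  ultimately show ?thesis by simp
qed

lemma Theta_low_superlevel_borel:
  fixes u :: "real^'n \<Rightarrow> real"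
  assumes u: "continuous_on (cball 0 1) u" and K: "K \<ge> 0"
  shows "{x \<in> ball 0 1. Theta_low u (ball 0 1) x > ereal K} \<in> sets borel"
proof -
  have "{x \<in> ball 0 1. Theta_low u (ball 0 1) x > ereal K} = ball 0 1 - (\<Inter>j::nat. {x. touched u (K + 1 / Suc j) x})"
    using Theta_low_le_iff[OF K, of u] by (auto simp: not_le[symmetric])
  moreover have "(\<Inter>j::nat. {x. touched u (K + 1 / Suc j) x}) \<in> sets borel"
    by (intro sets.countable_INT'' touched_borel[OF u]) auto
  ultimately show ?thesis by auto
qed

lemma cball_bound_of_ball_Sup:
  fixes u :: "'a::euclidean_space \<Rightarrow> real"
  assumes u: "continuous_on (cball 0 1) u" and y: "y \<in> cball 0 1"
  shows "\<bar>u y\<bar> \<le> (SUP y\<in>ball 0 1. \<bar>u y\<bar>)"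
proof -
  have "compact ((\<lambda>y. \<bar>u y\<bar>) ` cball 0 1)"
    by (intro compact_continuous_image continuous_intros u compact_cball)
  then have "bdd_above ((\<lambda>y. \<bar>u y\<bar>) ` cball 0 1)" by (intro bounded_imp_bdd_above compact_imp_bounded)
  then have "bdd_above ((\<lambda>y. \<bar>u y\<bar>) ` ball 0 1)" by (rule bdd_above_mono) auto
  then have ub: "\<bar>u z\<bar> \<le> (SUP y\<in>ball 0 1. \<bar>u y\<bar>)" if "z \<in> ball 0 1" for z using that by (rule cSUP_upper[rotated])
  have cl: "closure (ball (0::'a) 1) = cball 0 1" by simp
  show ?thesis
    by (rule continuous_le_on_closure[of "ball 0 1" "\<lambda>y. \<bar>u y\<bar>" y])
      (use u y ub cl in \<open>auto intro!: continuous_intros\<close>)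
qed

text \<open>The barrier is at least \<open>M\<close> on the ball of radius \<open>1/2\<close> and at most \<open>-M\<close> where \<open>\<bar>x\<bar>\<^sup>2 \<ge> 1/2\<close>.\<close>
definition barrier :: "real \<Rightarrow> real^'n \<Rightarrow> real" where
  "barrier M x = 3 * M - 8 * M * (norm x)\<^sup>2"

definition barrier_min :: "(real^'n \<Rightarrow> real) \<Rightarrow> real \<Rightarrow> real^'n \<Rightarrow> real" where
  "barrier_min u M x = (if norm x \<le> 1 then min (u x) (barrier M x) else barrier M x)"

lemma barrier_add: "barrier M (x + h) = barrier M x - 16 * M * (x \<bullet> h) - 8 * M * (norm h)\<^sup>2"
  by (simp add: barrier_def power2_norm_eq_inner inner_add_left inner_add_right inner_commute[of h x] algebra_simps)

text \<open>Where \<open>?v\<close> meets the barrier, the quadratic also touches the concave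
  barrier from below, so \<open>N\<close> has no positive eigenvalue. Elsewhere
  \<open>?v = u\<close> at the point and \<open>?v \<le> u\<close> on the closed ball, so it touches
  \<open>u\<close>.\<close>

lemma barrier_min_supersolution:
  fixes u :: "real^'n \<Rightarrow> real"
  assumes \<Lambda>: "\<Lambda> \<ge> 1" and u: "continuous_on (cball 0 1) u" and sup: "visc_pucci_super \<Lambda> u (ball 0 1)"
    and M: "M > 0" and bd: "\<And>y. y \<in> cball 0 1 \<Longrightarrow> \<bar>u y\<bar> \<le> M"
  shows "pucci_supersolution (barrier_min u M) \<Lambda> (16 * M) (- M)"
proof
  let ?v = "barrier_min u M" and ?P = "barrier M"
  have contP: "continuous_on A ?P" for A unfolding barrier_def by (intro continuous_intros)
  \<comment> \<open>On the unit sphere the barrier equals -5M, below -M and hence below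
    \<open>u\<close>; this makes the two branches match.\<close>
  have edge: "?v x = ?P x" if "norm x = 1" for x
    using bd[of x] that M by (simp add: barrier_min_def barrier_def)
  have vP: "?v x \<le> ?P x" for x by (simp add: barrier_min_def)
  show "continuous_on UNIV ?v"
    unfolding barrier_min_def
  proof (rule continuous_on_cases_le)
    show "continuous_on {t \<in> UNIV. norm t \<le> 1} (\<lambda>x. min (u x) (?P x))"
      by (intro continuous_intros contP continuous_on_subset[OF u]) auto
    show "min (u t) (?P t) = ?P t" if "norm t = 1" for t
      using edge[OF that] that by (simp add: barrier_min_def)
  qed (auto intro!: contP continuous_intros)
  show "- M \<le> ?v x + 16 * M / 2 * (norm x)\<^sup>2" for x
  proof -
    have "0 \<le> 8 * M * (norm x)\<^sup>2" using M by simp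
    moreover have "norm x \<le> 1 \<Longrightarrow> - M \<le> u x" using bd[of x] by simp
    moreover have "16 * M / 2 * (norm x)\<^sup>2 = 8 * M * (norm x)\<^sup>2" by simp
    ultimately show ?thesis using M unfolding barrier_min_def barrier_def min_def
      by (simp only: split: if_split) linarith
  qed
  fix x p :: "real^'n" and N :: "real^'n^'n" and r :: real
  assume N: "transpose N = N" and r: "r > 0"
    and t: "\<And>h. norm h < r \<Longrightarrow> ?v x + p \<bullet> h + 1/2 * (h \<bullet> (N *v h)) \<le> ?v (x + h)"
  show "pucci_nonpos \<Lambda> N"
  proof (cases "?v x = ?P x")
    case True
    have neg: "h \<bullet> (N *v h) \<le> 0" if h: "norm h < r" for h
    proof -
      have "?P x + p \<bullet> h + 1/2 * (h \<bullet> (N *v h)) \<le> ?P x - 16 * M * (x \<bullet> h) - 8 * M * (norm h)\<^sup>2"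
        using t[OF h] vP[of "x + h"] by (simp add: True barrier_add)
      \<comment> \<open>Adding the inequalities for \<open>h\<close> and \<open>- h\<close> cancels
        all linear terms.\<close>
      moreover have "?P x - p \<bullet> h + 1/2 * (h \<bullet> (N *v h)) \<le> ?P x + 16 * M * (x \<bullet> h) - 8 * M * (norm h)\<^sup>2"
      proof -
        have "N *v (- h) = - (N *v h)" using matrix_vector_mult_diff_distrib[of N 0 h] by simp
        then show ?thesis using t[of "- h"] vP[of "x + - h"] h by (simp only: True barrier_add) simp
      qed
      moreover have "0 \<le> 8 * M * (norm h)\<^sup>2" using M by simp
      ultimately show ?thesis by linarith
    qed
    obtain e lam where e: "eigenbasis N e lam" using symmetric_eigenbasis_exists[OF N] .
    have lam0: "lam i \<le> 0" for i
    proof -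
      have ee: "e i \<bullet> e i = 1" "N *v e i = lam i *\<^sub>R e i" using e by (simp_all add: eigenbasis_def)
      then have "norm (e i) = 1" by (simp add: norm_eq_1)
      then have "norm ((r / 2) *\<^sub>R e i) < r" using r by simp
      from neg[OF this] have "(r / 2)\<^sup>2 * lam i \<le> 0"
        using ee by (simp add: matrix_vector_mult_scaleR power2_eq_square algebra_simps)
      then show ?thesis using r by (simp add: mult_le_0_iff)
    qed
    have "(\<Sum>i\<in>UNIV. if lam i > 0 then lam i else \<Lambda> * lam i) \<le> 0"
    proof (intro sum_nonpos)
      fix i
      have "\<Lambda> * lam i \<le> 0" using \<Lambda> lam0[of i] by (intro mult_nonneg_nonpos) auto
      then show "(if lam i > 0 then lam i else \<Lambda> * lam i) \<le> 0" using lam0[of i] by simp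
    qed
    then show ?thesis using e unfolding pucci_nonpos_def by blast
  next
    case False
    then have x1: "norm x \<le> 1" and vx: "?v x = u x" unfolding barrier_min_def by (auto simp: min_def split: if_splits)
    have "norm x \<noteq> 1" using False edge[of x] by blast
    then have xb: "x \<in> ball 0 1" using x1 by simp
    show ?thesis
    proof (rule pucci_nonpos_local_quadratic[OF u sup xb N r])
      fix h assume "norm h < r" "x + h \<in> cball 0 1"
      then show "u x + p \<bullet> h + 1/2 * (h \<bullet> (N *v h)) \<le> u (x + h)"
        using t[of h] vx by (simp add: barrier_min_def)
    qed
  qed
qed (use \<Lambda> M in auto)

text \<open>Far out, the tangent paraboloid to the barrier with twice its opening gains an extra 8M
  |h|^2. From a point with norm at least 2 to the unit ball this is at least 8M, which brings the
  barrier's maximum 3M down below -M and hence below \<open>u\<close>.\<close>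

lemma barrier_min_noncontact:
  fixes u :: "real^'n \<Rightarrow> real"
  assumes S: "pucci_supersolution (barrier_min u M) \<Lambda> (16 * M) (- M)"
    and M: "M > 0" and bd: "\<And>y. y \<in> cball 0 1 \<Longrightarrow> \<bar>u y\<bar> \<le> M"
  shows "- pucci_supersolution.contact (barrier_min u M) (32 * M) \<subseteq> ball 0 2"
proof -
  interpret pucci_supersolution "barrier_min u M" \<Lambda> "16 * M" "- M" by (rule S)
  have "x \<in> contact (32 * M)" if x: "norm x \<ge> 2" for x
  proof (rule subgrad_va_imp_contact(1))
    \<comment> \<open>The gradient of the barrier at \<open>x\<close> is -16M x; the summand 32M x
      is the shift between slopes of \<open>v\<close> and subgradients of \<open>va\<close>.\<close>
    show "is_subgrad (va (32 * M)) x ((- 16 * M) *\<^sub>R x + (32 * M) *\<^sub>R x)"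
      unfolding subgrad_va_iff
    proof
      fix h
      have vx: "barrier_min u M x = barrier M x" using x by (simp add: barrier_min_def)
      have "barrier M (x + h) - 8 * M * (norm h)\<^sup>2 \<le> barrier_min u M (x + h)"
      proof (cases "norm (x + h) \<le> 1")
        case True
        have "norm h \<ge> 1" using norm_triangle_ineq4[of "x + h" h] True x by simp
        then have "8 * M * 1 \<le> 8 * M * (norm h)\<^sup>2" using M by (intro mult_left_mono) (auto simp: one_le_power)
        moreover have "0 \<le> 8 * M * (norm (x + h))\<^sup>2" using M by simp
        moreover have "- M \<le> u (x + h)" using bd[of "x + h"] True by simp
        ultimately have "barrier M (x + h) - 8 * M * (norm h)\<^sup>2 \<le> u (x + h)"
          using M unfolding barrier_def by linarith
        moreover have "0 \<le> 8 * M * (norm h)\<^sup>2" using M by simp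
        ultimately show ?thesis using True by (simp add: barrier_min_def)
      next
        case False
        then show ?thesis using M by (simp add: barrier_min_def)
      qed
      then show "barrier_min u M x + ((- 16 * M) *\<^sub>R x + (32 * M) *\<^sub>R x - (32 * M) *\<^sub>R x) \<bullet> h - 32 * M / 2 * (norm h)\<^sup>2
          \<le> barrier_min u M (x + h)"
        by (simp add: vx barrier_add)
    qed
  qed (use M in simp)
  then show ?thesis by (force simp: not_le[symmetric])
qed

text \<open>On the half ball the barrier is at least M, so \<open>barrier_min u M\<close> equals
  \<open>u\<close> at \<open>x\<close>; being at most \<open>u\<close> on the closed unit ball, it
  passes its touching paraboloids on to \<open>u\<close>.\<close>

lemma contact_imp_touched:
  fixes u :: "real^'n \<Rightarrow> real"
  assumes S: "pucci_supersolution (barrier_min u M) \<Lambda> (16 * M) (- M)"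
    and M: "M > 0" and bd: "\<And>y. y \<in> cball 0 1 \<Longrightarrow> \<bar>u y\<bar> \<le> M" and a: "16 * M \<le> a"
    and x: "x \<in> ball 0 (1/2)" "x \<in> pucci_supersolution.contact (barrier_min u M) a"
  shows "touched u a x"
proof -
  interpret pucci_supersolution "barrier_min u M" \<Lambda> "16 * M" "- M" by (rule S)
  have nx: "norm x < 1 / 2" using x by simp
  then have "(norm x)\<^sup>2 \<le> (1/2)\<^sup>2" by (intro power_mono) auto
  then have "8 * M * (norm x)\<^sup>2 \<le> 8 * M * (1/4)" using M by (intro mult_left_mono) (auto simp: power2_eq_square)
  then have "u x \<le> barrier M x" using bd[of x] nx by (simp add: barrier_def)
  then have vx: "barrier_min u M x = u x" using nx by (simp add: barrier_min_def)
  obtain p where "is_subgrad (va a) x p" using contact_subgrad_exists[OF a x(2)] .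
  then have p: "u x + (p - a *\<^sub>R x) \<bullet> h - a / 2 * (norm h)\<^sup>2 \<le> barrier_min u M (x + h)" for h
    unfolding subgrad_va_iff vx by blast
  have "u x + (p - a *\<^sub>R x) \<bullet> (z - x) - a / 2 * (norm (z - x))\<^sup>2 \<le> u z" if "z \<in> cball 0 1" for z
    using p[of "z - x"] that by (simp add: barrier_min_def)
  then show ?thesis unfolding touched_def using nx by (intro conjI exI[of _ "p - a *\<^sub>R x"]) auto
qed

text \<open>\<open>k\<close> is the integer part of \<open>log 2 (2 * t)\<close>, hence at least
  \<open>log 2 t\<close> and so at least \<open>ln t\<close>; with 1 - c at most exp (- c) this
  gives the power of \<open>t\<close>.\<close>

lemma decay_rate_le:
  fixes t c :: real
  assumes t: "t \<ge> 2" and c: "0 \<le> c" "c \<le> 1"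
  obtains k :: nat where "2 ^ k \<le> 2 * t" "(1 - c) ^ k \<le> t powr (- (c / 2))"
proof -
  define k where "k = nat \<lfloor>log 2 (2 * t)\<rfloor>"
  have l1: "log 2 (2 * t) = 1 + log 2 t" using t by (simp add: log_mult)
  have l0: "log 2 t \<ge> 0" using t by simp
  have k: "real k \<le> log 2 (2 * t)" "log 2 t \<le> real k"
  proof -
    have "real k = of_int \<lfloor>log 2 (2 * t)\<rfloor>" unfolding k_def using l0 l1 by (intro of_nat_nat) simp
    then show "real k \<le> log 2 (2 * t)" "log 2 t \<le> real k" using l1 by linarith+
  qed
  have "2 ^ k = 2 powr real k" by (simp add: powr_realpow)
  also have "\<dots> \<le> 2 powr log 2 (2 * t)" using k by simp
  also have "\<dots> = 2 * t" using t by simp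
  finally have 1: "2 ^ k \<le> 2 * t" .
  have "ln 2 \<le> (1::real)" using ln_2_less_1 by simp
  then have "ln t \<le> log 2 t" using t by (simp add: log_def field_simps mult_left_le)
  then have "c / 2 * ln t \<le> c * real k"
    using k(2) c t mult_left_mono[of "ln t" "real k" c] by (smt (verit) divide_nonneg_nonneg field_sum_of_halves ln_ge_zero mult_right_mono)
  then have "exp (- c) ^ k \<le> t powr (- (c / 2))"
    using t by (simp add: powr_def exp_of_nat_mult[symmetric] mult.commute)
  moreover have "(1 - c) ^ k \<le> exp (- c) ^ k" using c exp_ge_add_one_self[of "- c"] by (intro power_mono) auto
  ultimately have "(1 - c) ^ k \<le> t powr (- (c / 2))" by linarith
  with 1 show thesis by (rule that)
qed

theorem theorem2p1:
  fixes u :: "real^'n \<Rightarrow> real" and \<Lambda> t :: real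
  assumes "\<Lambda> \<ge> 1"
    and "continuous_on (cball 0 1) u"
    and "visc_pucci_super \<Lambda> u (ball 0 1)"
    and "t \<ge> 2"
  shows "{x \<in> ball 0 1. Theta_low u (ball 0 1) x >
            ereal (64 * (SUP y\<in>ball 0 1. \<bar>u y\<bar>) * t)} \<inter> ball 0 (1/2) \<in> sets lebesgue
       \<and> measure lebesgue ({x \<in> ball 0 1. Theta_low u (ball 0 1) x >
            ereal (64 * (SUP y\<in>ball 0 1. \<bar>u y\<bar>) * t)} \<inter> ball 0 (1/2))
         \<le> measure lebesgue (ball (0::real^'n) 2)
            * t powr (- ((1/4) * (2 * real CARD('n) * \<Lambda>) powr (1 - real CARD('n))))"
proof -
  define M where "M = (SUP y\<in>ball 0 1. \<bar>u y\<bar>)"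
  let ?K = "64 * M * t"
  let ?E = "{x \<in> ball 0 1. Theta_low u (ball 0 1) x > ereal ?K} \<inter> ball 0 (1/2)"
  have bd: "\<bar>u y\<bar> \<le> M" if "y \<in> cball 0 1" for y
    unfolding M_def by (rule cball_bound_of_ball_Sup[OF assms(2) that])
  have M0: "M \<ge> 0" using bd[of 0] by simp
  have K0: "?K \<ge> 0" using M0 assms(4) by simp
  have borel: "?E \<in> sets borel" using Theta_low_superlevel_borel[OF assms(2) K0] by auto
  then have "?E \<in> sets lborel" by (simp only: sets_lborel)
  then have Es: "?E \<in> sets lebesgue" by (rule sets_completionI_sets)
  have rhs0: "0 \<le> measure lebesgue (ball (0::real^'n) 2)
            * t powr (- ((1/4) * (2 * real CARD('n) * \<Lambda>) powr (1 - real CARD('n))))" by simp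
  have "measure lebesgue ?E \<le> measure lebesgue (ball (0::real^'n) 2)
            * t powr (- ((1/4) * (2 * real CARD('n) * \<Lambda>) powr (1 - real CARD('n))))"
  proof (cases "M = 0")
    \<comment> \<open>The barrier construction needs a positive \<open>M\<close>. Here
      \<open>u\<close> vanishes, opening 0 touches it at every point, and the superlevel set is
      empty.\<close>
    case True
    then have "touched u 0 x" if "x \<in> ball 0 1" for x
      using bd that unfolding touched_def by (intro conjI exI[of _ 0]) auto
    then have "Theta_low u (ball 0 1) x \<le> ereal 0" if "x \<in> ball 0 1" for x
      unfolding Theta_low_eq using that by (intro Inf_lower) auto
    then have "?E = {}" using True by (auto simp: not_le[symmetric])
    then show ?thesis using rhs0 by simp
  next
    case False
    then have M: "M > 0" using M0 by simp
    note S = barrier_min_supersolution[OF assms(1-3) M bd]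
    interpret pucci_supersolution "barrier_min u M" \<Lambda> "16 * M" "- M" by (rule S)
    define c where "c = 1 / (2 ^ CARD('n) * (real CARD('n) * \<Lambda>) ^ (CARD('n) - 1))"
    have n\<Lambda>: "1 \<le> real CARD('n) * \<Lambda>" using assms(1) mult_mono[of 1 "real CARD('n)" 1 \<Lambda>] by (simp add: Suc_le_eq)
    have "1 * 1 \<le> 2 ^ CARD('n) * (real CARD('n) * \<Lambda>) ^ (CARD('n) - 1)"
      using n\<Lambda> by (intro mult_mono one_le_power) auto
    then have c: "0 \<le> c" "c \<le> 1" by (auto simp: c_def divide_le_eq_1)
    \<comment> \<open>Both sides equal 1 / (2^(n+1) (n \<Lambda>)^(n-1)).\<close>
    have ceq: "(1/4) * (2 * real CARD('n) * \<Lambda>) powr (1 - real CARD('n)) = c / 2"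
    proof -
      have n1: "CARD('n) = Suc (CARD('n) - 1)" by simp
      have "(2 * real CARD('n) * \<Lambda>) powr (1 - real CARD('n)) = (2 * real CARD('n) * \<Lambda>) powr (- real (CARD('n) - 1))"
        by (simp add: of_nat_diff Suc_le_eq)
      also have "\<dots> = 1 / (2 * real CARD('n) * \<Lambda>) ^ (CARD('n) - 1)"
      proof -
        have "2 * real CARD('n) * \<Lambda> > 0" using n\<Lambda> by linarith
        then show ?thesis by (simp only: powr_minus_divide powr_realpow)
      qed
      also have "(2 * real CARD('n) * \<Lambda>) ^ (CARD('n) - 1) = 2 ^ (CARD('n) - 1) * (real CARD('n) * \<Lambda>) ^ (CARD('n) - 1)"
        by (simp only: power_mult_distrib mult.assoc)
      finally have "(2 * real CARD('n) * \<Lambda>) powr (1 - real CARD('n)) = 1 / (2 ^ (CARD('n) - 1) * (real CARD('n) * \<Lambda>) ^ (CARD('n) - 1))" .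
      moreover have "(2::real) ^ CARD('n) = 2 * 2 ^ (CARD('n) - 1)" by (subst n1) (simp only: power_Suc)
      ultimately show ?thesis by (simp add: c_def)
    qed
    obtain k where k: "2 ^ k \<le> 2 * t" "(1 - c) ^ k \<le> t powr (- (c / 2))"
      using decay_rate_le[OF assms(4) c] .
    let ?a = "2 ^ k * (32 * M)"
    have "1 * (32 * M) \<le> ?a" using M by (intro mult_right_mono) auto
    then have a: "16 * M \<le> ?a" using M by linarith
    have "?a \<le> 2 * t * (32 * M)" using k M by (intro mult_right_mono) auto
    then have aK: "?a \<le> ?K" by simp
    have nc: "- contact (32 * M) \<subseteq> ball 0 2" by (rule barrier_min_noncontact[OF S M bd])
    have sub: "?E \<subseteq> - contact ?a"
    proof
      fix x assume x: "x \<in> ?E"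
      show "x \<in> - contact ?a"
      proof
        assume "x \<in> contact ?a"
        then have "touched u ?a x" using contact_imp_touched[OF S M bd a] x by blast
        then have "Theta_low u (ball 0 1) x \<le> ereal ?a"
          unfolding Theta_low_eq using M by (intro Inf_lower) auto
        also have "\<dots> \<le> ereal ?K" using aK by simp
        finally show False using x by (simp add: not_le[symmetric])
      qed
    qed
    have "contact (32 * M) \<subseteq> contact ?a"
      using M \<open>1 * (32 * M) \<le> ?a\<close> by (intro contact_mono) auto
    then have "- contact ?a \<subseteq> ball 0 2" using nc by blast
    then have "bounded (- contact ?a)" by (rule bounded_subset[OF bounded_ball])
    then have lm: "- contact ?a \<in> lmeasurable"
      using closed_contact[OF a] by (intro bounded_set_imp_lmeasurable) auto
    have "measure lebesgue ?E \<le> measure lebesgue (- contact ?a)"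
      by (rule measure_mono_fmeasurable[OF sub Es lm])
    also have "\<dots> \<le> (1 - c) ^ k * measure lebesgue (ball (0::real^'n) 2)"
      unfolding c_def using M by (intro noncontact_measure_decay nc) auto
    also have "\<dots> \<le> t powr (- (c / 2)) * measure lebesgue (ball (0::real^'n) 2)"
      by (rule mult_right_mono[OF k(2) measure_nonneg])
    finally show ?thesis by (simp only: ceq mult.commute[of "measure lebesgue (ball (0::real^'n) 2)"])
  qed
  then show ?thesis using Es unfolding M_def by (intro conjI)
qed

end
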